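(* Let $-\infty<a<b<\infty$, let $k>0$, let $H=L^2[a,b]$, and let $A$ be the self-adjoint operator in $H$ given by $Af=-f''+kf$ on the domain $$\mathcal{D}(A)=\{f:[a,b]\to\mathbb{C}\mid f,f'\in AC[a,b];\ f''\in L^2[a,b];\ f(a)=-f(b);\ f'(a)=-f'(b)\}.$$ For each $n\in\mathbb{N}$, let $H_n=(V_n,(\cdot,\cdot)_n)$, where $$V_n:=\{f:[a,b]\to\mathbb{C}\mid f^{(j)}\in AC[a,b],\ f^{(j)}(a)=-f^{(j)}(b)\ (j=0,1,\ldots,n-1);\ f^{(n)}\in L^2[a,b]\}$$ and $$(f,g)_n:=\sum_{j=0}^{n}\binom{n}{j}k^{n-j}\int_a^b f^{(j)}(x)\,\overline{g}^{(j)}(x)\,dx\quad(f,g\in V_n).$$ Then, for each $n\in\mathbb{N}$, $H_n$ is the $n^{th}$ left-definite space associated with the pair $(H,A)$.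
   Context: $\mathbb{N}=\{1,2,3,\ldots\}$. $L^2[a,b]$ is the complex Hilbert space with $(f,g)_{L^2[a,b]}=\int_a^b f(x)\overline{g}(x)\,dx$; $AC[a,b]$ denotes the complex-valued absolutely continuous functions on $[a,b]$. Functions are identified with their classes in $L^2[a,b]$. The operator $A$ is self-adjoint in $H$ and is bounded below by $kI$, i.e. $(Af,f)_{L^2[a,b]}\ge k(f,f)_{L^2[a,b]}$ for $f\in\mathcal{D}(A)$. Definition (left-definite space). Let $A$ be a self-adjoint operator in a Hilbert space $H$ with inner product $(\cdot,\cdot)$, bounded below by $kI$ for some $k>0$, and let $r>0$. Let $V_r$ be a linear manifold (vector subspace) of $H$ and $(\cdot,\cdot)_r$ an inner product on $V_r$. Then $H_r=(V_r,(\cdot,\cdot)_r)$ is an $r^{th}$ left-definite space associated with $(H,A)$ if: (1) $H_r$ is a Hilbert space; (2) $\mathcal{D}(A^r)$ is a linear manifold of $V_r$; (3) $\mathcal{D}(A^r)$ is dense in $H_r$; (4) $(x,x)_r\ge k^r(x,x)$ for all $x\in V_r$; (5) $(x,y)_r=(A^rx,y)$ for all $x\in\mathcal{D}(A^r)$, $y\in V_r$. It is a known theorem (Littlejohn–Wellman) that for each $r>0$ the $r^{th}$ left-definite space exists and is unique, which is why one says "the" $r^{th}$ left-definite space; it is given by $V_r=\mathcal{D}(A^{r/2})$, $(x,y)_r=(A^{r/2}x,A^{r/2}y)$. *)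

theory Defs
  imports "HOL-Analysis.Analysis"
begin

section \<open>Complex Hilbert spaces carried by a subset of a vector space\<close>

text \<open>
  Throughout, \<open>s\<close> is the scalar multiplication of an ambient complex vector space, and an inner
  product on a subspace \<open>V\<close> is a function of which only the values on \<open>V\<close> matter. As in the
  analytic convention, inner products are linear in the first argument.
\<close>

definition inner_product_on ::
  "(complex \<Rightarrow> 'v \<Rightarrow> 'v::ab_group_add) \<Rightarrow> 'v set \<Rightarrow> ('v \<Rightarrow> 'v \<Rightarrow> complex) \<Rightarrow> bool" where
  "inner_product_on s V ip \<longleftrightarrow>
     (\<forall>x\<in>V. \<forall>y\<in>V. \<forall>z\<in>V. ip (x + y) z = ip x z + ip y z) \<and>
     (\<forall>c. \<forall>x\<in>V. \<forall>y\<in>V. ip (s c x) y = c * ip x y) \<and>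
     (\<forall>x\<in>V. \<forall>y\<in>V. ip y x = cnj (ip x y)) \<and>
     (\<forall>x\<in>V. 0 \<le> Re (ip x x)) \<and>
     (\<forall>x\<in>V. ip x x = 0 \<longrightarrow> x = 0)"

definition ip_norm :: "('v \<Rightarrow> 'v \<Rightarrow> complex) \<Rightarrow> 'v \<Rightarrow> real" where
  "ip_norm ip x = sqrt (Re (ip x x))"

definition hilbert_space ::
  "(complex \<Rightarrow> 'v \<Rightarrow> 'v::ab_group_add) \<Rightarrow> 'v set \<Rightarrow> ('v \<Rightarrow> 'v \<Rightarrow> complex) \<Rightarrow> bool" where
  "hilbert_space s V ip \<longleftrightarrow>
     vector_space s \<and> module.subspace s V \<and> inner_product_on s V ip \<and>
     (\<forall>X :: nat \<Rightarrow> 'v.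
        range X \<subseteq> V \<and> (\<forall>e>0. \<exists>M. \<forall>m\<ge>M. \<forall>n\<ge>M. ip_norm ip (X m - X n) < e)
          \<longrightarrow> (\<exists>x\<in>V. (\<lambda>n. ip_norm ip (X n - x)) \<longlonglongrightarrow> 0))"

definition dense_in_ip :: "('v \<Rightarrow> 'v::ab_group_add \<Rightarrow> complex) \<Rightarrow> 'v set \<Rightarrow> 'v set \<Rightarrow> bool" where
  "dense_in_ip ip V D \<longleftrightarrow> D \<subseteq> V \<and> (\<forall>x\<in>V. \<forall>e>0. \<exists>y\<in>D. ip_norm ip (x - y) < e)"


section \<open>Unbounded operators\<close>

text \<open>
  An operator is identified with its graph, a set of pairs \<open>(x, A x)\<close>. Its domain is then
  \<^term>\<open>Domain A\<close>, and its \<open>n\<close>-th power, with the maximal domain, is the relation power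
  \<^term>\<open>A ^^ n\<close>.
\<close>

definition linear_operator ::
  "(complex \<Rightarrow> 'v \<Rightarrow> 'v::ab_group_add) \<Rightarrow> 'v set \<Rightarrow> ('v \<times> 'v) set \<Rightarrow> bool" where
  "linear_operator s H A \<longleftrightarrow>
     A \<subseteq> H \<times> H \<and> single_valued A \<and> (0, 0) \<in> A \<and>
     (\<forall>(x, u)\<in>A. \<forall>(y, v)\<in>A. (x + y, u + v) \<in> A) \<and>
     (\<forall>c. \<forall>(x, u)\<in>A. (s c x, s c u) \<in> A)"

definition adjoint_operator ::
  "'v set \<Rightarrow> ('v \<Rightarrow> 'v \<Rightarrow> complex) \<Rightarrow> ('v \<times> 'v) set \<Rightarrow> ('v \<times> 'v) set" where
  "adjoint_operator H ip A = {(y, z) \<in> H \<times> H. \<forall>(x, w)\<in>A. ip w y = ip x z}"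

definition self_adjoint ::
  "(complex \<Rightarrow> 'v \<Rightarrow> 'v::ab_group_add) \<Rightarrow> 'v set \<Rightarrow> ('v \<Rightarrow> 'v \<Rightarrow> complex) \<Rightarrow> ('v \<times> 'v) set \<Rightarrow> bool"
  where
  "self_adjoint s H ip A \<longleftrightarrow>
     linear_operator s H A \<and> dense_in_ip ip H (Domain A) \<and> adjoint_operator H ip A = A"

text \<open>For self-adjoint \<open>A\<close> the number \<open>(Ax, x)\<close> is real, so that taking real parts loses nothing.\<close>

definition bounded_below ::
  "('v \<Rightarrow> 'v \<Rightarrow> complex) \<Rightarrow> ('v \<times> 'v) set \<Rightarrow> real \<Rightarrow> bool" where
  "bounded_below ip A k \<longleftrightarrow> (\<forall>(x, w)\<in>A. k * Re (ip x x) \<le> Re (ip w x))"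


section \<open>Left-definite spaces\<close>

text \<open>
  The definition makes sense for real \<open>r > 0\<close> once \<open>A\<^sup>r\<close> is defined by the spectral theorem; here
  \<open>r\<close> is a positive integer and \<open>A\<^sup>r\<close> is the iterated composition of \<open>A\<close>. The standing
  assumptions on \<open>(H, A)\<close> and \<open>k\<close> are part of the predicate.
\<close>

definition left_definite_space ::
  "(complex \<Rightarrow> 'v \<Rightarrow> 'v::ab_group_add) \<Rightarrow> 'v set \<Rightarrow> ('v \<Rightarrow> 'v \<Rightarrow> complex) \<Rightarrow> ('v \<times> 'v) set \<Rightarrow> real
     \<Rightarrow> nat \<Rightarrow> 'v set \<Rightarrow> ('v \<Rightarrow> 'v \<Rightarrow> complex) \<Rightarrow> bool" where
  "left_definite_space s H ip A k r V ipr \<longleftrightarrow>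
     hilbert_space s H ip \<and> self_adjoint s H ip A \<and> 0 < k \<and> bounded_below ip A k \<and>
     0 < r \<and> V \<subseteq> H \<and> hilbert_space s V ipr \<and>
     module.subspace s (Domain (A ^^ r)) \<and> Domain (A ^^ r) \<subseteq> V \<and>
     dense_in_ip ipr V (Domain (A ^^ r)) \<and>
     (\<forall>x\<in>V. k ^ r * Re (ip x x) \<le> Re (ipr x x)) \<and>
     (\<forall>(x, w)\<in>A ^^ r. \<forall>y\<in>V. ipr x y = ip w y)"


section \<open>The Hilbert space of square-integrable functions on an interval\<close>

quotient_type fclass = "real \<Rightarrow> complex" / "\<lambda>f g. AE x in lebesgue. f x = g x"
proof (rule equivpI)
  show "reflp (\<lambda>f g :: real \<Rightarrow> complex. AE x in lebesgue. f x = g x)"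
    by (rule reflpI) simp
  show "symp (\<lambda>f g :: real \<Rightarrow> complex. AE x in lebesgue. f x = g x)"
  proof (rule sympI)
    fix f g :: "real \<Rightarrow> complex"
    assume "AE x in lebesgue. f x = g x"
    then show "AE x in lebesgue. g x = f x" by eventually_elim simp
  qed
  show "transp (\<lambda>f g :: real \<Rightarrow> complex. AE x in lebesgue. f x = g x)"
  proof (rule transpI)
    fix f g h :: "real \<Rightarrow> complex"
    assume "AE x in lebesgue. f x = g x" "AE x in lebesgue. g x = h x"
    then show "AE x in lebesgue. f x = h x" by eventually_elim simp
  qed
qed

instantiation fclass :: ab_group_add
begin

lift_definition zero_fclass :: fclass is "\<lambda>x. 0" .
lift_definition plus_fclass :: "fclass \<Rightarrow> fclass \<Rightarrow> fclass" is "\<lambda>f g x. f x + g x"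
  subgoal premises prems using prems by eventually_elim simp
  done
lift_definition minus_fclass :: "fclass \<Rightarrow> fclass \<Rightarrow> fclass" is "\<lambda>f g x. f x - g x"
  subgoal premises prems using prems by eventually_elim simp
  done
lift_definition uminus_fclass :: "fclass \<Rightarrow> fclass" is "\<lambda>f x. - f x"
  subgoal premises prems using prems by eventually_elim simp
  done

instance
  by standard (transfer; simp add: algebra_simps)+

end

lift_definition scale_fclass :: "complex \<Rightarrow> fclass \<Rightarrow> fclass" is "\<lambda>c f x. c * f x"
  subgoal premises prems using prems by eventually_elim simp
  done

lemma vector_space_scale_fclass: "vector_space scale_fclass"
  by standard (transfer; simp add: algebra_simps)+

text \<open>
  A function on \<open>[a, b]\<close> is a function on the reals whose values outside \<open>[a, b]\<close> are ignored; its
  class is that of its extension by zero.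
\<close>

lift_definition class_on :: "real \<Rightarrow> real \<Rightarrow> (real \<Rightarrow> complex) \<Rightarrow> fclass" is
  "\<lambda>a b f x. if x \<in> {a..b} then f x else 0" .

definition square_integrable :: "real \<Rightarrow> real \<Rightarrow> (real \<Rightarrow> complex) \<Rightarrow> bool" where
  "square_integrable a b f \<longleftrightarrow>
     f \<in> borel_measurable (lebesgue_on {a..b}) \<and>
     integrable (lebesgue_on {a..b}) (\<lambda>x. (cmod (f x))\<^sup>2)"

definition L2 :: "real \<Rightarrow> real \<Rightarrow> fclass set" where
  "L2 a b = class_on a b ` {f. square_integrable a b f}"

lift_definition L2_inner :: "real \<Rightarrow> real \<Rightarrow> fclass \<Rightarrow> fclass \<Rightarrow> complex" is
  "\<lambda>a b f g. integral\<^sup>L (lebesgue_on {a..b}) (\<lambda>x. f x * cnj (g x))"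
proof -
  fix a b :: real and f f' g g' :: "real \<Rightarrow> complex"
  assume "AE x in lebesgue. f x = f' x" "AE x in lebesgue. g x = g' x"
  then have ae: "AE x in lebesgue. indicator {a..b} x *\<^sub>R (f x * cnj (g x))
                                  = indicator {a..b} x *\<^sub>R (f' x * cnj (g' x))"
    by eventually_elim simp
  have "integral\<^sup>L lebesgue (\<lambda>x. indicator {a..b} x *\<^sub>R (f x * cnj (g x)))
      = integral\<^sup>L lebesgue (\<lambda>x. indicator {a..b} x *\<^sub>R (f' x * cnj (g' x)))"
    (is "integral\<^sup>L _ ?u = integral\<^sup>L _ ?v")
  proof (cases "?u \<in> borel_measurable lebesgue")
    case True
    then show ?thesis
      using borel_measurable_AE[OF True ae] ae by (intro integral_cong_AE)
  next
    case False
    have "AE x in lebesgue. ?v x = ?u x"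
      using ae by eventually_elim (rule sym)
    then have v: "?v \<notin> borel_measurable lebesgue"
      using False borel_measurable_AE[of ?v ?u] by argo
    have "\<not> integrable lebesgue ?u" "\<not> integrable lebesgue ?v"
      using False v borel_measurable_integrable[of lebesgue ?u]
        borel_measurable_integrable[of lebesgue ?v] by argo+
    then show ?thesis
      using not_integrable_integral_eq[of lebesgue ?u] not_integrable_integral_eq[of lebesgue ?v]
      by argo
  qed
  then show "integral\<^sup>L (lebesgue_on {a..b}) (\<lambda>x. f x * cnj (g x))
           = integral\<^sup>L (lebesgue_on {a..b}) (\<lambda>x. f' x * cnj (g' x))"
    by (simp add: integral_restrict_space)
qed


section \<open>Absolutely continuous functions and the operator\<close>

text \<open>\<^term>\<open>d division_of S\<close> ranges over the finite families of non-overlapping closed intervals.\<close>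

definition AC_on :: "real \<Rightarrow> real \<Rightarrow> (real \<Rightarrow> complex) \<Rightarrow> bool" where
  "AC_on a b f \<longleftrightarrow>
     (\<forall>\<epsilon>>0. \<exists>\<delta>>0. \<forall>d S. d division_of S \<and> S \<subseteq> {a..b} \<and> (\<Sum>K\<in>d. Sup K - Inf K) < \<delta>
        \<longrightarrow> (\<Sum>K\<in>d. cmod (f (Sup K) - f (Inf K))) < \<epsilon>)"

text \<open>
  \<open>f\<^sup>(\<^sup>j\<^sup>)\<close>, one-sided at the endpoints. At points where no derivative exists the value is
  unspecified. This is harmless below: if \<open>f\<close> and \<open>deriv_on a b 1 f\<close> are both absolutely
  continuous on \<open>[a, b]\<close>, then \<open>f\<close> is an integral of \<open>deriv_on a b 1 f\<close>, which is
  therefore its derivative everywhere on \<open>[a, b]\<close>.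
\<close>

definition deriv_on :: "real \<Rightarrow> real \<Rightarrow> nat \<Rightarrow> (real \<Rightarrow> complex) \<Rightarrow> real \<Rightarrow> complex" where
  "deriv_on a b j f = ((\<lambda>g x. vector_derivative g (at x within {a..b})) ^^ j) f"

definition dom_A :: "real \<Rightarrow> real \<Rightarrow> (real \<Rightarrow> complex) set" where
  "dom_A a b = {f. AC_on a b f \<and> AC_on a b (deriv_on a b 1 f) \<and>
                   square_integrable a b (deriv_on a b 2 f) \<and>
                   f a = - f b \<and> deriv_on a b 1 f a = - deriv_on a b 1 f b}"

definition op_A :: "real \<Rightarrow> real \<Rightarrow> real \<Rightarrow> (fclass \<times> fclass) set" where
  "op_A a b k = {(class_on a b f, class_on a b (\<lambda>x. - deriv_on a b 2 f x + of_real k * f x)) |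
                 f. f \<in> dom_A a b}"

definition V_fun :: "real \<Rightarrow> real \<Rightarrow> nat \<Rightarrow> (real \<Rightarrow> complex) set" where
  "V_fun a b n = {f. (\<forall>j<n. AC_on a b (deriv_on a b j f) \<and>
                            deriv_on a b j f a = - deriv_on a b j f b) \<and>
                     square_integrable a b (deriv_on a b n f)}"

definition V_space :: "real \<Rightarrow> real \<Rightarrow> nat \<Rightarrow> fclass set" where
  "V_space a b n = class_on a b ` V_fun a b n"

text \<open>For \<open>n \<ge> 1\<close> the representative is continuous, hence unique on \<open>[a, b]\<close>.\<close>

definition V_rep :: "real \<Rightarrow> real \<Rightarrow> nat \<Rightarrow> fclass \<Rightarrow> real \<Rightarrow> complex" where
  "V_rep a b n u = (SOME f. f \<in> V_fun a b n \<and> class_on a b f = u)"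

definition V_inner_fun ::
  "real \<Rightarrow> real \<Rightarrow> real \<Rightarrow> nat \<Rightarrow> (real \<Rightarrow> complex) \<Rightarrow> (real \<Rightarrow> complex) \<Rightarrow> complex" where
  "V_inner_fun a b k n f g =
     (\<Sum>j=0..n. of_nat (n choose j) * of_real k ^ (n - j) *
        integral\<^sup>L (lebesgue_on {a..b}) (\<lambda>x. deriv_on a b j f x * cnj (deriv_on a b j g x)))"

definition V_inner :: "real \<Rightarrow> real \<Rightarrow> real \<Rightarrow> nat \<Rightarrow> fclass \<Rightarrow> fclass \<Rightarrow> complex" where
  "V_inner a b k n u v = V_inner_fun a b k n (V_rep a b n u) (V_rep a b n v)"

end

theory Submission
  imports Defs
begin

text \<open>
  Let \<open>T g\<close> be the primitive of \<open>g\<close> with antiperiodic boundary values. On \<open>L\<^sup>2[a, b]\<close> it is bounded,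
  injective and skew-symmetric. The functions in \<open>V\<^sub>n\<close> are exactly the \<open>T\<^sup>n g\<close> with \<open>g\<close> in \<open>L\<^sup>2\<close>, and the
  \<open>j\<close>-th derivative of \<open>T\<^sup>n g\<close> is \<open>T\<^sup>n\<^sup>-\<^sup>j g\<close>; the operator \<open>A\<close> maps \<open>T\<^sup>2 g\<close> to \<open>S g = k T\<^sup>2 g - g\<close>. As
  \<open>-S = 1 + k T\<^sup>* T\<close> is coercive, \<open>S\<close> is bijective, which makes \<open>A\<close> self-adjoint and yields
  \<open>A\<^sup>n (T\<^sup>2\<^sup>n g) = S\<^sup>n g\<close>. The formula \<open>(x, y)\<^sub>n = (A\<^sup>n x, y)\<close> then follows by induction on \<open>n\<close> from Pascal's
  rule, and density of \<open>D(A\<^sup>n)\<close> holds because a \<open>y\<close> orthogonal to it in \<open>V\<^sub>n\<close> is orthogonal to the range of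
  \<open>S\<^sup>n\<close>, which is all of \<open>L\<^sup>2\<close>.

  That absolutely continuous functions are primitives of their almost everywhere defined
  derivatives is obtained from the Jordan decomposition, the Radon-Nikodym theorem and Lebesgue's
  differentiation theorem.
\<close>

section \<open>Orthogonality and density in Hilbert spaces\<close>

text \<open>Everything is pulled back to \<open>L2\<close> along \<open>T ^^ n\<close>. There the
  \<open>n\<close>-th inner product becomes a bounded form that dominates the original one, so V_n
  inherits its completeness from \<open>L2\<close>, and the powers of the unbounded \<open>A\<close>
  become powers of a bounded bijection. Formally that form belongs to the \<open>n\<close>-th power
  of \<open>1 + k T* T\<close>, that is of \<open>-S\<close>, and this is why it matches
  \<open>A ^^ n\<close>. Antiperiodicity is what makes \<open>T\<close> available: it fixes the
  constant of integration, so every \<open>g\<close> in \<open>L2\<close> has exactly one such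
  primitive. The obstacle lies on the concrete side. \<open>deriv_on\<close> has unspecified values
  where no derivative exists, so absolute continuity in the epsilon-delta sense has to be converted
  into an almost everywhere derivative that integrates back to the function. Once functions are
  written as iterated primitives, only the highest derivative is confined to almost everywhere
  statements; the lower ones are known at every point, as the boundary conditions demand.\<close>

locale hilbert =
  fixes s :: "complex \<Rightarrow> 'v \<Rightarrow> 'v::ab_group_add" and H :: "'v set" and ip :: "'v \<Rightarrow> 'v \<Rightarrow> complex"
  assumes hilbert: "hilbert_space s H ip"
begin

sublocale vector_space s
  using hilbert by (simp add: hilbert_space_def)

abbreviation nrm :: "'v \<Rightarrow> real" where "nrm \<equiv> ip_norm ip"

lemma subspace_H: "subspace H"
  using hilbert by (simp add: hilbert_space_def)

lemma H_closed [simp]: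
  "0 \<in> H" "\<lbrakk>x \<in> H; y \<in> H\<rbrakk> \<Longrightarrow> x + y \<in> H" "\<lbrakk>x \<in> H; y \<in> H\<rbrakk> \<Longrightarrow> x - y \<in> H"
  "x \<in> H \<Longrightarrow> s c x \<in> H" "x \<in> H \<Longrightarrow> - x \<in> H"
  by (fact subspace_0[OF subspace_H] subspace_add[OF subspace_H] subspace_diff[OF subspace_H]
      subspace_scale[OF subspace_H] subspace_neg[OF subspace_H])+

lemma complete:
  assumes "\<And>n. X n \<in> H" "\<And>e. e > 0 \<Longrightarrow> \<exists>M. \<forall>m\<ge>M. \<forall>n\<ge>M. nrm (X m - X n) < e"
  obtains x where "x \<in> H" "(\<lambda>n. nrm (X n - x)) \<longlonglongrightarrow> 0"
proof -
  have "\<exists>x\<in>H. (\<lambda>n. nrm (X n - x)) \<longlonglongrightarrow> 0"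
    using hilbert[unfolded hilbert_space_def, THEN conjunct2, THEN conjunct2, THEN conjunct2,
      rule_format, of X] assms by blast
  then show ?thesis using that by blast
qed

lemma ip_props: "inner_product_on s H ip"
  using hilbert by (simp add: hilbert_space_def)

lemma ip_add_left: "\<lbrakk>x \<in> H; y \<in> H; z \<in> H\<rbrakk> \<Longrightarrow> ip (x + y) z = ip x z + ip y z"
  and ip_scale_left: "\<lbrakk>x \<in> H; y \<in> H\<rbrakk> \<Longrightarrow> ip (s c x) y = c * ip x y"
  and ip_cnj: "\<lbrakk>x \<in> H; y \<in> H\<rbrakk> \<Longrightarrow> ip y x = cnj (ip x y)"
  and ip_nonneg: "x \<in> H \<Longrightarrow> 0 \<le> Re (ip x x)"
  and ip_eq_0: "\<lbrakk>x \<in> H; ip x x = 0\<rbrakk> \<Longrightarrow> x = 0"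
  using ip_props unfolding inner_product_on_def by (elim conjE, metis)+

lemma ip_diff_left: "\<lbrakk>x \<in> H; y \<in> H; z \<in> H\<rbrakk> \<Longrightarrow> ip (x - y) z = ip x z - ip y z"
  using ip_add_left[of "x - y" y z] by simp

lemma ip_minus_left: "\<lbrakk>x \<in> H; y \<in> H\<rbrakk> \<Longrightarrow> ip (- x) y = - ip x y"
  using ip_scale_left[of x y "-1"] by simp

lemma ip_zero_left: "y \<in> H \<Longrightarrow> ip 0 y = 0"
  using ip_diff_left[of 0 0 y] by simp

lemma ip_zero_right: "y \<in> H \<Longrightarrow> ip y 0 = 0"
  by (metis H_closed(1) complex_cnj_zero ip_zero_left ip_cnj)

lemma ip_add_right: "\<lbrakk>x \<in> H; y \<in> H; z \<in> H\<rbrakk> \<Longrightarrow> ip x (y + z) = ip x y + ip x z"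
  by (metis H_closed(2) complex_cnj_add ip_add_left ip_cnj)

lemma ip_diff_right: "\<lbrakk>x \<in> H; y \<in> H; z \<in> H\<rbrakk> \<Longrightarrow> ip x (y - z) = ip x y - ip x z"
  by (metis H_closed(3) complex_cnj_diff ip_diff_left ip_cnj)

lemma ip_scale_right: "\<lbrakk>x \<in> H; y \<in> H\<rbrakk> \<Longrightarrow> ip x (s c y) = cnj c * ip x y"
  by (metis H_closed(4) complex_cnj_mult ip_scale_left ip_cnj)

lemma ip_minus_right: "\<lbrakk>x \<in> H; y \<in> H\<rbrakk> \<Longrightarrow> ip x (- y) = - ip x y"
  using ip_scale_right[of x y "-1"] by simp

lemmas ip_simps = ip_add_left ip_add_right ip_diff_left ip_diff_right ip_scale_left ip_scale_right
  ip_minus_left ip_minus_right ip_zero_left ip_zero_right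

lemma nrm_nonneg: "x \<in> H \<Longrightarrow> 0 \<le> nrm x"
  by (simp add: ip_norm_def ip_nonneg)

lemma nrm_power2: "x \<in> H \<Longrightarrow> (nrm x)\<^sup>2 = Re (ip x x)"
  by (simp add: ip_norm_def ip_nonneg)

lemma ip_self:
  assumes "x \<in> H"
  shows "ip x x = of_real ((nrm x)\<^sup>2)"
proof -
  have "Im (ip x x) = 0"
    using arg_cong[OF ip_cnj[OF assms assms], of Im] by simp
  then show ?thesis
    unfolding nrm_power2[OF assms] by (simp add: complex_eq_iff)
qed

lemma nrm_eq_0: "\<lbrakk>x \<in> H; nrm x = 0\<rbrakk> \<Longrightarrow> x = 0"
  using ip_eq_0 by (simp add: ip_self)

lemma nrm_zero: "nrm 0 = 0"
  by (simp add: ip_norm_def ip_zero_left)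

lemma nrm_scale: "x \<in> H \<Longrightarrow> nrm (s c x) = cmod c * nrm x"
proof (rule power2_eq_imp_eq)
  assume x: "x \<in> H"
  have "ip (s c x) (s c x) = (c * cnj c) * ip x x"
    using x by (simp add: ip_simps)
  also have "\<dots> = of_real ((cmod c)\<^sup>2 * (nrm x)\<^sup>2)"
    unfolding complex_norm_square[symmetric] ip_self[OF x] of_real_mult ..
  finally have "Re (ip (s c x) (s c x)) = (cmod c)\<^sup>2 * (nrm x)\<^sup>2"
    by (metis Re_complex_of_real)
  then show "(nrm (s c x))\<^sup>2 = (cmod c * nrm x)\<^sup>2"
    using x by (simp only: nrm_power2 H_closed power_mult_distrib)
qed (auto simp: nrm_nonneg)

lemma nrm_minus: "x \<in> H \<Longrightarrow> nrm (- x) = nrm x"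
  using nrm_scale[of x "-1"] by simp

lemma nrm_diff_commute: "\<lbrakk>x \<in> H; y \<in> H\<rbrakk> \<Longrightarrow> nrm (x - y) = nrm (y - x)"
  using nrm_minus[of "x - y"] by simp

lemma nrm_diff_power2:
  assumes "x \<in> H" "y \<in> H"
  shows "(nrm (x - y))\<^sup>2 = (nrm x)\<^sup>2 - 2 * Re (ip x y) + (nrm y)\<^sup>2"
proof -
  have "Re (ip y x) = Re (ip x y)"
    using ip_cnj[OF assms] by simp
  then show ?thesis
    using assms by (simp add: nrm_power2 ip_simps)
qed

text \<open>The multiplier carries the phase of \<open>ip x y\<close>, so the cross term is real and
  only the real parameter \<open>t\<close> is left. Cauchy-Schwarz takes the best \<open>t\<close>,
  the projection argument a small one.\<close>

lemma nrm_diff_scale_ip: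
  assumes "x \<in> H" "y \<in> H"
  shows "(nrm (x - s (of_real t * ip x y) y))\<^sup>2
       = (nrm x)\<^sup>2 - 2 * t * (cmod (ip x y))\<^sup>2 + t\<^sup>2 * (cmod (ip x y))\<^sup>2 * (nrm y)\<^sup>2"
proof -
  have "Re (ip x (s (of_real t * ip x y) y)) = t * (cmod (ip x y))\<^sup>2"
    unfolding cmod_power2 using assms by (simp add: ip_simps power2_eq_square algebra_simps)
  then show ?thesis
    using assms by (simp add: nrm_diff_power2 nrm_scale norm_mult power_mult_distrib)
qed

lemma Cauchy_Schwarz:
  assumes "x \<in> H" "y \<in> H"
  shows "cmod (ip x y) \<le> nrm x * nrm y"
proof (cases "y = 0")
  case True
  then show ?thesis using assms by (simp add: ip_simps nrm_zero)
next
  case False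
  then have pos: "0 < nrm y"
    using assms nrm_eq_0 nrm_nonneg by (metis less_eq_real_def)
  let ?c = "(cmod (ip x y))\<^sup>2"
  \<comment> \<open>This value of \<open>t\<close> minimizes the quadratic: it leaves the component
    of \<open>x\<close> orthogonal to \<open>y\<close>.\<close>
  have "0 \<le> (nrm x)\<^sup>2 - 2 * (1 / (nrm y)\<^sup>2) * ?c + (1 / (nrm y)\<^sup>2)\<^sup>2 * ?c * (nrm y)\<^sup>2"
    using nrm_diff_scale_ip[OF assms, of "1 / (nrm y)\<^sup>2"] by (metis zero_le_power2)
  also have "\<dots> = (nrm x)\<^sup>2 - ?c / (nrm y)\<^sup>2"
    using pos by (simp add: field_simps power2_eq_square)
  finally have "?c \<le> (nrm x * nrm y)\<^sup>2"
    using pos by (simp add: field_simps)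
  then show ?thesis
    using assms by (meson mult_nonneg_nonneg nrm_nonneg power2_le_imp_le)
qed

lemma nrm_triangle:
  assumes "x \<in> H" "y \<in> H"
  shows "nrm (x + y) \<le> nrm x + nrm y"
proof (rule power2_le_imp_le)
  have "(nrm (x + y))\<^sup>2 = (nrm x)\<^sup>2 + 2 * Re (ip x y) + (nrm y)\<^sup>2"
    using nrm_diff_power2[of x "- y"] assms by (simp add: ip_simps nrm_minus)
  moreover have "Re (ip x y) \<le> nrm x * nrm y"
    using Cauchy_Schwarz[OF assms] complex_Re_le_cmod order_trans by blast
  ultimately show "(nrm (x + y))\<^sup>2 \<le> (nrm x + nrm y)\<^sup>2"
    by (simp add: power2_sum)
qed (use assms in \<open>simp add: nrm_nonneg\<close>)

lemma nrm_triangle_diff: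
  assumes "x \<in> H" "y \<in> H" "z \<in> H"
  shows "nrm (x - z) \<le> nrm (x - y) + nrm (y - z)"
  using nrm_triangle[of "x - y" "y - z"] assms by simp

lemma parallelogram:
  assumes "x \<in> H" "y \<in> H"
  shows "(nrm (x - y))\<^sup>2 = 2 * (nrm x)\<^sup>2 + 2 * (nrm y)\<^sup>2 - (nrm (x + y))\<^sup>2"
  using nrm_diff_power2[of x y] nrm_diff_power2[of x "- y"] assms by (simp add: ip_simps nrm_minus)

text \<open>The orthogonal projection onto the closure of \<open>D\<close>, obtained from a minimizing sequence.\<close>

lemma dense_in_ipI:
  assumes D: "subspace D" "D \<subseteq> H"
    and orth: "\<And>y. \<lbrakk>y \<in> H; \<And>x. x \<in> D \<Longrightarrow> ip x y = 0\<rbrakk> \<Longrightarrow> y = 0"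
  shows "dense_in_ip ip H D"
  unfolding dense_in_ip_def
proof (intro conjI ballI allI impI)
  fix x and e :: real assume x: "x \<in> H" and e: "e > 0"
  have DH: "y \<in> H" if "y \<in> D" for y using that D by blast
  define \<delta> where "\<delta> = (INF y\<in>D. nrm (x - y))"
  have ne: "D \<noteq> {}" using D subspace_0 by blast
  have bdd: "bdd_below ((\<lambda>y. nrm (x - y)) ` D)"
    by (rule bdd_belowI[of _ 0]) (use x DH in \<open>auto simp: nrm_nonneg\<close>)
  have \<delta>_le: "\<delta> \<le> nrm (x - y)" if "y \<in> D" for y
    unfolding \<delta>_def using bdd that by (rule cINF_lower)
  have \<delta>0: "0 \<le> \<delta>"
    unfolding \<delta>_def using ne by (rule cINF_greatest) (use x DH in \<open>simp add: nrm_nonneg\<close>)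
  have "\<exists>y\<in>D. nrm (x - y) < \<delta> + 1 / real (Suc n)" for n
    using cINF_less_iff[OF ne bdd, of "\<delta> + 1 / real (Suc n)"] by (simp add: \<delta>_def)
  then obtain Y where YD: "\<And>n. Y n \<in> D" and Y: "\<And>n. nrm (x - Y n) < \<delta> + 1 / real (Suc n)"
    by metis
  have YH: "Y n \<in> H" for n using YD DH by blast
  have lim0: "(\<lambda>n. \<delta> + 1 / real (Suc n)) \<longlonglongrightarrow> \<delta> + 0"
    by (intro tendsto_intros LIMSEQ_inverse_real_of_nat[unfolded inverse_eq_divide])
  have lim: "(\<lambda>n. nrm (x - Y n)) \<longlonglongrightarrow> \<delta>"
    by (rule tendsto_sandwich[OF _ _ tendsto_const lim0[simplified]])
      (use \<delta>_le YD Y in \<open>auto intro!: always_eventually less_imp_le\<close>)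
  \<comment> \<open>The midpoint of \<open>Y m\<close> and \<open>Y n\<close> lies in the subspace
    \<open>D\<close>, hence at distance at least \<open>\<delta>\<close> from \<open>x\<close>; the
    parallelogram law turns this into smallness of \<open>Y m - Y n\<close>.\<close>
  have diff: "(nrm (Y m - Y n))\<^sup>2 \<le> 2 * (nrm (x - Y m))\<^sup>2 + 2 * (nrm (x - Y n))\<^sup>2 - 4 * \<delta>\<^sup>2" for m n
  proof -
    have mid: "s (1/2) (Y m + Y n) \<in> D"
      using D YD by (simp add: subspace_add subspace_scale)
    have two: "s 2 z = z + z" for z
      using scale_left_distrib[of 1 1 z] by simp
    have "(x - Y n) + (x - Y m) = s 2 (x - s (1/2) (Y m + Y n))"
      by (simp add: scale_right_diff_distrib two)
    then have "nrm ((x - Y n) + (x - Y m)) = 2 * nrm (x - s (1/2) (Y m + Y n))"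
      using x DH[OF mid] by (simp add: nrm_scale)
    then have "(nrm ((x - Y n) + (x - Y m)))\<^sup>2 \<ge> 4 * \<delta>\<^sup>2"
      using \<delta>_le[OF mid] \<delta>0 by (simp add: power_mult_distrib)
    then show ?thesis
      using parallelogram[of "x - Y n" "x - Y m"] x YH by simp
  qed
  have "\<exists>M. \<forall>m\<ge>M. \<forall>n\<ge>M. nrm (Y m - Y n) < \<epsilon>" if "\<epsilon> > 0" for \<epsilon>
  proof -
    have "(\<lambda>n. (nrm (x - Y n))\<^sup>2) \<longlonglongrightarrow> \<delta>\<^sup>2"
      using lim by (intro tendsto_intros)
    moreover have "\<delta>\<^sup>2 < \<delta>\<^sup>2 + \<epsilon>\<^sup>2 / 4" using that by simp
    ultimately have "\<forall>\<^sub>F n in sequentially. (nrm (x - Y n))\<^sup>2 < \<delta>\<^sup>2 + \<epsilon>\<^sup>2 / 4"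
      by (rule order_tendstoD)
    then obtain M where M: "\<And>n. n \<ge> M \<Longrightarrow> (nrm (x - Y n))\<^sup>2 < \<delta>\<^sup>2 + \<epsilon>\<^sup>2 / 4"
      by (auto simp: eventually_sequentially)
    have "nrm (Y m - Y n) < \<epsilon>" if mn: "m \<ge> M" "n \<ge> M" for m n
    proof (rule power2_less_imp_less)
      show "(nrm (Y m - Y n))\<^sup>2 < \<epsilon>\<^sup>2"
        using diff[of m n] M[OF mn(1)] M[OF mn(2)] by argo
    qed (use \<open>\<epsilon> > 0\<close> in simp)
    then show ?thesis by blast
  qed
  \<comment> \<open>The limit \<open>p\<close> lies in the closure of \<open>D\<close>, possibly
    outside \<open>D\<close>, so both estimates for \<open>w\<close> below have to go through the
    \<open>Y n\<close>.\<close>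
  then obtain p where p: "p \<in> H" and limp: "(\<lambda>n. nrm (Y n - p)) \<longlonglongrightarrow> 0"
    using complete[of Y] YH by metis
  define w where "w = x - p"
  have w: "w \<in> H" using x p by (simp add: w_def)
  have w_le: "nrm w \<le> \<delta>"
  proof (rule LIMSEQ_le_const)
    show "(\<lambda>n. nrm (x - Y n) + nrm (Y n - p)) \<longlonglongrightarrow> \<delta>"
      using tendsto_add[OF lim limp] by simp
    show "\<exists>N. \<forall>n\<ge>N. nrm w \<le> nrm (x - Y n) + nrm (Y n - p)"
      using nrm_triangle_diff x YH p unfolding w_def by blast
  qed
  have w_ge: "\<delta> \<le> nrm (w - z)" if z: "z \<in> D" for z
  proof (rule LIMSEQ_le_const)
    show "(\<lambda>n. nrm (w - z) + nrm (Y n - p)) \<longlonglongrightarrow> nrm (w - z)"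
      using tendsto_add[OF tendsto_const limp] by simp
    have "\<delta> \<le> nrm (w - z) + nrm (Y n - p)" for n
    proof -
      have "Y n + z \<in> D" using D z YD by (simp add: subspace_add)
      then have "\<delta> \<le> nrm (x - (Y n + z))" by (rule \<delta>_le)
      also have "x - (Y n + z) = (w - z) + (p - Y n)" by (simp add: w_def)
      also have "nrm \<dots> \<le> nrm (w - z) + nrm (p - Y n)"
        using nrm_triangle w p YH DH[OF z] by simp
      finally show ?thesis using nrm_diff_commute p YH by simp
    qed
    then show "\<exists>N. \<forall>n\<ge>N. \<delta> \<le> nrm (w - z) + nrm (Y n - p)" by blast
  qed
  have "ip z w = 0" if z: "z \<in> D" for z
  proof -
    \<comment> \<open>Since \<open>t * (nrm z)\<^sup>2 < 1\<close>, the second-order term cannot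
      compensate the first-order one; the added 1 also admits \<open>z = 0\<close>.\<close>
    define t where "t = 1 / ((nrm z)\<^sup>2 + 1)"
    have "0 < (nrm z)\<^sup>2 + 1" by (simp add: add_nonneg_pos)
    then have t: "t > 0" "t * (nrm z)\<^sup>2 < 1"
      by (simp_all add: t_def)
    have "s (of_real t * ip w z) z \<in> D" using D z by (simp add: subspace_scale)
    then have "nrm w \<le> nrm (w - s (of_real t * ip w z) z)"
      using w_le w_ge order_trans by blast
    then have "(nrm w)\<^sup>2 \<le> (nrm (w - s (of_real t * ip w z) z))\<^sup>2"
      using nrm_nonneg[OF w] by (simp add: power_mono)
    then have "2 * t * (cmod (ip w z))\<^sup>2 \<le> t * (cmod (ip w z))\<^sup>2 * (t * (nrm z)\<^sup>2)"
      using nrm_diff_scale_ip[OF w DH[OF z], of t] by (simp add: power2_eq_square mult_ac)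
    also have "\<dots> \<le> t * (cmod (ip w z))\<^sup>2 * 1"
      using t by (intro mult_left_mono) auto
    finally have "t * (cmod (ip w z))\<^sup>2 \<le> 0" by simp
    then have "ip w z = 0" using t by (simp add: mult_le_0_iff)
    then show ?thesis using ip_cnj[OF w DH[OF z]] by simp
  qed
  then have "w = 0" using orth w by blast
  then have "\<delta> \<le> 0" using w_ge[of 0] D subspace_0 by (simp add: nrm_zero)
  then have "(\<lambda>n. nrm (x - Y n)) \<longlonglongrightarrow> 0" using lim \<delta>0 by simp
  then have "\<forall>\<^sub>F n in sequentially. nrm (x - Y n) < e" using e by (rule order_tendstoD)
  then show "\<exists>y\<in>D. nrm (x - y) < e"
    using YD eventually_happens'[OF sequentially_bot] by blast
qed (use D in blast)


end

section \<open>Left-definite spaces from a skew-symmetric operator\<close>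

text \<open>These are the properties through which the antiperiodic primitive enters the abstract
  part. The boundary conditions are present only in \<open>T_skew\<close>, which is integration by
  parts with vanishing boundary term.\<close>

locale skew_operator = hilbert s H ip
  for s :: "complex \<Rightarrow> 'v \<Rightarrow> 'v::ab_group_add" and H :: "'v set" and ip :: "'v \<Rightarrow> 'v \<Rightarrow> complex" +
  fixes T :: "'v \<Rightarrow> 'v" and k C :: real
  assumes T_closed [simp]: "x \<in> H \<Longrightarrow> T x \<in> H"
    and T_add: "\<lbrakk>x \<in> H; y \<in> H\<rbrakk> \<Longrightarrow> T (x + y) = T x + T y"
    and T_scale: "x \<in> H \<Longrightarrow> T (s c x) = s c (T x)"
    and T_bounded: "x \<in> H \<Longrightarrow> ip_norm ip (T x) \<le> C * ip_norm ip x"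
    and T_skew: "\<lbrakk>x \<in> H; y \<in> H\<rbrakk> \<Longrightarrow> ip (T x) y = - ip x (T y)"
    and T_inj: "\<lbrakk>x \<in> H; T x = 0\<rbrakk> \<Longrightarrow> x = 0"
    and k_pos: "0 < k"
begin

section \<open>Powers of the skew-symmetric operator\<close>

lemma T_diff: "\<lbrakk>x \<in> H; y \<in> H\<rbrakk> \<Longrightarrow> T (x - y) = T x - T y"
  using T_add[of "x - y" y] by (simp add: algebra_simps)

lemma T_zero [simp]: "T 0 = 0"
  using T_diff[of 0 0] by simp

lemma T_eqD: "\<lbrakk>T x = T y; x \<in> H; y \<in> H\<rbrakk> \<Longrightarrow> x = y"
  using T_inj[of "x - y"] by (simp add: T_diff)

lemma Tn_closed [simp]: "x \<in> H \<Longrightarrow> (T ^^ n) x \<in> H"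
  by (induction n) auto

lemma Tn_add: "\<lbrakk>x \<in> H; y \<in> H\<rbrakk> \<Longrightarrow> (T ^^ n) (x + y) = (T ^^ n) x + (T ^^ n) y"
  by (induction n) (auto simp: T_add)

lemma Tn_diff: "\<lbrakk>x \<in> H; y \<in> H\<rbrakk> \<Longrightarrow> (T ^^ n) (x - y) = (T ^^ n) x - (T ^^ n) y"
  by (induction n) (auto simp: T_diff)

lemma Tn_scale: "x \<in> H \<Longrightarrow> (T ^^ n) (s c x) = s c ((T ^^ n) x)"
  by (induction n) (auto simp: T_scale)

lemma Tn_inj: "\<lbrakk>x \<in> H; (T ^^ n) x = 0\<rbrakk> \<Longrightarrow> x = 0"
  by (induction n) (auto dest: T_inj[rotated])

lemma Tn_zero [simp]: "(T ^^ n) 0 = 0"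
  by (induction n) auto

lemma Tn_commute: "T ((T ^^ n) x) = (T ^^ n) (T x)"
  by (simp add: funpow_swap1)

text \<open>The locale does not fix the sign of \<open>C\<close>; the absolute value keeps the
  factor nonnegative when the bounds are multiplied.\<close>

lemma Tn_bounded: "x \<in> H \<Longrightarrow> nrm ((T ^^ n) x) \<le> \<bar>C\<bar> ^ n * nrm x"
proof (induction n)
  case (Suc n)
  have "nrm (T ((T ^^ n) x)) \<le> C * nrm ((T ^^ n) x)"
    using Suc.prems by (simp add: T_bounded)
  also have "\<dots> \<le> \<bar>C\<bar> * (\<bar>C\<bar> ^ n * nrm x)"
    using Suc by (intro mult_mono) (auto simp: nrm_nonneg)
  finally show ?case by (simp add: mult.assoc)
qed simp

section \<open>The operators \<open>S\<close> and \<open>A\<close>, and the bijectivity of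
  \<open>S\<close>\<close>

definition S :: "'v \<Rightarrow> 'v" where "S g = s (of_real k) (T (T g)) - g"

definition A :: "('v \<times> 'v) set" where "A = {(T (T g), S g) | g. g \<in> H}"

lemma S_closed [simp]: "x \<in> H \<Longrightarrow> S x \<in> H"
  by (simp add: S_def)

lemma S_diff: "\<lbrakk>x \<in> H; y \<in> H\<rbrakk> \<Longrightarrow> S (x - y) = S x - S y"
  by (simp add: S_def T_diff scale_right_diff_distrib)

lemma S_add: "\<lbrakk>x \<in> H; y \<in> H\<rbrakk> \<Longrightarrow> S (x + y) = S x + S y"
  by (simp add: S_def T_add scale_right_distrib)

lemma S_scale: "x \<in> H \<Longrightarrow> S (s c x) = s c (S x)"
  by (simp add: S_def T_scale scale_right_diff_distrib mult.commute)

lemma S_T: "x \<in> H \<Longrightarrow> S (T x) = T (S x)"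
  by (simp add: S_def T_scale T_diff)

text \<open>Skew-symmetry makes \<open>ip (T (T x)) x\<close> equal to
  \<open>-(nrm (T x))\<^sup>2\<close>, so both parts of \<open>-S\<close> contribute nonnegatively.
  The identity serves twice: for the lower bound of \<open>S\<close>, and to show that only
  \<open>0\<close> is orthogonal to its range.\<close>

lemma ip_S:
  assumes "x \<in> H"
  shows "- ip (S x) x = of_real (k * (nrm (T x))\<^sup>2 + (nrm x)\<^sup>2)"
  using assms T_skew[of "T x" x] unfolding S_def
  by (simp add: ip_simps) (simp add: ip_self)

text \<open>Cauchy-Schwarz applied to \<open>ip (S x) x\<close>, whose modulus is at least
  \<open>(nrm x)\<^sup>2\<close> by \<open>ip_S\<close>. The estimate yields injectivity and makes
  the preimages of a Cauchy sequence Cauchy.\<close>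

lemma nrm_S_ge:
  assumes x: "x \<in> H"
  shows "nrm x \<le> nrm (S x)"
proof (cases "nrm x = 0")
  case False
  then have pos: "nrm x > 0" using nrm_nonneg[OF x] by simp
  have "(nrm x)\<^sup>2 \<le> k * (nrm (T x))\<^sup>2 + (nrm x)\<^sup>2"
    using k_pos by simp
  also have "\<dots> \<le> \<bar>k * (nrm (T x))\<^sup>2 + (nrm x)\<^sup>2\<bar>" by simp
  also have "\<dots> = cmod (ip (S x) x)"
    using ip_S[OF x] by (metis norm_minus_cancel norm_of_real)
  also have "\<dots> \<le> nrm (S x) * nrm x"
    using x by (simp add: Cauchy_Schwarz)
  finally show ?thesis using pos by (simp add: power2_eq_square)
qed (use x in \<open>simp add: nrm_nonneg\<close>)

lemma S_eqD: "\<lbrakk>S x = S y; x \<in> H; y \<in> H\<rbrakk> \<Longrightarrow> x = y"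
  using nrm_S_ge[of "x - y"] nrm_nonneg[of "x - y"] nrm_eq_0[of "x - y"]
  by (simp add: S_diff nrm_zero)

text \<open>\<open>S = -(1 + k T\<^sup>* T)\<close> is coercive, so its range is closed and has trivial orthogonal complement.\<close>

lemma S_surj:
  assumes y: "y \<in> H"
  obtains x where "x \<in> H" "S x = y"
proof -
  have "dense_in_ip ip H (S ` H)"
  proof (rule dense_in_ipI)
    show "subspace (S ` H)"
    proof (rule subspaceI)
      show "0 \<in> S ` H" by (rule image_eqI[of _ _ 0]) (simp_all add: S_def)
    next
      fix u v assume "u \<in> S ` H" "v \<in> S ` H"
      then show "u + v \<in> S ` H" by (auto simp flip: S_add)
    next
      fix c u assume "u \<in> S ` H"
      then show "s c u \<in> S ` H" by (auto simp flip: S_scale)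
    qed
  next
    fix z assume z: "z \<in> H" "\<And>x. x \<in> S ` H \<Longrightarrow> ip x z = 0"
    then have "of_real (k * (nrm (T z))\<^sup>2 + (nrm z)\<^sup>2) = (0::complex)"
      using ip_S[of z] by simp
    then have "k * (nrm (T z))\<^sup>2 + (nrm z)\<^sup>2 = 0"
      using of_real_eq_0_iff by blast
    then have "nrm z = 0"
      using k_pos by (simp add: add_nonneg_eq_0_iff)
    then show "z = 0" using z nrm_eq_0 by blast
  qed auto
  then have "\<exists>x\<in>H. nrm (y - S x) < 1 / real (Suc n)" for n
    using y unfolding dense_in_ip_def by (simp add: bex_simps)
  then obtain X where XH: "\<And>n. X n \<in> H" and X: "\<And>n. nrm (y - S (X n)) < 1 / real (Suc n)"
    by metis
  have lim: "(\<lambda>n. nrm (y - S (X n))) \<longlonglongrightarrow> 0"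
    by (rule tendsto_sandwich[OF _ _ tendsto_const
          LIMSEQ_inverse_real_of_nat[unfolded inverse_eq_divide]])
      (use X XH y in \<open>auto intro!: always_eventually less_imp_le simp: nrm_nonneg\<close>)
  have bound: "nrm (X m - X n) \<le> nrm (y - S (X m)) + nrm (y - S (X n))" for m n
  proof -
    have "nrm (X m - X n) \<le> nrm (S (X m) - S (X n))"
      using nrm_S_ge[of "X m - X n"] XH by (simp add: S_diff)
    also have "\<dots> \<le> nrm (S (X m) - y) + nrm (y - S (X n))"
      using XH y by (intro nrm_triangle_diff) auto
    finally show ?thesis using nrm_diff_commute y XH by simp
  qed
  have "\<exists>M. \<forall>m\<ge>M. \<forall>n\<ge>M. nrm (X m - X n) < e" if "e > 0" for e
  proof -
    have "\<forall>\<^sub>F n in sequentially. nrm (y - S (X n)) < e / 2"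
      using lim that by (intro order_tendstoD) auto
    then obtain M where "\<And>n. n \<ge> M \<Longrightarrow> nrm (y - S (X n)) < e / 2"
      by (auto simp: eventually_sequentially)
    then have "nrm (X m - X n) < e" if "m \<ge> M" "n \<ge> M" for m n
      using bound[of m n] that by (smt (verit) field_sum_of_halves)
    then show ?thesis by blast
  qed
  then obtain x where x: "x \<in> H" and limx: "(\<lambda>n. nrm (X n - x)) \<longlonglongrightarrow> 0"
    using complete[of X] XH by metis
  \<comment> \<open>Boundedness lets \<open>S (X n)\<close> converge to \<open>S x\<close>; the
    factor is \<open>k * C\<^sup>2\<close> for the term with two powers of \<open>T\<close> plus 1
    for the identity.\<close>
  have S_bound: "nrm (S z) \<le> (k * C\<^sup>2 + 1) * nrm z" if z: "z \<in> H" for z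
  proof -
    have "nrm (S z) \<le> nrm (s (of_real k) (T (T z))) + nrm (- z)"
      using nrm_triangle[of "s (of_real k) (T (T z))" "- z"] z by (simp add: S_def)
    also have "\<dots> = k * nrm ((T ^^ 2) z) + nrm z"
      using z k_pos by (simp add: nrm_scale nrm_minus numeral_2_eq_2)
    also have "\<dots> \<le> k * (\<bar>C\<bar>\<^sup>2 * nrm z) + nrm z"
      using Tn_bounded[OF z, of 2] k_pos by simp
    finally show ?thesis by (simp add: algebra_simps)
  qed
  have "nrm (y - S x) \<le> 0"
  proof (rule LIMSEQ_le_const)
    show "(\<lambda>n. nrm (y - S (X n)) + (k * C\<^sup>2 + 1) * nrm (X n - x)) \<longlonglongrightarrow> 0"
      using tendsto_add[OF lim tendsto_mult_left[OF limx]] by simp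
    have "nrm (y - S x) \<le> nrm (y - S (X n)) + (k * C\<^sup>2 + 1) * nrm (X n - x)" for n
    proof -
      have "nrm (y - S x) \<le> nrm (y - S (X n)) + nrm (S (X n) - S x)"
        using XH y x by (intro nrm_triangle_diff) auto
      then show ?thesis
        using S_bound[of "X n - x"] XH x by (simp add: S_diff)
    qed
    then show "\<exists>N. \<forall>n\<ge>N. nrm (y - S x) \<le> nrm (y - S (X n)) + (k * C\<^sup>2 + 1) * nrm (X n - x)"
      by blast
  qed
  then have "y - S x = 0"
    using nrm_eq_0[of "y - S x"] nrm_nonneg[of "y - S x"] x y by simp
  then show ?thesis using that x by simp
qed

lemma Sn_closed [simp]: "x \<in> H \<Longrightarrow> (S ^^ n) x \<in> H"
  by (induction n) auto

lemma Sn_surj: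
  assumes "y \<in> H"
  shows "\<exists>x\<in>H. (S ^^ n) x = y"
  using assms
proof (induction n arbitrary: y)
  case (Suc n)
  then obtain z where "z \<in> H" "S z = y" using S_surj by metis
  then show ?case using Suc.IH[of z] by auto
qed simp

lemma Sn_eqD: "\<lbrakk>(S ^^ n) x = (S ^^ n) y; x \<in> H; y \<in> H\<rbrakk> \<Longrightarrow> x = y"
  by (induction n) (auto dest: S_eqD)

lemma Sn_T: "x \<in> H \<Longrightarrow> (S ^^ n) (T x) = T ((S ^^ n) x)"
  by (induction n) (auto simp: S_T)

text \<open>The case \<open>n = 0\<close> is excluded because \<open>A ^^ 0\<close> is the identity on the whole type.\<close>

lemma A_pow: "0 < n \<Longrightarrow> A ^^ n = {((T ^^ (2 * n)) g, (S ^^ n) g) | g. g \<in> H}"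
proof (induction n rule: nat_induct_non_zero)
  case 1
  show ?case by (auto simp: A_def numeral_2_eq_2)
next
  case (Suc n)
  have "A ^^ Suc n = {((T ^^ (2 * n)) g, (S ^^ n) g) | g. g \<in> H} O A"
    by (simp add: Suc)
  also have "\<dots> = {((T ^^ (2 * Suc n)) g, (S ^^ Suc n) g) | g. g \<in> H}" (is "?L = ?R")
  proof (intro equalityI subrelI)
    fix x z assume "(x, z) \<in> ?L"
    \<comment> \<open>Lying in the domain of the next power means that \<open>(S ^^ n) g\<close> has
      the form \<open>T (T h)\<close>. Writing \<open>h\<close> as \<open>(S ^^ n) u\<close> and
      cancelling \<open>S ^^ n\<close> moves this regularity to \<open>g\<close> itself.\<close>
    then obtain g h where gh: "g \<in> H" "h \<in> H" "(S ^^ n) g = T (T h)" "x = (T ^^ (2 * n)) g" "z = S h"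
      by (auto simp: A_def)
    obtain u where u: "u \<in> H" "(S ^^ n) u = h" using Sn_surj gh by blast
    then have "(S ^^ n) (T (T u)) = (S ^^ n) g" using gh by (simp add: Sn_T)
    then have "T (T u) = g" using Sn_eqD[of n] gh u by simp
    then show "(x, z) \<in> ?R" using gh u by (auto simp: Tn_commute)
  next
    fix x z assume "(x, z) \<in> ?R"
    then obtain g where g: "g \<in> H" "x = (T ^^ (2 * Suc n)) g" "z = (S ^^ Suc n) g"
      by (elim CollectE exE conjE) simp
    have "((T ^^ (2 * n)) (T (T g)), (S ^^ n) (T (T g))) \<in> {((T ^^ (2 * n)) g, (S ^^ n) g) | g. g \<in> H}"
      using g(1) by (intro CollectI exI[of _ "T (T g)"]) simp
    moreover have "((S ^^ n) (T (T g)), S ((S ^^ n) g)) \<in> A"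
      using g by (auto simp: A_def Sn_T)
    moreover have "x = (T ^^ (2 * n)) (T (T g))" "z = S ((S ^^ n) g)"
      using g by (simp_all add: Tn_commute)
    ultimately show "(x, z) \<in> ?L" by blast
  qed
  finally show ?case .
qed

section \<open>Self-adjointness and lower bound of \<open>A\<close>\<close>

lemma subspace_range_Tn: "subspace ((T ^^ n) ` H)"
proof (rule subspaceI)
  show "0 \<in> (T ^^ n) ` H" by (rule image_eqI[of _ _ 0]) simp_all
next
  fix u v assume "u \<in> (T ^^ n) ` H" "v \<in> (T ^^ n) ` H"
  then show "u + v \<in> (T ^^ n) ` H" by (auto simp flip: Tn_add)
next
  fix c u assume "u \<in> (T ^^ n) ` H"
  then show "s c u \<in> (T ^^ n) ` H" by (auto simp flip: Tn_scale)
qed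

lemma A_symmetric: "\<lbrakk>g \<in> H; h \<in> H\<rbrakk> \<Longrightarrow> ip (S g) (T (T h)) = ip (T (T g)) (S h)"
  by (simp add: S_def ip_simps T_skew)

text \<open>A symmetric operator with full range equals its adjoint: for \<open>(y, z)\<close> in
  the adjoint, subtracting the point of the graph with the same image \<open>z\<close> leaves a
  vector orthogonal to the range of \<open>S\<close>, hence \<open>0\<close>.\<close>

lemma A_self_adjoint: "self_adjoint s H ip A"
  unfolding self_adjoint_def
proof (intro conjI)
  show "linear_operator s H A"
    unfolding linear_operator_def
  proof (intro conjI)
    show "A \<subseteq> H \<times> H" by (auto simp: A_def)
    show "single_valued A"
      by (rule single_valuedI) (auto simp: A_def dest!: T_eqD)
    show "(0, 0) \<in> A" by (auto simp: A_def S_def intro!: exI[of _ 0])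
    show "\<forall>(x, u)\<in>A. \<forall>(y, v)\<in>A. (x + y, u + v) \<in> A"
      by (auto simp: A_def simp flip: T_add S_add)
    show "\<forall>c. \<forall>(x, u)\<in>A. (s c x, s c u) \<in> A"
      by (auto simp: A_def) (metis H_closed(4) S_scale T_scale T_closed)
  qed
  have dom: "Domain A = (T ^^ 2) ` H"
    by (auto simp: A_def numeral_2_eq_2)
  show "dense_in_ip ip H (Domain A)"
    unfolding dom
  proof (rule dense_in_ipI[OF subspace_range_Tn])
    fix y assume y: "y \<in> H" and "\<And>x. x \<in> (T ^^ 2) ` H \<Longrightarrow> ip x y = 0"
    then have "ip (T (T (T (T y)))) y = 0" "ip (T (T y)) y = 0"
      by (auto simp: numeral_2_eq_2)
    \<comment> \<open>By skew-symmetry \<open>ip (T (T y)) y\<close> is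
      \<open>-(nrm (T y))\<^sup>2\<close>, so a vector orthogonal to the domain is annihilated by
      \<open>T\<close>.\<close>
    then have "T y = 0" using y ip_eq_0[of "T y"] by (simp add: T_skew)
    then show "y = 0" using T_inj y by blast
  qed auto
  show "adjoint_operator H ip A = A"
  proof (intro equalityI subrelI)
    fix y z assume "(y, z) \<in> A"
    then show "(y, z) \<in> adjoint_operator H ip A"
      by (auto simp: A_def adjoint_operator_def A_symmetric)
  next
    fix y z assume "(y, z) \<in> adjoint_operator H ip A"
    then have yz: "y \<in> H" "z \<in> H" and adj: "\<And>g. g \<in> H \<Longrightarrow> ip (S g) y = ip (T (T g)) z"
      by (auto simp: A_def adjoint_operator_def)
    obtain h where h: "h \<in> H" "S h = z" using S_surj yz by metis
    obtain g where g: "g \<in> H" "S g = y - T (T h)" using S_surj[of "y - T (T h)"] h yz by auto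
    have "ip (S g) y = ip (S g) (T (T h))" using adj[of g] A_symmetric[of g h] g h by simp
    then have "ip (S g) (y - T (T h)) = 0" using g h yz by (simp add: ip_simps)
    then have "y - T (T h) = 0" using g h yz ip_eq_0[of "y - T (T h)"] by simp
    then show "(y, z) \<in> A" using h by (auto simp: A_def)
  qed
qed

text \<open>Beyond \<open>k * ip x x\<close> there remains \<open>ip (T g) (T g)\<close>, the
  abstract form of the integral of the squared modulus of \<open>f'\<close> that integration by
  parts extracts from \<open>-f''\<close>.\<close>

lemma A_bounded_below: "bounded_below ip A k"
  unfolding bounded_below_def
proof clarify
  fix x w assume "(x, w) \<in> A"
  then obtain g where g: "g \<in> H" "x = T (T g)" "w = S g" by (auto simp: A_def)
  have "ip w x = of_real k * ip x x + ip (T g) (T g)"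
    using g T_skew[of g "T g"] by (simp add: S_def ip_simps)
  then show "k * Re (ip x x) \<le> Re (ip w x)"
    using g by (simp add: ip_nonneg)
qed

text \<open>The index counts integrations instead of derivatives: with \<open>x\<close> and
  \<open>y\<close> the highest derivatives, the \<open>i\<close>-th term belongs to the derivative
  of order \<open>n - i\<close>. The arguments thus keep their meaning when \<open>n\<close>
  changes, which permits a recursion in \<open>n\<close>.\<close>

definition B :: "nat \<Rightarrow> 'v \<Rightarrow> 'v \<Rightarrow> complex" where
  "B n x y = (\<Sum>i\<le>n. of_nat (n choose i) * of_real k ^ i * ip ((T ^^ i) x) ((T ^^ i) y))"

text \<open>One more factor \<open>1 + k T* T\<close> in the operator behind the form; on the
  coefficients this is Pascal's rule.\<close>

lemma B_Suc:
  assumes "x \<in> H" "y \<in> H"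
  shows "B (Suc n) x y = of_real k * B n (T x) (T y) + B n x y"
proof -
  let ?f = "\<lambda>i. ip ((T ^^ i) x) ((T ^^ i) y)"
  have "B (Suc n) x y = ?f 0 + (\<Sum>i\<le>n. of_nat (Suc n choose Suc i) * of_real k ^ Suc i * ?f (Suc i))"
    unfolding B_def by (subst sum.atMost_Suc_shift) simp
  also have "\<dots> = (\<Sum>i\<le>n. of_nat (n choose i) * of_real k ^ Suc i * ?f (Suc i))
      + (?f 0 + (\<Sum>i\<le>n. of_nat (n choose Suc i) * of_real k ^ Suc i * ?f (Suc i)))"
    by (simp add: sum.distrib algebra_simps)
  also have "?f 0 + (\<Sum>i\<le>n. of_nat (n choose Suc i) * of_real k ^ Suc i * ?f (Suc i))
      = (\<Sum>i\<le>Suc n. of_nat (n choose i) * of_real k ^ i * ?f i)"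
    by (subst sum.atMost_Suc_shift) simp
  \<comment> \<open>The additional term \<open>i = Suc n\<close> has coefficient
    \<open>n choose Suc n\<close>, which is \<open>0\<close>.\<close>
  also have "\<dots> = B n x y" by (simp add: B_def)
  also have "(\<Sum>i\<le>n. of_nat (n choose i) * of_real k ^ Suc i * ?f (Suc i)) = of_real k * B n (T x) (T y)"
    by (simp add: B_def sum_distrib_left mult_ac funpow_swap1)
  finally show ?thesis .
qed

lemma B_diff_left: "\<lbrakk>x \<in> H; y \<in> H; z \<in> H\<rbrakk> \<Longrightarrow> B n (x - y) z = B n x z - B n y z"
  by (simp add: B_def Tn_diff ip_simps right_diff_distrib sum_subtractf)

lemma B_add_left: "\<lbrakk>x \<in> H; y \<in> H; z \<in> H\<rbrakk> \<Longrightarrow> B n (x + y) z = B n x z + B n y z"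
  by (simp add: B_def Tn_add ip_simps distrib_left sum.distrib)

lemma B_scale_left: "\<lbrakk>x \<in> H; z \<in> H\<rbrakk> \<Longrightarrow> B n (s c x) z = c * B n x z"
  by (simp add: B_def Tn_scale ip_simps sum_distrib_left mult.left_commute)

lemma B_skew: "\<lbrakk>x \<in> H; z \<in> H\<rbrakk> \<Longrightarrow> B n (T x) z = - B n x (T z)"
  by (simp add: B_def T_skew sum_negf flip: Tn_commute)

lemma B_cnj: "\<lbrakk>x \<in> H; y \<in> H\<rbrakk> \<Longrightarrow> B n y x = cnj (B n x y)"
  unfolding B_def cnj_sum
  by (intro sum.cong refl) (simp add: ip_cnj[of "(T ^^ _) x" "(T ^^ _) y"])

lemma Re_B_self:
  assumes "x \<in> H"
  shows "Re (B n x x) = (\<Sum>i\<le>n. (n choose i) * k ^ i * (nrm ((T ^^ i) x))\<^sup>2)"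
proof -
  have "B n x x = of_real (\<Sum>i\<le>n. (n choose i) * k ^ i * (nrm ((T ^^ i) x))\<^sup>2)"
    using assms by (simp add: B_def ip_self)
  then show ?thesis by (metis Re_complex_of_real)
qed

text \<open>All summands are nonnegative, so each is a lower bound. The one with
  \<open>i = 0\<close> controls the highest derivative, the one with \<open>i = n\<close> gives the
  constant \<open>k ^ n\<close> of the left-definite inequality.\<close>

lemma Re_B_ge:
  assumes "x \<in> H" "i \<le> n"
  shows "(n choose i) * k ^ i * (nrm ((T ^^ i) x))\<^sup>2 \<le> Re (B n x x)"
  unfolding Re_B_self[OF assms(1)]
  by (rule member_le_sum[where f = "\<lambda>i. (n choose i) * k ^ i * (nrm ((T ^^ i) x))\<^sup>2"])
    (use assms k_pos in auto)

text \<open>Both arguments vary in the induction, since the hypothesis is applied to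
  \<open>S g\<close> and \<open>T h\<close>. The summand \<open>-g\<close> of \<open>S g\<close>
  becomes positive when \<open>T\<close> is moved from \<open>h\<close> to the left, and the outcome
  is exactly the right-hand side of \<open>B_Suc\<close>.\<close>

lemma S_pow_eq_B: "\<lbrakk>g \<in> H; h \<in> H\<rbrakk> \<Longrightarrow> ip ((S ^^ n) g) ((T ^^ n) h) = B n ((T ^^ n) g) h"
proof (induction n arbitrary: g h)
  case (Suc n)
  have "ip ((S ^^ Suc n) g) ((T ^^ Suc n) h) = ip ((S ^^ n) (S g)) ((T ^^ n) (T h))"
    by (simp add: funpow_swap1)
  also have "\<dots> = B n ((T ^^ n) (S g)) (T h)" using Suc by simp
  also have "\<dots> = of_real k * B n (T (T ((T ^^ n) g))) (T h) - B n ((T ^^ n) g) (T h)"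
    using Suc.prems by (simp add: S_def Tn_diff Tn_scale B_diff_left B_scale_left Tn_commute)
  also have "\<dots> = of_real k * B n (T (T ((T ^^ n) g))) (T h) + B n (T ((T ^^ n) g)) h"
    using Suc.prems B_skew[of "(T ^^ n) g" h n] by simp
  also have "\<dots> = B (Suc n) ((T ^^ Suc n) g) h"
    using Suc.prems B_Suc[of "T ((T ^^ n) g)" h n] by simp
  finally show ?case .
qed (simp add: B_def)

text \<open>\<open>T ^^ n\<close> plays the role of \<open>n\<close>-fold integration, so \<open>B n\<close> is the \<open>n\<close>-th inner product in terms of
  the highest derivatives.\<close>

theorem left_definite_space_range:
  assumes n: "0 < n" and ipn: "\<And>g h. \<lbrakk>g \<in> H; h \<in> H\<rbrakk> \<Longrightarrow> ipn ((T ^^ n) g) ((T ^^ n) h) = B n g h"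
  shows "left_definite_space s H ip A k n ((T ^^ n) ` H) ipn"
proof -
  let ?V = "(T ^^ n) ` H"
  \<comment> \<open>The summand \<open>i = 0\<close> of the form. It gives definiteness and
    transfers Cauchy sequences from V_n to \<open>H\<close>.\<close>
  have nrm_ge: "nrm g \<le> ip_norm ipn ((T ^^ n) g)" if "g \<in> H" for g
    using Re_B_ge[OF that, of 0 n] that nrm_nonneg by (simp add: ip_norm_def[of ipn] ipn real_le_rsqrt)
  have inner: "inner_product_on s ?V ipn"
    unfolding inner_product_on_def
  proof (intro conjI ballI allI impI; elim imageE; hypsubst)
    fix f g h assume "f \<in> H" "g \<in> H" "h \<in> H"
    then show "ipn ((T ^^ n) f + (T ^^ n) g) ((T ^^ n) h)
             = ipn ((T ^^ n) f) ((T ^^ n) h) + ipn ((T ^^ n) g) ((T ^^ n) h)"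
      by (simp add: ipn B_add_left flip: Tn_add)
  next
    fix c f g assume "f \<in> H" "g \<in> H"
    then show "ipn (s c ((T ^^ n) f)) ((T ^^ n) g) = c * ipn ((T ^^ n) f) ((T ^^ n) g)"
      by (simp add: ipn B_scale_left flip: Tn_scale)
  next
    fix f g assume "f \<in> H" "g \<in> H"
    then show "ipn ((T ^^ n) g) ((T ^^ n) f) = cnj (ipn ((T ^^ n) f) ((T ^^ n) g))"
      by (simp add: ipn B_cnj[of f g])
  next
    fix f assume "f \<in> H"
    then show "0 \<le> Re (ipn ((T ^^ n) f) ((T ^^ n) f))"
      using k_pos by (simp add: ipn Re_B_self sum_nonneg)
  next
    fix f assume f: "f \<in> H" "ipn ((T ^^ n) f) ((T ^^ n) f) = 0"
    then have "nrm f = 0"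
      using nrm_ge[of f] nrm_nonneg[of f] by (simp add: ip_norm_def[of ipn])
    then have "f = 0" using nrm_eq_0 f by blast
    then show "(T ^^ n) f = 0" by simp
  qed
  have complete_V: "\<exists>x\<in>?V. (\<lambda>m. ip_norm ipn (X m - x)) \<longlonglongrightarrow> 0"
    if X: "range X \<subseteq> ?V" and Cauchy: "\<forall>e>0. \<exists>M. \<forall>m\<ge>M. \<forall>l\<ge>M. ip_norm ipn (X m - X l) < e" for X
  proof -
    have "\<forall>m. \<exists>g\<in>H. X m = (T ^^ n) g" using X by blast
    then obtain G where GH: "\<And>m. G m \<in> H" and G: "\<And>m. X m = (T ^^ n) (G m)" by metis
    have "nrm (G m - G l) \<le> ip_norm ipn (X m - X l)" for m l
      using nrm_ge[of "G m - G l"] GH by (simp add: G Tn_diff)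
    then have "\<exists>M. \<forall>m\<ge>M. \<forall>l\<ge>M. nrm (G m - G l) < e" if "e > 0" for e
      using Cauchy that by (meson le_less_trans)
    then obtain g where g: "g \<in> H" and lim: "(\<lambda>m. nrm (G m - g)) \<longlonglongrightarrow> 0"
      using complete[of G] GH by metis
    \<comment> \<open>Conversely, the norm of V_n involves finitely many bounded powers of
      \<open>T\<close>, so convergence of the highest derivatives in \<open>H\<close>
      suffices.\<close>
    have Tlim: "(\<lambda>m. nrm ((T ^^ i) (G m - g))) \<longlonglongrightarrow> 0" for i
    proof (rule tendsto_sandwich[OF _ _ tendsto_const])
      show "(\<lambda>m. \<bar>C\<bar> ^ i * nrm (G m - g)) \<longlonglongrightarrow> 0"
        using tendsto_mult_left[OF lim] by simp
    qed (use GH g in \<open>auto simp: nrm_nonneg Tn_bounded\<close>)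
    have "(\<lambda>m. sqrt (\<Sum>i\<le>n. (n choose i) * k ^ i * (nrm ((T ^^ i) (G m - g)))\<^sup>2)) \<longlonglongrightarrow>
        sqrt (\<Sum>i\<le>n. (n choose i) * k ^ i * 0\<^sup>2)"
      by (intro tendsto_intros Tlim)
    also have "(\<lambda>m. sqrt (\<Sum>i\<le>n. (n choose i) * k ^ i * (nrm ((T ^^ i) (G m - g)))\<^sup>2))
        = (\<lambda>m. ip_norm ipn (X m - (T ^^ n) g))"
      using GH g by (simp add: fun_eq_iff ip_norm_def[of ipn] G ipn Re_B_self flip: Tn_diff)
    finally show ?thesis using g by auto
  qed
  have hilbert_V: "hilbert_space s ?V ipn"
    unfolding hilbert_space_def
    using inner complete_V subspace_range_Tn vector_space_axioms by blast
  interpret V: hilbert s ?V ipn by unfold_locales (rule hilbert_V)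
  have dom: "Domain (A ^^ n) = (T ^^ (2 * n)) ` H"
    using n by (auto simp: A_pow)
  have T2n: "(T ^^ (2 * n)) x = (T ^^ n) ((T ^^ n) x)" for x
    by (simp add: mult_2 funpow_add)
  have dom_V: "(T ^^ (2 * n)) ` H \<subseteq> ?V"
    by (auto simp: T2n)
  have formula: "ipn ((T ^^ (2 * n)) g) ((T ^^ n) h) = ip ((S ^^ n) g) ((T ^^ n) h)"
    if "g \<in> H" "h \<in> H" for g h
    using that by (simp add: T2n ipn S_pow_eq_B)
  have dense: "dense_in_ip ipn ?V ((T ^^ (2 * n)) ` H)"
  proof (rule V.dense_in_ipI[OF subspace_range_Tn dom_V])
    fix y assume y: "y \<in> ?V" and orth: "\<And>x. x \<in> (T ^^ (2 * n)) ` H \<Longrightarrow> ipn x y = 0"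
    then have yH: "y \<in> H" by auto
    then obtain g where "g \<in> H" "(S ^^ n) g = y" using Sn_surj by blast
    then have "ip y y = 0" using orth[of "(T ^^ (2 * n)) g"] y formula by auto
    then show "y = 0" using ip_eq_0 yH by blast
  qed
  have lower: "k ^ n * Re (ip x x) \<le> Re (ipn x x)" if "x \<in> ?V" for x
    using that Re_B_ge[of _ n n] by (auto simp: ipn nrm_power2)
  show ?thesis
    unfolding left_definite_space_def dom
    using hilbert A_self_adjoint k_pos A_bounded_below n hilbert_V subspace_range_Tn dom_V dense lower
    by (auto simp: A_pow formula)
qed

end

section \<open>Lebesgue's differentiation theorem\<close>

text \<open>Henstock's lemma makes the intervals on which the difference quotient is off by more than
  \<open>q\<close> short in total, and the Vitali covering lemma turns this into a bound for the exceptional set.\<close>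

lemma negligible_not_derivative:
  fixes f :: "real \<Rightarrow> 'a::euclidean_space"
  assumes f: "f integrable_on {a..b}" and q: "q > 0"
  defines "F \<equiv> \<lambda>x. integral {a..x} f"
  shows "negligible {x\<in>{a..b}. \<forall>r>0. \<exists>y\<in>{a..b}. \<bar>y - x\<bar> < r \<and>
           norm (F y - F x - (y - x) *\<^sub>R f x) > q * \<bar>y - x\<bar>}" (is "negligible ?E")
  unfolding negligible_outer_le
proof (intro allI impI)
  fix e :: real assume e: "e > 0"
  \<comment> \<open>The 5 is the enlargement factor of the Vitali covering lemma; \<open>q\<close>
    converts the error in Henstock's lemma into length.\<close>
  define \<epsilon> where "\<epsilon> = q * e / 5"
  have "\<epsilon> > 0" using e q by (simp add: \<epsilon>_def)
  then obtain \<gamma> where \<gamma>: "gauge \<gamma>"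
    and fine: "\<And>p. \<lbrakk>p tagged_partial_division_of (cbox a b); \<gamma> fine p\<rbrakk> \<Longrightarrow>
             (\<Sum>(x,k)\<in>p. norm (measure lborel k *\<^sub>R f x - integral k f)) < \<epsilon>"
    using Henstock_lemma[of f a b \<epsilon>] f by auto
  define E where "E = ?E"
  define Q where "Q = (\<lambda>x y. y \<in> {a..b} \<and> {min x y..max x y} \<subseteq> \<gamma> x \<and>
      norm (F y - F x - (y - x) *\<^sub>R f x) > q * \<bar>y - x\<bar>)"
  have Eab: "x \<in> {a..b}" if "x \<in> E" for x
    using that by (simp add: E_def)
  have "\<exists>y. Q x y" if x: "x \<in> E" for x
  proof -
    have "open (\<gamma> x)" "x \<in> \<gamma> x" using \<gamma> by (auto simp: gauge_def)
    then obtain r where r: "r > 0" "ball x r \<subseteq> \<gamma> x"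
      using open_contains_ball by blast
    from x r(1) obtain y where y: "y \<in> {a..b}" "\<bar>y - x\<bar> < r"
        "norm (F y - F x - (y - x) *\<^sub>R f x) > q * \<bar>y - x\<bar>"
      unfolding E_def by blast
    have "{min x y..max x y} \<subseteq> ball x r"
      using y(2) by (auto simp: dist_real_def)
    then show ?thesis using r y unfolding Q_def by blast
  qed
  then obtain Y where QY: "\<And>x. x \<in> E \<Longrightarrow> Q x (Y x)" by metis
  have Y: "Y x \<in> {a..b}" and Y\<gamma>: "{min x (Y x)..max x (Y x)} \<subseteq> \<gamma> x"
    and Yn: "norm (F (Y x) - F x - (Y x - x) *\<^sub>R f x) > q * \<bar>Y x - x\<bar>" if "x \<in> E" for x
    using QY[OF that] by (simp_all add: Q_def)
  have Yne: "Y x \<noteq> x" if "x \<in> E" for x using Yn[OF that] by auto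
  \<comment> \<open>Centre and radius present the interval between \<open>x\<close> and
    \<open>Y x\<close> as a ball, as the covering lemma requires. The point \<open>x\<close> is an
    endpoint of it and thus a legitimate tag.\<close>
  define c where "c = (\<lambda>x. (x + Y x) / 2)"
  define r where "r = (\<lambda>x. \<bar>Y x - x\<bar> / 2)"
  define I where "I = (\<lambda>x. {min x (Y x)..max x (Y x)})"
  have cball: "cball (c x) (r x) = I x" for x
    by (auto simp: cball_eq_atLeastAtMost c_def r_def I_def min_def max_def field_simps)
  have r: "0 < r x \<and> r x \<le> b - a" if "x \<in> E" for x
    using Y[OF that] Yne[OF that] Eab[OF that] by (auto simp: r_def)
  have cover: "E \<subseteq> (\<Union>x\<in>E. cball (c x) (r x))"
    unfolding cball by (auto simp: I_def)
  obtain C where C: "countable C" "C \<subseteq> E"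
     "pairwise (\<lambda>i j. disjnt (cball (c i) (r i)) (cball (c j) (r j))) C"
     "E \<subseteq> (\<Union>i\<in>C. cball (c i) (5 * r i))"
    using Vitali_covering_lemma_cballs[OF cover r] by blast
  \<comment> \<open>Henstock's lemma concerns finite families; the countable union follows because
    the bound does not depend on \<open>C'\<close>.\<close>
  have finite_bound: "measure lebesgue (\<Union>i\<in>C'. cball (c i) (5 * r i)) \<le> e"
    if C': "C' \<subseteq> C" "finite C'" for C'
  proof -
    have CE: "x \<in> E" if "x \<in> C'" for x using that C' C by blast
    define p where "p = (\<lambda>x. (x, I x)) ` C'"
    have p: "p tagged_partial_division_of (cbox a b)"
      unfolding tagged_partial_division_of_def
    proof (intro conjI allI impI)
      show "finite p" using C' by (simp add: p_def)
      show "x \<in> K" "K \<subseteq> cbox a b" "\<exists>u v. K = cbox u v" if "(x, K) \<in> p" for x K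
        using that CE Y Eab by (force simp: p_def I_def)+
      fix x1 K1 x2 K2 assume *: "(x1, K1) \<in> p \<and> (x2, K2) \<in> p \<and> (x1, K1) \<noteq> (x2, K2)"
      then have x: "x1 \<in> C" "x2 \<in> C" "x1 \<noteq> x2" "K1 = I x1" "K2 = I x2"
        using C'(1) by (auto simp: p_def)
      then have "disjnt (I x1) (I x2)"
        using C(3) unfolding cball by (auto simp: pairwise_def)
      then show "interior K1 \<inter> interior K2 = {}"
        using x interior_subset unfolding disjnt_def by blast
    qed
    have "\<gamma> fine p" using Y\<gamma> CE by (auto simp: fine_def p_def I_def)
    have "q * (\<Sum>x\<in>C'. 2 * r x) = (\<Sum>x\<in>C'. q * \<bar>Y x - x\<bar>)"
      by (simp add: r_def sum_distrib_left)
    also have "\<dots> \<le> (\<Sum>x\<in>C'. norm (measure lborel (I x) *\<^sub>R f x - integral (I x) f))"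
    proof (rule sum_mono)
      fix x assume "x \<in> C'"
      then have x: "x \<in> E" by (rule CE)
      have comb: "integral {u..v} f = F v - F u" if "u \<le> v" "u \<in> {a..b}" "v \<in> {a..b}" for u v
      proof -
        have "f integrable_on {a..v}"
          by (rule integrable_on_subinterval[OF f]) (use that in auto)
        then show ?thesis
          using that Henstock_Kurzweil_Integration.integral_combine[of a u v f] by (simp add: F_def algebra_simps)
      qed
      have "norm (measure lborel (I x) *\<^sub>R f x - integral (I x) f) = norm (F (Y x) - F x - (Y x - x) *\<^sub>R f x)"
      proof (cases "x \<le> Y x")
        case True
        then show ?thesis
          using comb[of x "Y x"] Y[OF x] Eab[OF x] by (simp add: I_def norm_minus_commute)
      next
        case False
        then have "integral (I x) f = F x - F (Y x)" "measure lborel (I x) = x - Y x"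
          using comb[of "Y x" x] Y[OF x] Eab[OF x] by (simp_all add: I_def)
        then have "measure lborel (I x) *\<^sub>R f x - integral (I x) f = F (Y x) - F x - (Y x - x) *\<^sub>R f x"
          by (simp add: scaleR_left_diff_distrib)
        then show ?thesis by simp
      qed
      then show "q * \<bar>Y x - x\<bar> \<le> norm (measure lborel (I x) *\<^sub>R f x - integral (I x) f)"
        using Yn[OF x] by simp
    qed
    also have "\<dots> = (\<Sum>(x,k)\<in>p. norm (measure lborel k *\<^sub>R f x - integral k f))"
      unfolding p_def by (subst sum.reindex) (auto simp: inj_on_def)
    also have "\<dots> < \<epsilon>" using fine p \<open>\<gamma> fine p\<close> by blast
    finally have "(\<Sum>x\<in>C'. 2 * r x) < e / 5" using q by (simp add: \<epsilon>_def field_simps)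
    have "measure lebesgue (\<Union>i\<in>C'. cball (c i) (5 * r i)) \<le> (\<Sum>i\<in>C'. measure lebesgue (cball (c i) (5 * r i)))"
      by (rule measure_UNION_le) (use C' in auto)
    also have "\<dots> = (\<Sum>i\<in>C'. 5 * (2 * r i))"
      using r CE by (intro sum.cong refl) (force simp: cball_eq_atLeastAtMost)
    also have "\<dots> = 5 * (\<Sum>i\<in>C'. 2 * r i)"
      by (rule sum_distrib_left[symmetric])
    also have "\<dots> \<le> e"
      using \<open>(\<Sum>x\<in>C'. 2 * r x) < e / 5\<close> by linarith
    finally show ?thesis .
  qed
  have "(\<Union>i\<in>C. cball (c i) (5 * r i)) \<in> lmeasurable"
       "measure lebesgue (\<Union>i\<in>C. cball (c i) (5 * r i)) \<le> e"
    by (rule fmeasurable_UN_bound[where B = e] measure_UN_bound; use C(1) finite_bound in simp)+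
  then show "\<exists>T. ?E \<subseteq> T \<and> T \<in> lmeasurable \<and> measure lebesgue T \<le> e"
    using C(4) unfolding E_def by blast
qed

text \<open>Where the derivative fails to be \<open>f x\<close>, the error bound is violated for
  some \<open>q = 1 / (n + 1)\<close>, so the exceptional points lie in a countable union of
  negligible sets.\<close>

theorem Lebesgue_differentiation:
  fixes f :: "real \<Rightarrow> 'a::euclidean_space"
  assumes f: "f integrable_on {a..b}"
  obtains N where "negligible N"
    "\<And>x. x \<in> {a..b} - N \<Longrightarrow> ((\<lambda>x. integral {a..x} f) has_vector_derivative f x) (at x within {a..b})"
proof
  define F where "F = (\<lambda>x. integral {a..x} f)"
  define E where "E = (\<lambda>q. {x\<in>{a..b}. \<forall>r>0. \<exists>y\<in>{a..b}. \<bar>y - x\<bar> < r \<and>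
           norm (F y - F x - (y - x) *\<^sub>R f x) > q * \<bar>y - x\<bar>})"
  show "negligible (\<Union>n. E (1 / real (Suc n)))"
  proof (rule negligible_countable_Union)
    fix S assume "S \<in> range (\<lambda>n. E (1 / real (Suc n)))"
    then obtain n where "S = E (1 / real (Suc n))" by blast
    then show "negligible S"
      using negligible_not_derivative[OF f, of "1 / real (Suc n)"] by (simp only: E_def F_def) simp
  qed auto
  fix x assume x: "x \<in> {a..b} - (\<Union>n. E (1 / real (Suc n)))"
  show "((\<lambda>x. integral {a..x} f) has_vector_derivative f x) (at x within {a..b})"
    unfolding has_vector_derivative_def has_derivative_within_alt F_def[symmetric]
  proof (intro conjI allI impI)
    show "bounded_linear (\<lambda>t. t *\<^sub>R f x)" by (rule bounded_linear_scaleR_left)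
    fix e :: real assume "e > 0"
    then obtain n where "1 / real (Suc n) < e"
      by (metis inverse_eq_divide reals_Archimedean)
    then obtain q where q: "q < e" "x \<notin> E q" using x by blast
    have "\<exists>r>0. \<forall>y\<in>{a..b}. \<bar>y - x\<bar> < r \<longrightarrow> norm (F y - F x - (y - x) *\<^sub>R f x) \<le> q * \<bar>y - x\<bar>"
    proof (rule ccontr)
      assume no: "\<not> ?thesis"
      have "\<exists>y\<in>{a..b}. \<bar>y - x\<bar> < r \<and> q * \<bar>y - x\<bar> < norm (F y - F x - (y - x) *\<^sub>R f x)" if "r > 0" for r
        using no that not_le by blast
      then have "x \<in> E q" using x unfolding E_def by blast
      then show False using q by blast
    qed
    then obtain r where r: "r > 0" and le: "\<And>y. y \<in> {a..b} \<Longrightarrow> \<bar>y - x\<bar> < r \<Longrightarrow>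
        norm (F y - F x - (y - x) *\<^sub>R f x) \<le> q * \<bar>y - x\<bar>" by blast
    have "norm (F y - F x - (y - x) *\<^sub>R f x) \<le> e * norm (y - x)" if "y \<in> {a..b}" "norm (y - x) < r" for y
      using le[of y] that q(1)
      by (smt (verit, best) mult_right_mono norm_ge_zero real_norm_def)
    then show "\<exists>d>0. \<forall>y\<in>{a..b}. norm (y - x) < d \<longrightarrow>
        norm (F y - F x - (y - x) *\<^sub>R f x) \<le> e * norm (y - x)"
      using r by blast
  qed
qed

section \<open>Absolutely continuous functions\<close>

text \<open>With pairs of endpoints in place of sets, inserting, cutting and refining intervals
  become statements about inequalities. Degenerate intervals are excluded, so that no pair is
  separated from itself and families living in separated intervals are disjoint.\<close>

definition subintervals :: "real \<Rightarrow> real \<Rightarrow> (real \<times> real) set \<Rightarrow> bool" where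
  "subintervals x y P \<longleftrightarrow> finite P \<and> (\<forall>(u, v)\<in>P. x \<le> u \<and> u < v \<and> v \<le> y) \<and>
     (\<forall>p\<in>P. \<forall>q\<in>P. p \<noteq> q \<longrightarrow> snd p \<le> fst q \<or> snd q \<le> fst p)"

definition variation_sum :: "(real \<Rightarrow> 'a::real_normed_vector) \<Rightarrow> (real \<times> real) set \<Rightarrow> real" where
  "variation_sum f P = (\<Sum>(u, v)\<in>P. norm (f v - f u))"

definition abs_cont :: "real \<Rightarrow> real \<Rightarrow> (real \<Rightarrow> 'a::real_normed_vector) \<Rightarrow> bool" where
  "abs_cont a b f \<longleftrightarrow> (\<forall>\<epsilon>>0. \<exists>\<delta>>0. \<forall>P. subintervals a b P \<and> (\<Sum>(u, v)\<in>P. v - u) < \<delta>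
     \<longrightarrow> variation_sum f P < \<epsilon>)"

lemma subintervals_finite: "subintervals x y P \<Longrightarrow> finite P"
  by (simp add: subintervals_def)

lemma subintervals_bounds:
  assumes "subintervals x y P" "(u, v) \<in> P"
  shows "x \<le> u" "u < v" "v \<le> y"
  using assms by (auto simp: subintervals_def)

lemma subintervals_apart:
  "\<lbrakk>subintervals x y P; p \<in> P; q \<in> P; p \<noteq> q\<rbrakk> \<Longrightarrow> snd p \<le> fst q \<or> snd q \<le> fst p"
  by (auto simp: subintervals_def)

lemma subintervals_empty [simp]: "subintervals x y {}"
  by (simp add: subintervals_def)

lemma subintervals_singleton: "\<lbrakk>x \<le> u; u < v; v \<le> y\<rbrakk> \<Longrightarrow> subintervals x y {(u, v)}"
  by (simp add: subintervals_def)

lemma subintervals_mono: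
  assumes "subintervals x y P" "x' \<le> x" "y \<le> y'"
  shows "subintervals x' y' P"
  using assms by (fastforce simp: subintervals_def)

lemma variation_sum_nonneg: "0 \<le> variation_sum f P"
  by (auto simp: variation_sum_def intro!: sum_nonneg)

lemma AC_on_imp_abs_cont:
  assumes "AC_on a b f"
  shows "abs_cont a b f"
  unfolding abs_cont_def
proof (intro allI impI)
  fix \<epsilon> :: real assume "\<epsilon> > 0"
  then obtain \<delta> where \<delta>: "\<delta> > 0" and small: "\<And>d S. \<lbrakk>d division_of S; S \<subseteq> {a..b}; (\<Sum>K\<in>d. Sup K - Inf K) < \<delta>\<rbrakk>
      \<Longrightarrow> (\<Sum>K\<in>d. cmod (f (Sup K) - f (Inf K))) < \<epsilon>"
    using assms unfolding AC_on_def by metis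
  have "variation_sum f P < \<epsilon>" if P: "subintervals a b P" and len: "(\<Sum>(u, v)\<in>P. v - u) < \<delta>" for P
  proof -
    define I where "I = (\<lambda>(u::real, v). {u..v})"
    have bounds: "a \<le> fst p" "fst p < snd p" "snd p \<le> b" if "p \<in> P" for p
      using subintervals_bounds[OF P, of "fst p" "snd p"] that by auto
    have Sup: "Sup (I p) = snd p" and Inf: "Inf (I p) = fst p" if "p \<in> P" for p
      using bounds[OF that] by (auto simp: I_def split_beta)
    have inj: "inj_on I P"
      by (rule inj_onI) (metis Sup Inf prod_eqI)
    have "I ` P division_of \<Union>(I ` P)"
    proof (rule division_ofI)
      fix K assume "K \<in> I ` P"
      then show "K \<noteq> {}" "\<exists>u v. K = cbox u v"
        using bounds by (force simp: I_def split_beta)+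
    next
      fix K1 K2 assume "K1 \<in> I ` P" "K2 \<in> I ` P" "K1 \<noteq> K2"
      then obtain p q where pq: "p \<in> P" "q \<in> P" "p \<noteq> q" "K1 = I p" "K2 = I q" by blast
      with subintervals_apart[OF P] have "snd p \<le> fst q \<or> snd q \<le> fst p" by blast
      then show "interior K1 \<inter> interior K2 = {}"
        by (auto simp: pq I_def split_beta)
    qed (use subintervals_finite[OF P] in auto)
    moreover have "\<Union>(I ` P) \<subseteq> {a..b}"
      using bounds by (force simp: I_def split_beta)
    moreover have "(\<Sum>K\<in>I ` P. Sup K - Inf K) = (\<Sum>(u, v)\<in>P. v - u)"
      by (subst sum.reindex[OF inj]) (auto simp: Sup Inf split_beta intro!: sum.cong)
    moreover have "(\<Sum>K\<in>I ` P. cmod (f (Sup K) - f (Inf K))) = variation_sum f P"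
      unfolding variation_sum_def
      by (subst sum.reindex[OF inj]) (auto simp: Sup Inf split_beta intro!: sum.cong)
    ultimately show ?thesis using small[of "I ` P"] len by simp
  qed
  then show "\<exists>\<delta>>0. \<forall>P. subintervals a b P \<and> (\<Sum>(u, v)\<in>P. v - u) < \<delta> \<longrightarrow> variation_sum f P < \<epsilon>"
    using \<delta> by blast
qed

lemma abs_contE:
  assumes "abs_cont a b f" "\<epsilon> > 0"
  obtains \<delta> where "\<delta> > 0"
    "\<And>P. \<lbrakk>subintervals a b P; (\<Sum>(u, v)\<in>P. v - u) < \<delta>\<rbrakk> \<Longrightarrow> variation_sum f P < \<epsilon>"
  using assms unfolding abs_cont_def by metis

text \<open>Applied to real and imaginary parts, whose increments are dominated by those of the
  function.\<close>

lemma abs_cont_le: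
  assumes f: "abs_cont a b f"
    and le: "\<And>u v. \<lbrakk>a \<le> u; u < v; v \<le> b\<rbrakk> \<Longrightarrow> norm (g v - g u) \<le> norm (f v - f u)"
  shows "abs_cont a b g"
  unfolding abs_cont_def
proof (intro allI impI)
  fix \<epsilon> :: real assume "\<epsilon> > 0"
  then obtain \<delta> where \<delta>: "\<delta> > 0"
    "\<And>P. \<lbrakk>subintervals a b P; (\<Sum>(u, v)\<in>P. v - u) < \<delta>\<rbrakk> \<Longrightarrow> variation_sum f P < \<epsilon>"
    using f abs_contE by metis
  moreover have "variation_sum g P \<le> variation_sum f P" if "subintervals a b P" for P
    unfolding variation_sum_def
    by (rule sum_mono) (use le subintervals_bounds[OF that] in auto)
  ultimately show "\<exists>\<delta>>0. \<forall>P. subintervals a b P \<and> (\<Sum>(u, v)\<in>P. v - u) < \<delta> \<longrightarrow> variation_sum g P < \<epsilon>"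
    by (meson le_less_trans)
qed

lemma abs_cont_diff:
  assumes f: "abs_cont a b f" and g: "abs_cont a b g"
  shows "abs_cont a b (\<lambda>x. f x - g x)"
  unfolding abs_cont_def
proof (intro allI impI)
  fix \<epsilon> :: real assume "\<epsilon> > 0"
  then have "\<epsilon> / 2 > 0" by simp
  obtain \<delta> where \<delta>: "\<delta> > 0"
    "\<And>P. \<lbrakk>subintervals a b P; (\<Sum>(u, v)\<in>P. v - u) < \<delta>\<rbrakk> \<Longrightarrow> variation_sum f P < \<epsilon> / 2"
    by (rule abs_contE[OF f \<open>\<epsilon> / 2 > 0\<close>]) blast
  obtain \<delta>' where \<delta>': "\<delta>' > 0"
    "\<And>P. \<lbrakk>subintervals a b P; (\<Sum>(u, v)\<in>P. v - u) < \<delta>'\<rbrakk> \<Longrightarrow> variation_sum g P < \<epsilon> / 2"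
    by (rule abs_contE[OF g \<open>\<epsilon> / 2 > 0\<close>]) blast
  have "variation_sum (\<lambda>x. f x - g x) P \<le> variation_sum f P + variation_sum g P" for P
  proof -
    have "norm (f v - g v - (f u - g u)) \<le> norm (f v - f u) + norm (g v - g u)" for u v
      using norm_triangle_ineq4[of "f v - f u" "g v - g u"] by (simp add: algebra_simps)
    then show ?thesis
      unfolding variation_sum_def sum.distrib[symmetric] by (intro sum_mono) auto
  qed
  then have "variation_sum (\<lambda>x. f x - g x) P < \<epsilon>"
    if "subintervals a b P" "(\<Sum>(u, v)\<in>P. v - u) < min \<delta> \<delta>'" for P
    using \<delta>(2)[OF that(1)] \<delta>'(2)[OF that(1)] that(2) by (smt (verit) field_sum_of_halves)
  then show "\<exists>\<delta>>0. \<forall>P. subintervals a b P \<and> (\<Sum>(u, v)\<in>P. v - u) < \<delta> \<longrightarrow> variation_sum (\<lambda>x. f x - g x) P < \<epsilon>"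
    using \<delta>(1) \<delta>'(1) by (intro exI[of _ "min \<delta> \<delta>'"]) auto
qed

text \<open>Neighbours may share endpoints, so the open intervals are measured: they are disjoint
  and equally long. \<open>U\<close> is an interval in one application and a cover of a null set in
  the other.\<close>

lemma sum_length_le_measure:
  assumes P: "subintervals x y P" and U: "U \<in> lmeasurable" "\<And>u v. (u, v) \<in> P \<Longrightarrow> {u<..<v} \<subseteq> U"
  shows "(\<Sum>(u, v)\<in>P. v - u) \<le> measure lebesgue U"
proof -
  have "(\<Sum>(u, v)\<in>P. v - u) = (\<Sum>p\<in>P. measure lebesgue {fst p<..<snd p})"
    using subintervals_bounds[OF P] by (intro sum.cong) (auto simp: less_imp_le)
  also have "\<dots> = measure lebesgue (\<Union>p\<in>P. {fst p<..<snd p})"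
  proof (rule measure_finite_Union[symmetric])
    show "disjoint_family_on (\<lambda>p. {fst p<..<snd p}) P"
      unfolding disjoint_family_on_def
    proof (intro ballI impI)
      fix p q assume "p \<in> P" "q \<in> P" "p \<noteq> q"
      then have "snd p \<le> fst q \<or> snd q \<le> fst p" by (rule subintervals_apart[OF P])
      then show "{fst p<..<snd p} \<inter> {fst q<..<snd q} = {}" by auto
    qed
  next
    fix p assume "p \<in> P"
    then show "emeasure lebesgue {fst p<..<snd p} \<noteq> \<infinity>"
      using subintervals_bounds[OF P, of "fst p" "snd p"] by simp
  qed (use subintervals_finite[OF P] in auto)
  also have "\<dots> \<le> measure lebesgue U"
  proof (rule measure_mono_fmeasurable)
    show "(\<Union>p\<in>P. {fst p<..<snd p}) \<subseteq> U"
    proof (rule UN_least)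
      fix p assume "p \<in> P"
      then show "{fst p<..<snd p} \<subseteq> U" using U(2)[of "fst p" "snd p"] by simp
    qed
  qed (use U in \<open>auto intro!: sets.finite_UN subintervals_finite[OF P]\<close>)
  finally show ?thesis .
qed

lemma sum_length_le:
  assumes "subintervals x y P" "x \<le> y"
  shows "(\<Sum>(u, v)\<in>P. v - u) \<le> y - x"
proof -
  have "{u<..<v} \<subseteq> {x..y}" if "(u, v) \<in> P" for u v
    using subintervals_bounds[OF assms(1) that] by auto
  then have "(\<Sum>(u, v)\<in>P. v - u) \<le> measure lebesgue {x..y}"
    by (intro sum_length_le_measure[OF assms(1)]) auto
  then show ?thesis using assms(2) by simp
qed

lemma subintervals_insert:
  assumes P: "subintervals x y P" and uv: "x \<le> u" "u < v" "v \<le> y"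
    and apart: "\<And>p. p \<in> P \<Longrightarrow> snd p \<le> u \<or> v \<le> fst p"
  shows "subintervals x y (insert (u, v) P)" "(u, v) \<notin> P"
proof -
  show "(u, v) \<notin> P" using apart[of "(u, v)"] uv by auto
  show "subintervals x y (insert (u, v) P)"
    using assms unfolding subintervals_def by auto
qed

lemma subintervals_subset:
  assumes "subintervals x y P" "Q \<subseteq> P" "\<And>u v. (u, v) \<in> Q \<Longrightarrow> x' \<le> u \<and> v \<le> y'"
  shows "subintervals x' y' Q"
  unfolding subintervals_def
proof (intro conjI)
  show "finite Q" using assms subintervals_finite finite_subset by blast
  show "\<forall>(u, v)\<in>Q. x' \<le> u \<and> u < v \<and> v \<le> y'"
    using assms(2,3) subintervals_bounds(2)[OF assms(1)] by blast
  show "\<forall>p\<in>Q. \<forall>q\<in>Q. p \<noteq> q \<longrightarrow> snd p \<le> fst q \<or> snd q \<le> fst p"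
    using subintervals_apart[OF assms(1)] assms(2) by blast
qed

lemma variation_sum_insert:
  "\<lbrakk>finite P; (u, v) \<notin> P\<rbrakk> \<Longrightarrow> variation_sum f (insert (u, v) P) = norm (f v - f u) + variation_sum f P"
  by (simp add: variation_sum_def)

text \<open>At most one interval contains \<open>y\<close> in its interior; cutting it at
  \<open>y\<close> does not decrease the sum, by the triangle inequality.\<close>

lemma variation_sum_split:
  assumes P: "subintervals x z P" and y: "x \<le> y" "y \<le> z"
  obtains P1 P2 where "subintervals x y P1" "subintervals y z P2"
    "variation_sum f P \<le> variation_sum f P1 + variation_sum f P2"
proof -
  define L R M where "L = {p \<in> P. snd p \<le> y}" and "R = {p \<in> P. y \<le> fst p}"
    and "M = {p \<in> P. fst p < y \<and> y < snd p}"
  have fin: "finite P" using P by (rule subintervals_finite)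
  have finLRM: "finite L" "finite R" "finite M" using fin by (auto simp: L_def R_def M_def)
  have L: "subintervals x y L" and R: "subintervals y z R"
    using subintervals_bounds[OF P] by (auto simp: L_def R_def intro!: subintervals_subset[OF P])
  have disj: "L \<inter> R = {}" "(L \<union> R) \<inter> M = {}"
    using subintervals_bounds[OF P] by (force simp: L_def R_def M_def)+
  have un: "P = (L \<union> R) \<union> M" by (auto simp: L_def R_def M_def)
  have sum: "variation_sum f P = variation_sum f L + variation_sum f R + variation_sum f M"
    unfolding un variation_sum_def using disj finLRM by (simp add: sum.union_disjoint)
  show ?thesis
  proof (cases "M = {}")
    case True
    then show ?thesis using that[OF L R] sum by (simp add: variation_sum_def)
  next
    case False
    then obtain u v where uv: "(u, v) \<in> M" by auto
    have uvP: "(u, v) \<in> P" "u < y" "y < v" using uv by (auto simp: M_def)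
    have "M = {(u, v)}"
      using uv subintervals_apart[OF P] by (force simp: M_def)
    then have M: "variation_sum f M = norm (f v - f u)" by (simp add: variation_sum_def)
    have L': "snd p \<le> u" if "p \<in> L" for p
      using that subintervals_apart[OF P, of p "(u, v)"] subintervals_bounds[OF P, of "fst p" "snd p"] uvP
      by (fastforce simp: L_def)
    have R': "v \<le> fst p" if "p \<in> R" for p
      using that subintervals_apart[OF P, of p "(u, v)"] subintervals_bounds[OF P, of "fst p" "snd p"] uvP
      by (fastforce simp: R_def)
    have ins1: "subintervals x y (insert (u, y) L)" "(u, y) \<notin> L"
      using subintervals_insert[OF L, of u y] L' uvP subintervals_bounds[OF P uvP(1)] by auto
    have ins2: "subintervals y z (insert (y, v) R)" "(y, v) \<notin> R"
      using subintervals_insert[OF R, of y v] R' uvP subintervals_bounds[OF P uvP(1)] by auto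
    have "norm (f v - f u) \<le> norm (f y - f u) + norm (f v - f y)"
      using norm_triangle_ineq[of "f y - f u" "f v - f y"] by simp
    then show ?thesis
      using that[OF ins1(1) ins2(1)] sum M ins1(2) ins2(2) finLRM by (simp add: variation_sum_insert)
  qed
qed

section \<open>Total variation and the Jordan decomposition\<close>

definition total_variation :: "(real \<Rightarrow> 'a::real_normed_vector) \<Rightarrow> real \<Rightarrow> real \<Rightarrow> ennreal" where
  "total_variation f x y = (SUP P\<in>{P. subintervals x y P}. ennreal (variation_sum f P))"

lemma total_variation_upper: "subintervals x y P \<Longrightarrow> ennreal (variation_sum f P) \<le> total_variation f x y"
  by (auto simp: total_variation_def intro: SUP_upper)

lemma total_variation_least:
  "(\<And>P. subintervals x y P \<Longrightarrow> ennreal (variation_sum f P) \<le> B) \<Longrightarrow> total_variation f x y \<le> B"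
  by (auto simp: total_variation_def intro: SUP_least)

lemma total_variation_mono:
  "\<lbrakk>x' \<le> x; y \<le> y'\<rbrakk> \<Longrightarrow> total_variation f x y \<le> total_variation f x' y'"
  by (intro total_variation_least total_variation_upper) (rule subintervals_mono)

lemma total_variation_split:
  assumes "x \<le> y" "y \<le> z"
  shows "total_variation f x z \<le> total_variation f x y + total_variation f y z"
proof (rule total_variation_least)
  fix P assume "subintervals x z P"
  then obtain P1 P2 where P: "subintervals x y P1" "subintervals y z P2"
    "variation_sum f P \<le> variation_sum f P1 + variation_sum f P2"
    using variation_sum_split assms by metis
  then have "ennreal (variation_sum f P) \<le> ennreal (variation_sum f P1) + ennreal (variation_sum f P2)"
    by (simp add: variation_sum_nonneg flip: ennreal_plus)
  also have "\<dots> \<le> total_variation f x y + total_variation f y z"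
    using P by (intro add_mono total_variation_upper)
  finally show "ennreal (variation_sum f P) \<le> total_variation f x y + total_variation f y z" .
qed

text \<open>A family on \<open>[x, y]\<close> is extended by the interval from \<open>y\<close> to
  \<open>z\<close>. For \<open>x = a\<close> this makes both the variation function and its
  difference with \<open>f\<close> monotone.\<close>

lemma total_variation_step:
  assumes "x \<le> y" "y < z"
  shows "total_variation f x y + ennreal (norm (f z - f y)) \<le> total_variation f x z"
proof -
  have "total_variation f x y + ennreal (norm (f z - f y))
      = (SUP P\<in>{P. subintervals x y P}. ennreal (variation_sum f P) + ennreal (norm (f z - f y)))"
    unfolding total_variation_def
    by (rule ennreal_SUP_add_left[symmetric]) (auto intro!: exI[of _ "{}"])
  also have "\<dots> \<le> total_variation f x z"
  proof (rule SUP_least)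
    fix P assume "P \<in> {P. subintervals x y P}"
    then have P: "subintervals x y P" by simp
    then have Q: "subintervals x z P" using assms by (auto intro: subintervals_mono)
    have "subintervals x z (insert (y, z) P)" "(y, z) \<notin> P"
      using subintervals_insert[OF Q, of y z] subintervals_bounds[OF P] assms by force+
    then show "ennreal (variation_sum f P) + ennreal (norm (f z - f y)) \<le> total_variation f x z"
      using total_variation_upper[of x z "insert (y, z) P" f] subintervals_finite[OF P]
      by (simp add: variation_sum_insert variation_sum_nonneg add.commute flip: ennreal_plus)
  qed
  finally show ?thesis .
qed

lemma total_variation_small:
  assumes "\<And>P. \<lbrakk>subintervals a b P; (\<Sum>(u, v)\<in>P. v - u) < \<delta>\<rbrakk> \<Longrightarrow> variation_sum f P < \<epsilon>"
    and "a \<le> x" "x \<le> y" "y \<le> b" "y - x < \<delta>"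
  shows "total_variation f x y \<le> ennreal \<epsilon>"
proof (rule total_variation_least)
  fix P assume P: "subintervals x y P"
  then have "(\<Sum>(u, v)\<in>P. v - u) < \<delta>"
    using sum_length_le[OF P] assms by simp
  moreover have "subintervals a b P"
    using subintervals_mono[OF P] assms by simp
  ultimately show "ennreal (variation_sum f P) \<le> ennreal \<epsilon>"
    using assms(1)[of P] by (simp add: ennreal_leI)
qed

text \<open>The interval is cut into \<open>n\<close> pieces shorter than the
  \<open>\<delta>\<close> that belongs to \<open>1\<close>, each of variation at most
  \<open>1\<close>. Because finiteness is only established here, the variation takes values in
  \<open>ennreal\<close>.\<close>

lemma abs_cont_total_variation_finite:
  assumes f: "abs_cont a b f" and "a \<le> b"
  shows "total_variation f a b < \<infinity>"
proof -
  obtain \<delta> where \<delta>: "\<delta> > 0"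
    "\<And>P. \<lbrakk>subintervals a b P; (\<Sum>(u, v)\<in>P. v - u) < \<delta>\<rbrakk> \<Longrightarrow> variation_sum f P < 1"
    by (rule abs_contE[OF f zero_less_one]) blast
  obtain n where n: "(b - a) / \<delta> < real n" using reals_Archimedean2 by blast
  have n0: "n > 0" using n \<delta> \<open>a \<le> b\<close>
    by (metis diff_ge_0_iff_ge divide_nonneg_pos gr0I less_le_not_le of_nat_0)
  define h where "h = (b - a) / n"
  have h: "0 \<le> h" "h < \<delta>" "real n * h = b - a"
    using n n0 \<delta>(1) \<open>a \<le> b\<close> by (auto simp: h_def field_simps)
  have "total_variation f a (a + real m * h) < \<infinity>" if "m \<le> n" for m
    using that
  proof (induction m)
    case 0
    have "total_variation f a a \<le> ennreal 1"
      by (rule total_variation_small[OF \<delta>(2)]) (use \<delta> \<open>a \<le> b\<close> in auto)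
    also have "ennreal 1 < \<infinity>" by simp
    finally show ?case by simp
  next
    case (Suc m)
    have "real (Suc m) * h \<le> real n * h"
      using Suc.prems h by (intro mult_right_mono) auto
    then have "total_variation f (a + real m * h) (a + real (Suc m) * h) \<le> ennreal 1"
      by (intro total_variation_small[OF \<delta>(2)]) (use h in \<open>auto simp: algebra_simps\<close>)
    also have "ennreal 1 < \<infinity>" by simp
    finally have "total_variation f (a + real m * h) (a + real (Suc m) * h) < \<infinity>" .
    moreover have "total_variation f a (a + real m * h) < \<infinity>" using Suc by simp
    moreover have "total_variation f a (a + real (Suc m) * h) \<le>
        total_variation f a (a + real m * h) + total_variation f (a + real m * h) (a + real (Suc m) * h)"
      using h by (intro total_variation_split) (auto simp: algebra_simps)
    ultimately show ?case by (simp add: le_less_trans del: of_nat_Suc)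
  qed
  from this[of n] show ?thesis using h by simp
qed

text \<open>This carries absolute continuity from \<open>f\<close> to its variation. Each interval
  is replaced by a family inside it that almost attains its variation; the union of these families
  has total length at most that of \<open>P\<close>, so the same \<open>\<delta>\<close>
  applies.\<close>

lemma sum_total_variation_small:
  assumes small: "\<And>P. \<lbrakk>subintervals a b P; (\<Sum>(u, v)\<in>P. v - u) < \<delta>\<rbrakk> \<Longrightarrow> variation_sum f P < \<epsilon>"
    and P: "subintervals a b P" "(\<Sum>(u, v)\<in>P. v - u) < \<delta>"
    and fin: "\<And>u v. (u, v) \<in> P \<Longrightarrow> total_variation f u v < \<infinity>"
  shows "(\<Sum>(u, v)\<in>P. enn2real (total_variation f u v)) \<le> \<epsilon>"
proof (rule field_le_epsilon)
  fix e :: real assume "e > 0"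
  \<comment> \<open>An equal share of the error for each interval; the added 1 keeps
    \<open>\<eta>\<close> positive when \<open>P\<close> is empty.\<close>
  define \<eta> where "\<eta> = e / (1 + card P)"
  have \<eta>: "\<eta> > 0" using \<open>e > 0\<close> by (simp add: \<eta>_def add_pos_nonneg)
  have "\<exists>Q. subintervals (fst p) (snd p) Q \<and>
      enn2real (total_variation f (fst p) (snd p)) \<le> variation_sum f Q + \<eta>" if p: "p \<in> P" for p
  proof (rule ccontr)
    assume no: "\<not> ?thesis"
    let ?W = "total_variation f (fst p) (snd p)"
    have "?W \<le> ennreal (enn2real ?W - \<eta>)"
    proof (rule total_variation_least)
      fix Q assume "subintervals (fst p) (snd p) Q"
      then have "variation_sum f Q \<le> enn2real ?W - \<eta>" using no by force
      then show "ennreal (variation_sum f Q) \<le> ennreal (enn2real ?W - \<eta>)" by (rule ennreal_leI)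
    qed
    \<comment> \<open>\<open>ennreal\<close> sends negative numbers to \<open>0\<close>, so the sign
      must be known before real values are compared; the empty family supplies it.\<close>
    moreover have "0 \<le> enn2real ?W - \<eta>"
      using no[simplified, rule_format, of "{}"] by (simp add: variation_sum_def)
    ultimately have "enn2real ?W \<le> enn2real ?W - \<eta>"
      using enn2real_leI by blast
    then show False using \<eta> by simp
  qed
  then obtain Q where Q: "\<And>p. p \<in> P \<Longrightarrow> subintervals (fst p) (snd p) (Q p)"
    and W: "\<And>p. p \<in> P \<Longrightarrow> enn2real (total_variation f (fst p) (snd p)) \<le> variation_sum f (Q p) + \<eta>"
    by metis
  have finP: "finite P" and finQ: "\<And>p. p \<in> P \<Longrightarrow> finite (Q p)"
    using P(1) Q subintervals_finite by blast+
  have apart: "snd r \<le> fst r' \<or> snd r' \<le> fst r"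
    if "p \<in> P" "q \<in> P" "p \<noteq> q" "r \<in> Q p" "r' \<in> Q q" for p q r r'
    using subintervals_apart[OF P(1) that(1-3)] subintervals_bounds[OF Q[OF that(1)], of "fst r" "snd r"]
      subintervals_bounds[OF Q[OF that(2)], of "fst r'" "snd r'"] that by fastforce
  have disj: "Q p \<inter> Q q = {}" if "p \<in> P" "q \<in> P" "p \<noteq> q" for p q
  proof (rule equals0I)
    fix r assume "r \<in> Q p \<inter> Q q"
    then have "snd r \<le> fst r" "fst r < snd r"
      using apart[OF that, of r r] subintervals_bounds[OF Q[OF that(1)], of "fst r" "snd r"] by auto
    then show False by simp
  qed
  have sums: "sum g (\<Union>p\<in>P. Q p) = (\<Sum>p\<in>P. sum g (Q p))" for g :: "real \<times> real \<Rightarrow> real"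
    using finP finQ disj by (intro sum.UNION_disjoint) auto
  have U: "subintervals a b (\<Union>p\<in>P. Q p)"
    unfolding subintervals_def
  proof (intro conjI)
    show "finite (\<Union>p\<in>P. Q p)" using finP finQ by blast
    show "\<forall>(u, v)\<in>(\<Union>p\<in>P. Q p). a \<le> u \<and> u < v \<and> v \<le> b"
    proof clarify
      fix u v p assume "p \<in> P" "(u, v) \<in> Q p"
      then show "a \<le> u \<and> u < v \<and> v \<le> b"
        using subintervals_bounds[OF Q, of p u v] subintervals_bounds[OF P(1), of "fst p" "snd p"] by force
    qed
    show "\<forall>r\<in>(\<Union>p\<in>P. Q p). \<forall>r'\<in>(\<Union>p\<in>P. Q p). r \<noteq> r' \<longrightarrow> snd r \<le> fst r' \<or> snd r' \<le> fst r"
    proof (intro ballI impI)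
      fix r r' assume "r \<in> (\<Union>p\<in>P. Q p)" "r' \<in> (\<Union>p\<in>P. Q p)" "r \<noteq> r'"
      then obtain p q where pq: "p \<in> P" "q \<in> P" "r \<in> Q p" "r' \<in> Q q" by blast
      show "snd r \<le> fst r' \<or> snd r' \<le> fst r"
      proof (cases "p = q")
        case True
        then show ?thesis using subintervals_apart[OF Q[OF pq(1)]] pq \<open>r \<noteq> r'\<close> by blast
      next
        case False
        then show ?thesis using apart[OF pq(1,2)] pq by blast
      qed
    qed
  qed
  have "(\<Sum>(u, v)\<in>(\<Union>p\<in>P. Q p). v - u) \<le> (\<Sum>(u, v)\<in>P. v - u)"
    unfolding sums
  proof (rule sum_mono)
    fix p assume p: "p \<in> P"
    then show "(\<Sum>(u, v)\<in>Q p. v - u) \<le> (case p of (u, v) \<Rightarrow> v - u)"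
      using sum_length_le[OF Q[OF p]] subintervals_bounds[OF P(1), of "fst p" "snd p"] by (auto simp: split_beta)
  qed
  then have "variation_sum f (\<Union>p\<in>P. Q p) < \<epsilon>"
    using small[OF U] P(2) by simp
  moreover have "variation_sum f (\<Union>p\<in>P. Q p) = (\<Sum>p\<in>P. variation_sum f (Q p))"
    unfolding variation_sum_def by (rule sums)
  moreover have "(\<Sum>(u, v)\<in>P. enn2real (total_variation f u v)) \<le> (\<Sum>p\<in>P. variation_sum f (Q p) + \<eta>)"
    using W by (intro sum_mono) (auto simp: split_beta)
  moreover have "real (card P) * \<eta> \<le> e"
    using \<open>e > 0\<close> by (simp add: \<eta>_def field_simps)
  ultimately show "(\<Sum>(u, v)\<in>P. enn2real (total_variation f u v)) \<le> \<epsilon> + e"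
    by (simp add: sum.distrib)
qed

text \<open>\<open>V x\<close> is the variation on \<open>[a, x]\<close>. Its increments lie between
  \<open>\<bar>f v - f u\<bar>\<close> and the variation on \<open>[u, v]\<close>: the lower bound
  makes \<open>V\<close> and \<open>V - f\<close> monotone, the upper one makes \<open>V\<close>
  absolutely continuous.\<close>

lemma abs_cont_Jordan_decomposition:
  fixes f :: "real \<Rightarrow> real"
  assumes f: "abs_cont a b f" and ab: "a \<le> b"
  obtains V where "abs_cont a b V" "mono_on {a..b} V" "mono_on {a..b} (\<lambda>x. V x - f x)"
proof
  define V where "V = (\<lambda>x. enn2real (total_variation f a x))"
  have fin: "total_variation f x y < \<infinity>" if "a \<le> x" "y \<le> b" for x y
    using total_variation_mono[OF that] abs_cont_total_variation_finite[OF f ab] by (rule le_less_trans)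
  have V_nonneg: "0 \<le> V x" for x by (simp add: V_def)
  have V: "total_variation f a x = ennreal (V x)" if "x \<le> b" for x
    using fin[of a x] that by (simp add: V_def)
  have up: "\<bar>f v - f u\<bar> \<le> V v - V u" if "a \<le> u" "u < v" "v \<le> b" for u v
  proof -
    have "ennreal (V u + \<bar>f v - f u\<bar>) = total_variation f a u + ennreal (norm (f v - f u))"
      using that by (simp add: V V_nonneg)
    also have "\<dots> \<le> total_variation f a v" using that by (intro total_variation_step)
    also have "\<dots> = ennreal (V v)" using that by (simp add: V)
    finally have "V u + \<bar>f v - f u\<bar> \<le> V v"
      by (simp only: ennreal_le_iff[OF V_nonneg])
    then show ?thesis by simp
  qed
  have low: "V v - V u \<le> enn2real (total_variation f u v)" if "a \<le> u" "u < v" "v \<le> b" for u v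
  proof -
    have "ennreal (V v) = total_variation f a v" using that by (simp add: V)
    also have "\<dots> \<le> total_variation f a u + total_variation f u v"
      using that by (intro total_variation_split) auto
    also have "\<dots> = ennreal (V u + enn2real (total_variation f u v))"
      using fin[of u v] that by (simp add: V V_nonneg)
    finally have "V v \<le> V u + enn2real (total_variation f u v)"
      by (subst (asm) ennreal_le_iff) (simp_all add: V_nonneg)
    then show ?thesis by simp
  qed
  show "mono_on {a..b} V"
  proof (rule mono_onI)
    fix u v assume "u \<in> {a..b}" "v \<in> {a..b}" "u \<le> v"
    then show "V u \<le> V v" using up[of u v] by (cases "u = v") auto
  qed
  show "mono_on {a..b} (\<lambda>x. V x - f x)"
  proof (rule mono_onI)
    fix u v assume "u \<in> {a..b}" "v \<in> {a..b}" "u \<le> v"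
    then show "V u - f u \<le> V v - f v" using up[of u v] by (cases "u = v") auto
  qed
  show "abs_cont a b V"
    unfolding abs_cont_def
  proof (intro allI impI)
    fix \<epsilon> :: real assume "\<epsilon> > 0"
    then have "\<epsilon> / 2 > 0" by simp
    then obtain \<delta> where \<delta>: "\<delta> > 0"
      "\<And>P. \<lbrakk>subintervals a b P; (\<Sum>(u, v)\<in>P. v - u) < \<delta>\<rbrakk> \<Longrightarrow> variation_sum f P < \<epsilon> / 2"
      using abs_contE[OF f] by metis
    have "variation_sum V P < \<epsilon>" if P: "subintervals a b P" "(\<Sum>(u, v)\<in>P. v - u) < \<delta>" for P
    proof -
      have "variation_sum V P \<le> (\<Sum>(u, v)\<in>P. enn2real (total_variation f u v))"
        unfolding variation_sum_def
      proof (rule sum_mono, clarify)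
        fix u v assume "(u, v) \<in> P"
        then show "norm (V v - V u) \<le> enn2real (total_variation f u v)"
          using up[of u v] low[of u v] subintervals_bounds[OF P(1), of u v] by simp
      qed
      also have "\<dots> \<le> \<epsilon> / 2"
        by (rule sum_total_variation_small[OF \<delta>(2) P]) (use fin subintervals_bounds[OF P(1)] in auto)
      finally show ?thesis using \<open>\<epsilon> > 0\<close> by simp
    qed
    then show "\<exists>\<delta>>0. \<forall>P. subintervals a b P \<and> (\<Sum>(u, v)\<in>P. v - u) < \<delta> \<longrightarrow> variation_sum V P < \<epsilon>"
      using \<delta>(1) by blast
  qed
qed

section \<open>Stieltjes measures of monotone functions and their densities\<close>

lemma abs_cont_continuous_on:
  assumes f: "abs_cont a b f"
  shows "continuous_on {a..b} f"
  unfolding continuous_on_iff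
proof (intro ballI allI impI)
  fix x and e :: real assume x: "x \<in> {a..b}" and "e > 0"
  then obtain \<delta> where \<delta>: "\<delta> > 0"
    "\<And>P. \<lbrakk>subintervals a b P; (\<Sum>(u, v)\<in>P. v - u) < \<delta>\<rbrakk> \<Longrightarrow> variation_sum f P < e"
    using abs_contE[OF f] by metis
  have "dist (f y) (f x) < e" if y: "y \<in> {a..b}" "dist y x < \<delta>" for y
  proof (cases "y = x")
    case False
    then have "variation_sum f {(min x y, max x y)} < e"
      using x y by (intro \<delta>(2) subintervals_singleton) (auto simp: dist_real_def)
    then show ?thesis
      by (auto simp: variation_sum_def dist_norm min_def max_def norm_minus_commute split: if_splits)
  qed (use \<open>e > 0\<close> in simp)
  then show "\<exists>d>0. \<forall>x'\<in>{a..b}. dist x' x < d \<longrightarrow> dist (f x') (f x) < e"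
    using \<delta>(1) by blast
qed

text \<open>\<open>G\<close> continues \<open>F\<close> by constants and so defines a measure on the
  line that is carried by \<open>[a, b]\<close>. A Lebesgue null set in \<open>[a, b]\<close> is
  covered by non-overlapping intervals of total length below \<open>\<delta>\<close>, and their
  measures are increments of \<open>F\<close>, adding up to at most
  \<open>\<epsilon>\<close>.\<close>

lemma interval_measure_absolutely_continuous:
  fixes F :: "real \<Rightarrow> real"
  assumes F: "abs_cont a b F" "mono_on {a..b} F" and ab: "a < b"
  defines "G \<equiv> \<lambda>x. F (max a (min b x))"
  shows "mono G" "continuous_on UNIV G" "absolutely_continuous lborel (interval_measure G)"
    "finite_measure (interval_measure G)"
proof -
  let ?M = "interval_measure G"
  show mono: "mono G"
    unfolding G_def by (intro monoI mono_onD[OF F(2)]) (use ab in auto)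
  then have monoD: "\<And>x y. x \<le> y \<Longrightarrow> G x \<le> G y" by (rule monoD)
  show cont: "continuous_on UNIV G"
    unfolding G_def
    by (rule continuous_on_compose2[OF abs_cont_continuous_on[OF F(1)]])
      (use ab in \<open>auto intro!: continuous_intros\<close>)
  have Icc: "emeasure ?M {u..v} = ennreal (G v - G u)" if "u \<le> v" for u v
    using that monoD cont by (rule emeasure_interval_measure_Icc)
  \<comment> \<open>The endpoint is included: \<open>G\<close> is constant to the left of
    \<open>a\<close> and, being continuous, has no atom at \<open>a\<close>.\<close>
  have left: "emeasure ?M {..a} = 0"
  proof -
    have eq: "{..a} = (\<Union>n::nat. {a - real n..a})"
    proof (intro equalityI subsetI)
      fix x assume "x \<in> {..a}"
      moreover obtain n :: nat where "a - x \<le> real n" using real_arch_simple by blast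
      ultimately show "x \<in> (\<Union>n::nat. {a - real n..a})" by (auto intro!: exI[of _ n])
    qed auto
    have "G (a - real n) = G a" for n using ab by (simp add: G_def)
    then have "(\<Union>n::nat. {a - real n..a}) \<in> null_sets ?M"
      by (intro null_sets_UN) (simp add: null_sets_def Icc)
    then show ?thesis unfolding eq by auto
  qed
  have right: "emeasure ?M {b..} = 0"
  proof -
    have eq: "{b..} = (\<Union>n::nat. {b..b + real n})"
    proof (intro equalityI subsetI)
      fix x assume "x \<in> {b..}"
      moreover obtain n :: nat where "x - b \<le> real n" using real_arch_simple by blast
      ultimately show "x \<in> (\<Union>n::nat. {b..b + real n})" by (auto intro!: exI[of _ n])
    qed auto
    have "G (b + real n) = G b" for n using ab by (simp add: G_def)
    then have "(\<Union>n::nat. {b..b + real n}) \<in> null_sets ?M"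
      by (intro null_sets_UN) (simp add: null_sets_def Icc)
    then show ?thesis unfolding eq by auto
  qed
  have outside: "emeasure ?M N \<le> emeasure ?M (N \<inter> {a..b})" if N: "N \<in> sets borel" for N
  proof -
    have "emeasure ?M N \<le> emeasure ?M ((N \<inter> {a..b}) \<union> ({..a} \<union> {b..}))"
      using N by (intro emeasure_mono) auto
    also have "\<dots> \<le> emeasure ?M (N \<inter> {a..b}) + emeasure ?M ({..a} \<union> {b..})"
      using N by (intro emeasure_subadditive) auto
    also have "emeasure ?M ({..a} \<union> {b..}) \<le> emeasure ?M {..a} + emeasure ?M {b..}"
      by (intro emeasure_subadditive) auto
    finally show ?thesis by (simp add: left right)
  qed
  show "finite_measure ?M"
  proof (rule finite_measureI)
    have "emeasure ?M UNIV \<le> emeasure ?M (UNIV \<inter> {a..b})" by (rule outside) simp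
    also have "\<dots> < \<infinity>" using ab by (simp add: Icc)
    finally show "emeasure ?M (space ?M) \<noteq> \<infinity>" by simp
  qed
  show "absolutely_continuous lborel ?M"
    unfolding absolutely_continuous_def
  proof (rule subsetI)
    fix N assume N: "N \<in> null_sets (lborel :: real measure)"
    then have N_borel: "N \<in> sets borel" by auto
    have "emeasure ?M (N \<inter> {a..b}) \<le> ennreal \<epsilon>" if "\<epsilon> > 0" for \<epsilon>
    proof -
      obtain \<delta> where \<delta>: "\<delta> > 0"
        "\<And>P. \<lbrakk>subintervals a b P; (\<Sum>(u, v)\<in>P. v - u) < \<delta>\<rbrakk> \<Longrightarrow> variation_sum F P < \<epsilon>"
        using abs_contE[OF F(1) \<open>\<epsilon> > 0\<close>] by metis
      have neg: "negligible (N \<inter> {a..b})"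
        using N unfolding negligible_iff_null_sets
        by (meson inf_le1 null_sets_completionI null_sets_completion_subset)
      have lm: "N \<inter> {a..b} \<in> lmeasurable" using neg by (rule negligible_imp_measurable)
      have sub: "N \<inter> {a..b} \<subseteq> cbox a b" by auto
      have pos: "\<delta> / 2 > 0" using \<delta>(1) by simp
      show ?thesis
      proof (rule measurable_outer_intervals_bounded[OF lm sub pos])
        fix \<D> assume \<D>: "countable \<D>"
          and \<D>_sub': "\<And>K. K \<in> \<D> \<Longrightarrow> K \<subseteq> cbox a b \<and> K \<noteq> {} \<and> (\<exists>c d. K = cbox c d)"
          and \<D>_pair: "pairwise (\<lambda>A B. interior A \<inter> interior B = {}) \<D>"
          and \<D>_int': "\<And>K. \<lbrakk>K \<in> \<D>; box a b \<noteq> {}\<rbrakk> \<Longrightarrow> interior K \<noteq> {}"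
          and \<D>_cover: "N \<inter> {a..b} \<subseteq> \<Union>\<D>" "\<Union>\<D> \<in> lmeasurable"
          and \<D>_le: "measure lebesgue (\<Union>\<D>) \<le> measure lebesgue (N \<inter> {a..b}) + \<delta> / 2"
        have \<D>_sub: "K \<subseteq> {a..b}" "\<exists>c d. K = {c..d}" if "K \<in> \<D>" for K
          using \<D>_sub'[OF that] by (simp_all add: cbox_interval)
        have \<D>_int: "interior K \<noteq> {}" if "K \<in> \<D>" for K
          by (rule \<D>_int'[OF that]) (use ab in simp)
        have len: "measure lebesgue (\<Union>\<D>) < \<delta>"
          using \<D>_le negligible_imp_measure0[OF neg] \<delta>(1) by simp
        have K: "K = {Inf K..Sup K}" "a \<le> Inf K" "Inf K < Sup K" "Sup K \<le> b" if K: "K \<in> \<D>" for K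
        proof -
          obtain c d where cd: "K = {c..d}" using \<D>_sub(2)[OF K] by blast
          have "c < d" using \<D>_int[OF K] unfolding cd by simp
          then have "Inf K = c" "Sup K = d" by (simp_all add: cd)
          then show "K = {Inf K..Sup K}" "a \<le> Inf K" "Inf K < Sup K" "Sup K \<le> b"
            using cd \<open>c < d\<close> \<D>_sub(1)[OF K] by auto
        qed
        \<comment> \<open>Absolute continuity speaks of finite families whereas the cover is
          countable; continuity of the measure from below closes the gap at the end.\<close>
        have finite_bound: "emeasure ?M (\<Union>\<F>) \<le> ennreal \<epsilon>" if \<F>: "\<F> \<subseteq> \<D>" "finite \<F>" for \<F>
        proof -
          define P where "P = (\<lambda>K. (Inf K, Sup K)) ` \<F>"
          have inj: "inj_on (\<lambda>K. (Inf K, Sup K)) \<F>"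
            using K(1) \<F>(1) by (intro inj_onI) (metis Pair_inject subsetD)
          have P: "subintervals a b P"
            unfolding subintervals_def
          proof (intro conjI)
            show "finite P" using \<F> by (simp add: P_def)
            show "\<forall>(u, v)\<in>P. a \<le> u \<and> u < v \<and> v \<le> b"
              using K \<F>(1) by (auto simp: P_def)
            show "\<forall>p\<in>P. \<forall>q\<in>P. p \<noteq> q \<longrightarrow> snd p \<le> fst q \<or> snd q \<le> fst p"
            proof (intro ballI impI)
              fix p q assume "p \<in> P" "q \<in> P" "p \<noteq> q"
              then obtain I J where IJ: "I \<in> \<F>" "J \<in> \<F>" "I \<noteq> J" "p = (Inf I, Sup I)" "q = (Inf J, Sup J)"
                by (auto simp: P_def)
              then have IJ\<D>: "I \<in> \<D>" "J \<in> \<D>" using \<F>(1) by auto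
              then have "interior I \<inter> interior J = {}"
                using \<D>_pair IJ(3) by (auto simp: pairwise_def)
              then have "{Inf I<..<Sup I} \<inter> {Inf J<..<Sup J} = {}"
                using K(1)[OF IJ\<D>(1)] K(1)[OF IJ\<D>(2)] by (metis interior_atLeastAtMost_real)
              then show "snd p \<le> fst q \<or> snd q \<le> fst p"
                using K(3)[OF IJ\<D>(1)] K(3)[OF IJ\<D>(2)] IJ by (auto simp: Int_greaterThanLessThan)
            qed
          qed
          have "(\<Sum>(u, v)\<in>P. v - u) \<le> measure lebesgue (\<Union>\<D>)"
          proof (rule sum_length_le_measure[OF P \<D>_cover(2)])
            fix u v assume "(u, v) \<in> P"
            then obtain I where "I \<in> \<F>" "u = Inf I" "v = Sup I" by (auto simp: P_def)
            then show "{u<..<v} \<subseteq> \<Union>\<D>"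
              using K(1)[of I] \<F>(1) greaterThanLessThan_subseteq_atLeastAtMost_iff by blast
          qed
          then have small: "variation_sum F P < \<epsilon>" using \<delta>(2)[OF P] len by simp
          have "emeasure ?M (\<Union>\<F>) = emeasure ?M (\<Union>K\<in>\<F>. K)" by simp
          also have "\<dots> \<le> (\<Sum>K\<in>\<F>. emeasure ?M K)"
          proof (rule emeasure_subadditive_finite)
            have "K \<in> sets borel" if "K \<in> \<F>" for K
              using K(1)[of K] that \<F>(1) by (metis atLeastAtMost_borel subsetD)
            then show "(\<lambda>K. K) ` \<F> \<subseteq> sets ?M" by auto
          qed (rule \<F>(2))
          also have "\<dots> = (\<Sum>K\<in>\<F>. ennreal \<bar>F (Sup K) - F (Inf K)\<bar>)"
          proof (rule sum.cong[OF refl])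
            fix K' assume "K' \<in> \<F>"
            then have K': "K' \<in> \<D>" using \<F>(1) by blast
            have "emeasure ?M K' = ennreal (G (Sup K') - G (Inf K'))"
              using K(1)[OF K'] Icc[of "Inf K'" "Sup K'"] K(3)[OF K'] by simp
            also have "G (Sup K') - G (Inf K') = \<bar>F (Sup K') - F (Inf K')\<bar>"
              using K(2-4)[OF K'] mono_onD[OF F(2), of "Inf K'" "Sup K'"] by (simp add: G_def)
            finally show "emeasure ?M K' = ennreal \<bar>F (Sup K') - F (Inf K')\<bar>" .
          qed
          also have "\<dots> = ennreal (variation_sum F P)"
            unfolding variation_sum_def P_def by (subst sum.reindex[OF inj]) (simp add: sum_ennreal)
          also have "\<dots> \<le> ennreal \<epsilon>" using small by (simp add: ennreal_leI)
          finally show ?thesis .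
        qed
        have \<D>_borel: "K \<in> sets ?M" if "K \<in> \<D>" for K
          using K(1)[OF that] by (metis atLeastAtMost_borel sets_interval_measure)
        show "emeasure ?M (N \<inter> {a..b}) \<le> ennreal \<epsilon>"
        proof (cases "\<D> = {}")
          case True
          then have "N \<inter> {a..b} = {}" using \<D>_cover(1) by simp
          then show ?thesis by simp
        next
          case False
          define e where "e = from_nat_into \<D>"
          have range: "range e = \<D>" unfolding e_def using range_from_nat_into[OF False \<D>] .
          have un: "\<Union>\<D> = (\<Union>n. \<Union>i\<le>n. e i)" unfolding range[symmetric] by auto
          have "emeasure ?M (N \<inter> {a..b}) \<le> emeasure ?M (\<Union>\<D>)"
            using \<D>_cover(1) \<D>_borel \<D> by (intro emeasure_mono sets.countable_Union) auto
          also have "\<dots> = (SUP n. emeasure ?M (\<Union>i\<le>n. e i))"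
            unfolding un
          proof (rule SUP_emeasure_incseq[symmetric])
            show "range (\<lambda>n. \<Union>i\<le>n. e i) \<subseteq> sets ?M"
              using \<D>_borel range by (auto intro!: sets.finite_UN)
            show "incseq (\<lambda>n. \<Union>i\<le>n. e i)"
              by (intro incseq_SucI UN_mono) auto
          qed
          also have "\<dots> \<le> ennreal \<epsilon>"
          proof (rule SUP_least)
            fix n
            show "emeasure ?M (\<Union>i\<le>n. e i) \<le> ennreal \<epsilon>"
              using finite_bound[of "e ` {..n}"] range by auto
          qed
          finally show ?thesis .
        qed
      qed
    qed
    then have "emeasure ?M (N \<inter> {a..b}) = 0"
      by (metis ennreal_le_epsilon add.left_neutral le_zero_eq)
    then have "emeasure ?M N = 0" using outside[OF N_borel] by simp
    then show "N \<in> null_sets ?M" using N_borel by (auto simp: null_sets_def)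
  qed
qed

text \<open>The Stieltjes measure of \<open>[a, x]\<close> is \<open>F x - F a\<close>, so its
  Radon-Nikodym density has the required integrals. Nonnegativity is recorded because it upgrades
  integrability to absolute integrability.\<close>

lemma abs_cont_mono_has_integral:
  fixes F :: "real \<Rightarrow> real"
  assumes F: "abs_cont a b F" "mono_on {a..b} F" and ab: "a < b"
  obtains g where "\<And>x. 0 \<le> g x" "\<And>x. x \<in> {a..b} \<Longrightarrow> (g has_integral (F x - F a)) {a..x}"
proof -
  define G where "G = (\<lambda>x. F (max a (min b x)))"
  note G = interval_measure_absolutely_continuous[OF F ab, folded G_def]
  let ?M = "interval_measure G"
  have sets: "sets ?M = sets lborel" by simp
  obtain g where g: "g \<in> borel_measurable lborel"
    and RN: "AE x in lborel. RN_deriv lborel ?M x = ennreal (g x)" and nonneg: "\<And>x. 0 \<le> g x"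
    using sigma_finite_measure.real_RN_deriv[OF lborel.sigma_finite_measure_axioms G(4,3) sets] by metis
  have "(g has_integral (F x - F a)) {a..x}" if x: "x \<in> {a..b}" for x
  proof -
    have "ennreal (F x - F a) = emeasure ?M {a..x}"
      using emeasure_interval_measure_Icc[OF _ monoD[OF G(1)] G(2), of a x] x by (simp add: G_def)
    also have "\<dots> = emeasure (density lborel (RN_deriv lborel ?M)) {a..x}"
      by (simp add: sigma_finite_measure.density_RN_deriv[OF lborel.sigma_finite_measure_axioms G(3) sets])
    also have "\<dots> = (\<integral>\<^sup>+y. RN_deriv lborel ?M y * indicator {a..x} y \<partial>lborel)"
      by (intro emeasure_density) auto
    also have "\<dots> = (\<integral>\<^sup>+y. ennreal (g y * indicator {a..x} y) \<partial>lborel)"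
      by (intro nn_integral_cong_AE) (use RN in eventually_elim, simp split: split_indicator)
    finally have *: "(\<integral>\<^sup>+y. ennreal (g y * indicator {a..x} y) \<partial>lborel) = ennreal (F x - F a)" ..
    have "((\<lambda>y. g y * indicator {a..x} y) has_integral (F x - F a)) UNIV"
      by (rule nn_integral_has_integral[OF _ _ *])
        (use g nonneg mono_onD[OF F(2), of a x] x in auto)
    then show ?thesis
      using has_integral_restrict_UNIV[of "{a..x}" g]
      by (simp add: indicator_def of_bool_def if_distrib cong: if_cong)
  qed
  then show ?thesis using that nonneg by blast
qed

lemma abs_cont_has_integral_real:
  fixes f :: "real \<Rightarrow> real"
  assumes f: "abs_cont a b f" and ab: "a < b"
  obtains g where "g absolutely_integrable_on {a..b}"
    "\<And>x. x \<in> {a..b} \<Longrightarrow> (g has_integral (f x - f a)) {a..x}"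
proof -
  obtain V where V: "abs_cont a b V" "mono_on {a..b} V" "mono_on {a..b} (\<lambda>x. V x - f x)"
    using abs_cont_Jordan_decomposition[OF f] ab by (metis less_imp_le)
  obtain g where g: "\<And>x. 0 \<le> g x" "\<And>x. x \<in> {a..b} \<Longrightarrow> (g has_integral (V x - V a)) {a..x}"
    using abs_cont_mono_has_integral[OF V(1,2) ab] by blast
  obtain h where h: "\<And>x. 0 \<le> h x"
      "\<And>x. x \<in> {a..b} \<Longrightarrow> (h has_integral ((V x - f x) - (V a - f a))) {a..x}"
    using abs_cont_mono_has_integral[OF abs_cont_diff[OF V(1) f] V(3) ab] by blast
  show ?thesis
  proof
    have "g integrable_on {a..b}" "h integrable_on {a..b}"
      using g(2)[of b] h(2)[of b] ab by auto
    then have "g absolutely_integrable_on {a..b}" "h absolutely_integrable_on {a..b}"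
      using g(1) h(1) by (auto intro: nonnegative_absolutely_integrable_1)
    then show "(\<lambda>x. g x - h x) absolutely_integrable_on {a..b}"
      by (rule set_integral_diff)
    show "((\<lambda>x. g x - h x) has_integral (f x - f a)) {a..x}" if "x \<in> {a..b}" for x
      using has_integral_diff[OF g(2)[OF that] h(2)[OF that]] by simp
  qed
qed

lemma abs_cont_has_integral_complex:
  fixes f :: "real \<Rightarrow> complex"
  assumes f: "abs_cont a b f" and ab: "a < b"
  obtains g where "g absolutely_integrable_on {a..b}"
    "\<And>x. x \<in> {a..b} \<Longrightarrow> (g has_integral (f x - f a)) {a..x}"
proof -
  have "abs_cont a b (\<lambda>x. Re (f x))"
    by (rule abs_cont_le[OF f]) (metis abs_Re_le_cmod minus_complex.sel(1) real_norm_def)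
  then obtain g where g: "g absolutely_integrable_on {a..b}"
    "\<And>x. x \<in> {a..b} \<Longrightarrow> (g has_integral (Re (f x) - Re (f a))) {a..x}"
    using abs_cont_has_integral_real ab by blast
  have "abs_cont a b (\<lambda>x. Im (f x))"
    by (rule abs_cont_le[OF f]) (metis abs_Im_le_cmod minus_complex.sel(2) real_norm_def)
  then obtain h where h: "h absolutely_integrable_on {a..b}"
    "\<And>x. x \<in> {a..b} \<Longrightarrow> (h has_integral (Im (f x) - Im (f a))) {a..x}"
    using abs_cont_has_integral_real ab by blast
  have lin: "bounded_linear complex_of_real" "bounded_linear (\<lambda>x. \<i> * complex_of_real x)"
    using bounded_linear_of_real bounded_linear_const_mult[OF bounded_linear_of_real] by blast+
  show ?thesis
  proof
    have "(\<lambda>x. complex_of_real (g x)) absolutely_integrable_on {a..b}"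
         "(\<lambda>x. \<i> * complex_of_real (h x)) absolutely_integrable_on {a..b}"
      using absolutely_integrable_linear[OF g(1) lin(1)] absolutely_integrable_linear[OF h(1) lin(2)]
      by (simp_all add: o_def)
    then show "(\<lambda>x. complex_of_real (g x) + \<i> * complex_of_real (h x)) absolutely_integrable_on {a..b}"
      by (rule set_integral_add)
    show "((\<lambda>x. complex_of_real (g x) + \<i> * complex_of_real (h x)) has_integral (f x - f a)) {a..x}"
      if x: "x \<in> {a..b}" for x
    proof -
      have "f x - f a = of_real (Re (f x) - Re (f a)) + \<i> * of_real (Im (f x) - Im (f a))"
        by (simp add: complex_eq_iff)
      then show ?thesis
        using has_integral_add[OF has_integral_linear[OF g(2)[OF x] lin(1)]
            has_integral_linear[OF h(2)[OF x] lin(2)]] by (simp add: o_def)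
    qed
  qed
qed

lemma vector_derivative_within_Icc:
  assumes "(f has_vector_derivative D) (at x within {a..b})" "a < b" "x \<in> {a..b}"
  shows "vector_derivative f (at x within {a..b}) = D"
  using assms vector_derivative_within_cbox[of a b x f D] by auto

text \<open>The density of \<open>f\<close> is at first an abstract function. Lebesgue's theorem
  makes it the derivative of its own primitive, hence equal to \<open>deriv_on a b 1 f\<close>, off
  a null set; the unspecified values of \<open>deriv_on\<close> lie in that set and do not affect
  integrals.\<close>

theorem AC_on_fundamental_theorem:
  assumes f: "AC_on a b f" and ab: "a < b"
  shows "deriv_on a b 1 f absolutely_integrable_on {a..b}"
    and "x \<in> {a..b} \<Longrightarrow> f x = f a + integral {a..x} (deriv_on a b 1 f)"
proof -
  obtain g where g: "g absolutely_integrable_on {a..b}"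
    and int: "\<And>x. x \<in> {a..b} \<Longrightarrow> (g has_integral (f x - f a)) {a..x}"
    using abs_cont_has_integral_complex[OF AC_on_imp_abs_cont[OF f] ab] by blast
  obtain N where N: "negligible N" and deriv: "\<And>x. x \<in> {a..b} - N \<Longrightarrow>
      ((\<lambda>x. integral {a..x} g) has_vector_derivative g x) (at x within {a..b})"
    using Lebesgue_differentiation[of g a b] g by (metis absolutely_integrable_on_def)
  have eq: "deriv_on a b 1 f x = g x" if x: "x \<in> {a..b} - N" for x
  proof -
    have "((\<lambda>x. f a + integral {a..x} g) has_vector_derivative (0 + g x)) (at x within {a..b})"
      by (intro has_vector_derivative_add has_vector_derivative_const deriv x)
    moreover have "f y = f a + integral {a..y} g" if "y \<in> {a..b}" for y
      using int[OF that] by (simp add: integral_unique)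
    ultimately have "(f has_vector_derivative (0 + g x)) (at x within {a..b})"
      using x has_vector_derivative_transform[of x "{a..b}" f "\<lambda>x. f a + integral {a..x} g" "0 + g x"] by blast
    then show ?thesis
      using ab x by (simp add: deriv_on_def vector_derivative_within_Icc)
  qed
  show "deriv_on a b 1 f absolutely_integrable_on {a..b}"
    by (rule absolutely_integrable_spike[OF g N]) (rule eq)
  show "f x = f a + integral {a..x} (deriv_on a b 1 f)" if x: "x \<in> {a..b}"
  proof -
    have "integral {a..x} (deriv_on a b 1 f) = integral {a..x} g"
      by (rule integral_spike[OF N]) (use eq x in auto)
    then show ?thesis using int[OF x] by (simp add: integral_unique)
  qed
qed

section \<open>The space of square-integrable functions\<close>

lemma finite_measure_Icc: "finite_measure (lebesgue_on {a..b::real})"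
  by (rule finite_measure_lebesgue_on) simp

lemma borel_measurable_cnj [measurable]: "cnj \<in> borel_measurable borel"
  by (intro borel_measurable_continuous_onI continuous_intros)

lemma square_integrableD:
  assumes "square_integrable a b f"
  shows "f \<in> borel_measurable (lebesgue_on {a..b})" "integrable (lebesgue_on {a..b}) (\<lambda>x. (cmod (f x))\<^sup>2)"
  using assms by (simp_all add: square_integrable_def)

lemma square_integrable_bound:
  assumes "f \<in> borel_measurable (lebesgue_on {a..b})" "integrable (lebesgue_on {a..b}) \<phi>"
    and "\<And>x. x \<in> {a..b} \<Longrightarrow> (cmod (f x))\<^sup>2 \<le> \<phi> x"
  shows "square_integrable a b f"
  unfolding square_integrable_def
proof
  note [measurable] = assms(1)
  show "integrable (lebesgue_on {a..b}) (\<lambda>x. (cmod (f x))\<^sup>2)"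
  proof (rule Bochner_Integration.integrable_bound[OF assms(2)])
    show "AE x in lebesgue_on {a..b}. norm ((cmod (f x))\<^sup>2) \<le> norm (\<phi> x)"
    proof (rule AE_I2)
      fix x assume "x \<in> space (lebesgue_on {a..b})"
      then have "(cmod (f x))\<^sup>2 \<le> \<phi> x" using assms(3) by simp
      then show "norm ((cmod (f x))\<^sup>2) \<le> norm (\<phi> x)"
        unfolding real_norm_def using zero_le_power2[of "cmod (f x)"] by linarith
    qed
  qed measurable
qed (rule assms(1))

lemma square_integrable_add:
  assumes "square_integrable a b f" "square_integrable a b g"
  shows "square_integrable a b (\<lambda>x. f x + g x)"
proof (rule square_integrable_bound)
  show "(\<lambda>x. f x + g x) \<in> borel_measurable (lebesgue_on {a..b})"
    using square_integrableD(1)[OF assms(1)] square_integrableD(1)[OF assms(2)] by measurable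
  show "integrable (lebesgue_on {a..b}) (\<lambda>x. 2 * (cmod (f x))\<^sup>2 + 2 * (cmod (g x))\<^sup>2)"
    using square_integrableD(2)[OF assms(1)] square_integrableD(2)[OF assms(2)] by simp
  show "(cmod (f x + g x))\<^sup>2 \<le> 2 * (cmod (f x))\<^sup>2 + 2 * (cmod (g x))\<^sup>2" for x
  proof -
    have "(cmod (f x + g x))\<^sup>2 \<le> (cmod (f x) + cmod (g x))\<^sup>2"
      by (intro power_mono norm_triangle_ineq) simp
    also have "\<dots> \<le> 2 * (cmod (f x))\<^sup>2 + 2 * (cmod (g x))\<^sup>2"
      using zero_le_power2[of "cmod (f x) - cmod (g x)"] by (simp add: power2_eq_square algebra_simps)
    finally show ?thesis .
  qed
qed

lemma square_integrable_scale:
  assumes "square_integrable a b f"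
  shows "square_integrable a b (\<lambda>x. c * f x)"
  using square_integrableD[OF assms]
  by (auto simp: square_integrable_def norm_mult power_mult_distrib intro: borel_measurable_times)

lemma square_integrable_diff:
  assumes "square_integrable a b f" "square_integrable a b g"
  shows "square_integrable a b (\<lambda>x. f x - g x)"
  using square_integrable_add[OF assms(1) square_integrable_scale[OF assms(2), of "-1"]] by simp

lemma square_integrable_norm:
  assumes "square_integrable a b f"
  shows "square_integrable a b (\<lambda>x. of_real (cmod (f x)))"
proof -
  note [measurable] = square_integrableD(1)[OF assms]
  show ?thesis
    using square_integrableD(2)[OF assms] by (simp add: square_integrable_def)
qed

lemma square_integrable_continuous:
  assumes "continuous_on {a..b} f"
  shows "square_integrable a b f"
  unfolding square_integrable_def
proof
  show "f \<in> borel_measurable (lebesgue_on {a..b})"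
    using assms by (intro continuous_imp_measurable_on_sets_lebesgue) auto
  show "integrable (lebesgue_on {a..b}) (\<lambda>x. (cmod (f x))\<^sup>2)"
    using assms by (intro continuous_imp_integrable_real continuous_intros)
qed

lemma integrable_mult_cnj:
  assumes f: "square_integrable a b f" and g: "square_integrable a b g"
  shows "integrable (lebesgue_on {a..b}) (\<lambda>x. f x * cnj (g x))"
proof (rule Bochner_Integration.integrable_bound)
  note [measurable] = square_integrableD(1)[OF f] square_integrableD(1)[OF g]
  show "integrable (lebesgue_on {a..b}) (\<lambda>x. (cmod (f x))\<^sup>2 + (cmod (g x))\<^sup>2)"
    using square_integrableD(2)[OF f] square_integrableD(2)[OF g] by simp
  show "(\<lambda>x. f x * cnj (g x)) \<in> borel_measurable (lebesgue_on {a..b})"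
    by measurable
  have "cmod (f x) * cmod (g x) \<le> (cmod (f x))\<^sup>2 + (cmod (g x))\<^sup>2" for x
  proof -
    have "2 * (cmod (f x) * cmod (g x)) \<le> (cmod (f x))\<^sup>2 + (cmod (g x))\<^sup>2"
      using sum_squares_bound[of "cmod (f x)" "cmod (g x)"] by (simp only: mult.assoc)
    moreover have "0 \<le> cmod (f x) * cmod (g x)" by simp
    ultimately show ?thesis by linarith
  qed
  then show "AE x in lebesgue_on {a..b}. norm (f x * cnj (g x)) \<le> norm ((cmod (f x))\<^sup>2 + (cmod (g x))\<^sup>2)"
    by (simp add: norm_mult)
qed

lemma square_integrable_imp_integrable:
  assumes f: "square_integrable a b f"
  shows "integrable (lebesgue_on {a..b}) f"
  using integrable_mult_cnj[OF f square_integrable_continuous[of a b "\<lambda>x. 1"]] by simp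

text \<open>Either \<open>c\<close> is at most \<open>1 / t\<close> or it is at most
  \<open>t * c\<^sup>2\<close>. Integrated, with \<open>t\<close> chosen afterwards, this takes the
  role of the Cauchy-Schwarz inequality for integrals.\<close>

lemma le_mult_power2_plus_inverse:
  fixes c t :: real
  assumes t: "t > 0"
  shows "c \<le> t * c\<^sup>2 + 1 / t"
proof (cases "c \<le> 1 / t")
  case True
  moreover have "0 \<le> t * c\<^sup>2" using t by simp
  ultimately show ?thesis by linarith
next
  case False
  moreover have "0 < 1 / t" using t by simp
  ultimately have "0 \<le> c" by linarith
  have "1 \<le> t * c" using False t by (simp add: field_simps)
  then have "1 * c \<le> (t * c) * c"
    using \<open>0 \<le> c\<close> by (rule mult_right_mono)
  then have "c \<le> t * c\<^sup>2" by (simp add: power2_eq_square mult.assoc)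
  moreover have "0 < 1 / t" using t by simp
  ultimately show ?thesis by linarith
qed

text \<open>The factor 2, in place of the sharp 1, is what the best \<open>t\<close> in
  \<open>t * N + (b - a) / t\<close> gives.\<close>

lemma integral_norm_le_L2:
  assumes h: "square_integrable a b h" and ab: "a < b"
  shows "(LINT x|lebesgue_on {a..b}. cmod (h x)) \<le> 2 * sqrt (b - a) * sqrt (LINT x|lebesgue_on {a..b}. (cmod (h x))\<^sup>2)"
proof -
  let ?M = "lebesgue_on {a..b}"
  define N where "N = (LINT x|?M. (cmod (h x))\<^sup>2)"
  have *: "(LINT x|?M. cmod (h x)) \<le> t * N + (b - a) / t" if t: "t > 0" for t
  proof -
    have int: "integrable ?M (\<lambda>x. t * (cmod (h x))\<^sup>2)" "integrable ?M (\<lambda>x. 1 / t)"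
      using square_integrableD(2)[OF h] finite_measure.integrable_const[OF finite_measure_Icc] by simp_all
    have "(LINT x|?M. cmod (h x)) \<le> (LINT x|?M. t * (cmod (h x))\<^sup>2 + 1 / t)"
    proof (rule integral_mono)
      show "cmod (h x) \<le> t * (cmod (h x))\<^sup>2 + 1 / t" for x
        using t by (rule le_mult_power2_plus_inverse)
      show "integrable ?M (\<lambda>x. t * (cmod (h x))\<^sup>2 + 1 / t)"
        using int by (rule Bochner_Integration.integrable_add)
    qed (use square_integrable_imp_integrable[OF h] in auto)
    also have "\<dots> = t * N + (LINT x|?M. 1 / t)"
      using int by (simp add: N_def)
    also have "(LINT x|?M. 1 / t) = (b - a) / t"
      using ab by (simp add: measure_restrict_space)
    finally show ?thesis .
  qed
  have N0: "N \<ge> 0" by (simp add: N_def)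
  show ?thesis
  proof (cases "N = 0")
    case True
    \<comment> \<open>For \<open>N = 0\<close> there is no best \<open>t\<close>; letting
      \<open>t\<close> grow removes the remaining term.\<close>
    have "(LINT x|?M. cmod (h x)) \<le> 0"
    proof (rule field_le_epsilon)
      fix e :: real assume "e > 0"
      then show "(LINT x|?M. cmod (h x)) \<le> 0 + e"
        using *[of "(b - a) / e"] ab True by simp
    qed
    then show ?thesis using True by (simp add: N_def)
  next
    case False
    then have pos: "N > 0" using N0 by simp
    \<comment> \<open>The choice \<open>t = r / s\<close> balances the two summands, both being
      \<open>r * s\<close>.\<close>
    define r s where "r = sqrt (b - a)" and "s = sqrt N"
    have rs: "r > 0" "s > 0" "b - a = r * r" "N = s * s"
      using pos ab by (simp_all add: r_def s_def)
    have "(LINT x|?M. cmod (h x)) \<le> r / s * N + (b - a) / (r / s)"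
      using rs by (intro *) simp
    also have "\<dots> = 2 * r * s"
      unfolding rs(3,4) using rs(1,2) by (simp add: field_simps)
    also have "\<dots> = 2 * sqrt (b - a) * sqrt N" by (simp add: r_def s_def)
    finally show ?thesis by (simp add: N_def)
  qed
qed

section \<open>Classes of functions and the Riesz-Fischer theorem\<close>

lemma class_on_eq_iff:
  "class_on a b f = class_on a b g \<longleftrightarrow> (AE x in lebesgue. x \<in> {a..b} \<longrightarrow> f x = g x)"
proof -
  have "class_on a b f = class_on a b g \<longleftrightarrow>
      (AE x in lebesgue. (if x \<in> {a..b} then f x else 0) = (if x \<in> {a..b} then g x else 0))"
    by transfer simp
  also have "\<dots> \<longleftrightarrow> (AE x in lebesgue. x \<in> {a..b} \<longrightarrow> f x = g x)"
    by (intro AE_cong) auto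
  finally show ?thesis .
qed

lemma class_on_cong: "(\<And>x. x \<in> {a..b} \<Longrightarrow> f x = g x) \<Longrightarrow> class_on a b f = class_on a b g"
  by (simp add: class_on_eq_iff)

lemma class_on_add: "class_on a b (\<lambda>x. f x + g x) = class_on a b f + class_on a b g"
  and class_on_diff: "class_on a b (\<lambda>x. f x - g x) = class_on a b f - class_on a b g"
  and class_on_scale: "class_on a b (\<lambda>x. c * f x) = scale_fclass c (class_on a b f)"
  and class_on_zero: "class_on a b (\<lambda>x. 0) = 0"
  by (transfer; auto)+

lemma L2_inner_class_on:
  "L2_inner a b (class_on a b f) (class_on a b g) = (LINT x|lebesgue_on {a..b}. f x * cnj (g x))"
  by transfer (auto intro!: Bochner_Integration.integral_cong)

lemma class_on_in_L2: "square_integrable a b f \<Longrightarrow> class_on a b f \<in> L2 a b"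
  by (auto simp: L2_def)

lemma ip_norm_L2:
  assumes "square_integrable a b f"
  shows "ip_norm (L2_inner a b) (class_on a b f) = sqrt (LINT x|lebesgue_on {a..b}. (cmod (f x))\<^sup>2)"
proof -
  have "L2_inner a b (class_on a b f) (class_on a b f) = of_real (LINT x|lebesgue_on {a..b}. (cmod (f x))\<^sup>2)"
    unfolding L2_inner_class_on complex_norm_square[symmetric] by (rule integral_complex_of_real)
  then show ?thesis by (simp add: ip_norm_def)
qed

lemma L2_subspace: "module.subspace scale_fclass (L2 a b)"
proof -
  interpret vector_space scale_fclass by (rule vector_space_scale_fclass)
  show ?thesis
  proof (rule subspaceI)
    show "0 \<in> L2 a b"
      using class_on_in_L2[OF square_integrable_continuous[of a b "\<lambda>x. 0"]] by (simp add: class_on_zero)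
  qed (auto simp: L2_def square_integrable_add square_integrable_scale simp flip: class_on_add class_on_scale)
qed

lemma L2_inner_product: "inner_product_on scale_fclass (L2 a b) (L2_inner a b)"
  unfolding inner_product_on_def L2_def
proof (intro conjI ballI allI impI; elim imageE CollectE; hypsubst)
  fix f g h assume "square_integrable a b f" "square_integrable a b g" "square_integrable a b h"
  then show "L2_inner a b (class_on a b f + class_on a b g) (class_on a b h)
      = L2_inner a b (class_on a b f) (class_on a b h) + L2_inner a b (class_on a b g) (class_on a b h)"
    by (simp add: L2_inner_class_on distrib_right integrable_mult_cnj flip: class_on_add)
next
  fix c f g
  show "L2_inner a b (scale_fclass c (class_on a b f)) (class_on a b g)
      = c * L2_inner a b (class_on a b f) (class_on a b g)"
    by (simp add: L2_inner_class_on mult.assoc flip: class_on_scale)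
next
  fix f g
  show "L2_inner a b (class_on a b g) (class_on a b f) = cnj (L2_inner a b (class_on a b f) (class_on a b g))"
    unfolding L2_inner_class_on Bochner_Integration.integral_cnj[symmetric] by (simp add: mult.commute)
next
  fix f
  show "0 \<le> Re (L2_inner a b (class_on a b f) (class_on a b f))"
    unfolding L2_inner_class_on complex_norm_square[symmetric] integral_complex_of_real by simp
next
  fix f assume f: "square_integrable a b f" and "L2_inner a b (class_on a b f) (class_on a b f) = 0"
  then have "(LINT x|lebesgue_on {a..b}. (cmod (f x))\<^sup>2) = 0"
    unfolding L2_inner_class_on complex_norm_square[symmetric] integral_complex_of_real by simp
  then have "AE x in lebesgue_on {a..b}. (cmod (f x))\<^sup>2 = 0"
    using integral_nonneg_eq_0_iff_AE[OF square_integrableD(2)[OF f]] by simp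
  then show "class_on a b f = 0"
    unfolding class_on_zero[of a b, symmetric] class_on_eq_iff by (simp add: AE_restrict_space_iff)
qed

text \<open>On a bounded interval the sequence is also Cauchy in mean, which supplies a subsequence
  converging almost everywhere. Fatou's lemma along it bounds the distance from each
  \<open>F m\<close> to the limit, so the whole sequence converges.\<close>

lemma L2_complete:
  assumes ab: "a < b" and X: "\<And>n. X n \<in> L2 a b"
    and Cauchy: "\<And>e. e > 0 \<Longrightarrow> \<exists>M. \<forall>m\<ge>M. \<forall>n\<ge>M. ip_norm (L2_inner a b) (X m - X n) < e"
  shows "\<exists>x\<in>L2 a b. (\<lambda>n. ip_norm (L2_inner a b) (X n - x)) \<longlonglongrightarrow> 0"
proof -
  let ?M = "lebesgue_on {a..b}"
  let ?ip = "L2_inner a b"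
  have "\<forall>n. \<exists>f. square_integrable a b f \<and> X n = class_on a b f"
    using X by (force simp: L2_def)
  then obtain F where F: "\<And>n. square_integrable a b (F n)" and XF: "\<And>n. X n = class_on a b (F n)"
    by metis
  note [measurable] = square_integrableD(1)[OF F]
  have norm_diff: "ip_norm ?ip (X m - X n) = sqrt (LINT x|?M. (cmod (F m x - F n x))\<^sup>2)" for m n
    by (simp add: XF ip_norm_L2 square_integrable_diff F flip: class_on_diff)
  have "\<exists>N. \<forall>i\<ge>N. \<forall>j\<ge>N. (LINT x|?M. norm (F i x - F j x)) < e" if "e > 0" for e
  proof -
    have "e / (2 * sqrt (b - a)) > 0" using that ab by simp
    then obtain N where N: "\<And>i j. i \<ge> N \<Longrightarrow> j \<ge> N \<Longrightarrow> ip_norm ?ip (X i - X j) < e / (2 * sqrt (b - a))"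
      using Cauchy by blast
    have "(LINT x|?M. norm (F i x - F j x)) < e" if "i \<ge> N" "j \<ge> N" for i j
    proof -
      have "(LINT x|?M. norm (F i x - F j x)) \<le> 2 * sqrt (b - a) * ip_norm ?ip (X i - X j)"
        unfolding norm_diff by (intro integral_norm_le_L2 square_integrable_diff F ab)
      also have "\<dots> < 2 * sqrt (b - a) * (e / (2 * sqrt (b - a)))"
        using ab by (intro mult_strict_left_mono N that) auto
      finally show ?thesis using ab by simp
    qed
    then show ?thesis by blast
  qed
  then obtain r where r: "strict_mono r" and AE_Cauchy: "AE x in ?M. Cauchy (\<lambda>i. F (r i) x)"
    using cauchy_L1_AE_cauchy_subseq[of ?M F] square_integrable_imp_integrable[OF F] by blast
  \<comment> \<open>\<open>lim\<close> is unspecified where the subsequence diverges; these points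
    form a null set.\<close>
  define G where "G = (\<lambda>x. lim (\<lambda>i. F (r i) x))"
  have G_meas [measurable]: "G \<in> borel_measurable ?M"
    unfolding G_def by (rule borel_measurable_lim_metric) measurable
  have lim: "AE x in ?M. (\<lambda>i. F (r i) x) \<longlonglongrightarrow> G x"
    using AE_Cauchy unfolding G_def
    by eventually_elim (simp add: Cauchy_convergent_iff convergent_LIMSEQ_iff)
  have Fatou: "(\<integral>\<^sup>+x. ennreal ((cmod (F m x - G x))\<^sup>2) \<partial>?M) \<le> ennreal (e\<^sup>2)"
    if e: "\<And>i. i \<ge> N \<Longrightarrow> ip_norm ?ip (X m - X i) \<le> e" for m N e
  proof -
    have "(\<integral>\<^sup>+x. ennreal ((cmod (F m x - G x))\<^sup>2) \<partial>?M)
        = (\<integral>\<^sup>+x. liminf (\<lambda>i. ennreal ((cmod (F m x - F (r i) x))\<^sup>2)) \<partial>?M)"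
    proof (rule nn_integral_cong_AE, use lim in eventually_elim)
      fix x assume "(\<lambda>i. F (r i) x) \<longlonglongrightarrow> G x"
      then have "(\<lambda>i. ennreal ((cmod (F m x - F (r i) x))\<^sup>2)) \<longlonglongrightarrow> ennreal ((cmod (F m x - G x))\<^sup>2)"
        by (intro tendsto_ennrealI tendsto_intros)
      then show "ennreal ((cmod (F m x - G x))\<^sup>2) = liminf (\<lambda>i. ennreal ((cmod (F m x - F (r i) x))\<^sup>2))"
        by (rule lim_imp_Liminf[OF sequentially_bot, symmetric])
    qed
    also have "\<dots> \<le> liminf (\<lambda>i. \<integral>\<^sup>+x. ennreal ((cmod (F m x - F (r i) x))\<^sup>2) \<partial>?M)"
      by (rule nn_integral_liminf) measurable
    also have "\<dots> \<le> ennreal (e\<^sup>2)"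
    proof (rule Liminf_le)
      have "(\<integral>\<^sup>+x. ennreal ((cmod (F m x - F (r i) x))\<^sup>2) \<partial>?M) \<le> ennreal (e\<^sup>2)" if "i \<ge> N" for i
      proof -
        have int: "integrable ?M (\<lambda>x. (cmod (F m x - F (r i) x))\<^sup>2)"
          using square_integrableD(2)[OF square_integrable_diff[OF F F]] .
        have "r i \<ge> N" using seq_suble[OF r, of i] that by linarith
        then have "ip_norm ?ip (X m - X (r i)) \<le> e" by (rule e)
        then have "(LINT x|?M. (cmod (F m x - F (r i) x))\<^sup>2) \<le> e\<^sup>2"
          unfolding norm_diff by (rule sqrt_le_D)
        then show ?thesis
          by (subst nn_integral_eq_integral[OF int]) (auto intro: ennreal_leI)
      qed
      then show "\<forall>\<^sub>F i in sequentially. (\<integral>\<^sup>+x. ennreal ((cmod (F m x - F (r i) x))\<^sup>2) \<partial>?M) \<le> ennreal (e\<^sup>2)"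
        by (auto simp: eventually_sequentially)
    qed simp
    finally show ?thesis .
  qed
  have sq_diff: "square_integrable a b (\<lambda>x. F m x - G x)"
    if "(\<integral>\<^sup>+x. ennreal ((cmod (F m x - G x))\<^sup>2) \<partial>?M) \<le> ennreal c" for m c
    unfolding square_integrable_def
  proof
    show "integrable ?M (\<lambda>x. (cmod (F m x - G x))\<^sup>2)"
      using that by (intro integrableI_bounded) (auto intro: le_less_trans)
  qed measurable
  obtain N where N: "\<And>m n. m \<ge> N \<Longrightarrow> n \<ge> N \<Longrightarrow> ip_norm ?ip (X m - X n) < 1"
    using Cauchy[of 1] by auto
  have "square_integrable a b (\<lambda>x. F N x - G x)"
    by (rule sq_diff[OF Fatou[of N N 1]]) (use N in \<open>simp add: less_imp_le\<close>)
  \<comment> \<open>\<open>G\<close> is recovered as the difference of \<open>F N\<close> and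
    \<open>F N - G\<close>.\<close>
  from square_integrable_diff[OF F[of N] this] have G: "square_integrable a b G" by simp
  have "\<exists>N. \<forall>m\<ge>N. ip_norm ?ip (X m - class_on a b G) \<le> e" if e: "e > 0" for e
  proof -
    obtain N where N: "\<And>m n. m \<ge> N \<Longrightarrow> n \<ge> N \<Longrightarrow> ip_norm ?ip (X m - X n) < e"
      using Cauchy[OF e] by auto
    have "ip_norm ?ip (X m - class_on a b G) \<le> e" if "m \<ge> N" for m
    proof -
      have int: "integrable ?M (\<lambda>x. (cmod (F m x - G x))\<^sup>2)"
        using square_integrableD(2)[OF square_integrable_diff[OF F G]] .
      have "ennreal (LINT x|?M. (cmod (F m x - G x))\<^sup>2) \<le> ennreal (e\<^sup>2)"
        using Fatou[of N m e] N[OF that] nn_integral_eq_integral[OF int] by (simp add: less_imp_le)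
      then have "(LINT x|?M. (cmod (F m x - G x))\<^sup>2) \<le> e\<^sup>2"
        by (simp add: ennreal_le_iff)
      then have "sqrt (LINT x|?M. (cmod (F m x - G x))\<^sup>2) \<le> e"
        using e by (simp add: real_le_lsqrt real_sqrt_le_iff')
      then show ?thesis
        by (simp add: XF ip_norm_L2 square_integrable_diff F G flip: class_on_diff)
    qed
    then show ?thesis by blast
  qed
  note small = this
  have "(\<lambda>n. ip_norm ?ip (X n - class_on a b G)) \<longlonglongrightarrow> 0"
  proof (rule LIMSEQ_I)
    fix e :: real assume "e > 0"
    then obtain N where N: "\<And>m. m \<ge> N \<Longrightarrow> ip_norm ?ip (X m - class_on a b G) \<le> e / 2"
      using small[of "e / 2"] by auto
    have "0 \<le> ip_norm ?ip (X m - class_on a b G)" for m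
      by (simp add: XF ip_norm_L2 square_integrable_diff F G flip: class_on_diff)
    then have "norm (ip_norm ?ip (X m - class_on a b G) - 0) < e" if "m \<ge> N" for m
      using N[OF that] \<open>e > 0\<close> by simp
    then show "\<exists>N. \<forall>m\<ge>N. norm (ip_norm ?ip (X m - class_on a b G) - 0) < e" by blast
  qed
  then show ?thesis using class_on_in_L2[OF G] by blast
qed

lemma L2_hilbert_space:
  assumes "a < b"
  shows "hilbert_space scale_fclass (L2 a b) (L2_inner a b)"
  unfolding hilbert_space_def
proof (intro conjI allI impI)
  fix X :: "nat \<Rightarrow> fclass"
  assume "range X \<subseteq> L2 a b \<and> (\<forall>e>0. \<exists>M. \<forall>m\<ge>M. \<forall>n\<ge>M. ip_norm (L2_inner a b) (X m - X n) < e)"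
  then show "\<exists>x\<in>L2 a b. (\<lambda>n. ip_norm (L2_inner a b) (X n - x)) \<longlonglongrightarrow> 0"
    using L2_complete[OF assms, of X] by blast
qed (rule vector_space_scale_fclass L2_subspace L2_inner_product)+

section \<open>Antiperiodic primitives\<close>

lemma square_integrable_integral:
  assumes "square_integrable a b f"
  shows "f absolutely_integrable_on {a..b}" "(\<lambda>x. (cmod (f x))\<^sup>2) integrable_on {a..b}"
  using square_integrable_imp_integrable[OF assms] integrable_on_lebesgue_on[OF square_integrableD(2)[OF assms]]
  by (simp_all add: set_integrable_def integrable_restrict_space)

text \<open>Needed for highest derivatives, which agree with a given function only off a null set.
  Measurability passes over because Lebesgue measure is complete.\<close>

lemma square_integrable_cong_negligible:
  assumes f: "square_integrable a b f" and N: "negligible N" "\<And>x. x \<in> {a..b} - N \<Longrightarrow> g x = f x"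
  shows "square_integrable a b g"
proof -
  have "f x = g x" if "x \<in> {a..b} - N" for x
    using N(2)[OF that] by simp
  then have AE: "AE x in lebesgue. x \<in> {a..b} \<longrightarrow> f x = g x"
    unfolding eventually_ae_filter_negligible using N(1) by (intro exI[of _ N]) auto
  have "(\<lambda>x. indicator {a..b} x *\<^sub>R f x) \<in> borel_measurable lebesgue"
    using square_integrableD(1)[OF f] by (subst borel_measurable_restrict_space_iff[symmetric]) auto
  moreover have "AE x in lebesgue. indicator {a..b} x *\<^sub>R f x = indicator {a..b} x *\<^sub>R g x"
    using AE by eventually_elim (auto simp: indicator_def)
  ultimately have "(\<lambda>x. indicator {a..b} x *\<^sub>R g x) \<in> borel_measurable lebesgue"
    by (rule borel_measurable_AE)
  then have g: "g \<in> borel_measurable (lebesgue_on {a..b})"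
    by (subst borel_measurable_restrict_space_iff) auto
  note [measurable] = g square_integrableD(1)[OF f]
  have "integrable (lebesgue_on {a..b}) (\<lambda>x. (cmod (g x))\<^sup>2) \<longleftrightarrow>
      integrable (lebesgue_on {a..b}) (\<lambda>x. (cmod (f x))\<^sup>2)"
  proof (rule integrable_cong_AE)
    show "AE x in lebesgue_on {a..b}. (cmod (g x))\<^sup>2 = (cmod (f x))\<^sup>2"
      using AE by (subst AE_restrict_space_iff) (auto elim: eventually_mono)
  qed measurable
  then show ?thesis
    using g square_integrableD(2)[OF f] by (simp add: square_integrable_def)
qed

lemma class_on_eq_negligible:
  assumes "negligible N" "\<And>x. x \<in> {a..b} - N \<Longrightarrow> f x = g x"
  shows "class_on a b f = class_on a b g"
  unfolding class_on_eq_iff eventually_ae_filter_negligible using assms by (intro exI[of _ N]) auto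

lemma AC_on_cong:
  assumes f: "AC_on a b f" and eq: "\<And>x. x \<in> {a..b} \<Longrightarrow> g x = f x"
  shows "AC_on a b g"
proof -
  have "(\<Sum>K\<in>d. cmod (g (Sup K) - g (Inf K))) = (\<Sum>K\<in>d. cmod (f (Sup K) - f (Inf K)))"
    if d: "d division_of S" "S \<subseteq> {a..b}" for d S
  proof (rule sum.cong[OF refl])
    fix K assume K: "K \<in> d"
    then obtain u v where "K = {u..v}" "K \<noteq> {}"
      using division_ofD(3,4)[OF d(1) K] by (metis cbox_interval)
    moreover have "K \<subseteq> {a..b}" using division_ofD(2)[OF d(1) K] d(2) by blast
    ultimately have "Sup K \<in> {a..b}" "Inf K \<in> {a..b}" by auto
    then show "cmod (g (Sup K) - g (Inf K)) = cmod (f (Sup K) - f (Inf K))" by (simp add: eq)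
  qed
  then show ?thesis
    using f unfolding AC_on_def by (metis (no_types, lifting))
qed

text \<open>Increments over a family of total length \<open>L\<close> add up to at most
  \<open>t * Q + L / t\<close>; first \<open>t\<close> is fixed, then \<open>L\<close> is made
  small. As \<open>\<phi>\<close> need only majorize increments, the criterion covers products of
  primitives as well as primitives.\<close>

lemma AC_onI:
  assumes \<phi>: "square_integrable a b \<phi>"
    and le: "\<And>u v. \<lbrakk>a \<le> u; u \<le> v; v \<le> b\<rbrakk> \<Longrightarrow> cmod (F v - F u) \<le> integral {u..v} (\<lambda>x. cmod (\<phi> x))"
  shows "AC_on a b F"
  unfolding AC_on_def
proof (intro allI impI)
  fix \<epsilon> :: real assume \<epsilon>: "\<epsilon> > 0"
  define Q where "Q = integral {a..b} (\<lambda>x. (cmod (\<phi> x))\<^sup>2)"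
  \<comment> \<open>This keeps \<open>t * Q\<close> within \<open>\<epsilon> / 2\<close>, the added
    1 covering \<open>Q = 0\<close>; lengths below \<open>t * \<epsilon> / 2\<close> take care of
    the other half.\<close>
  define t where "t = \<epsilon> / (2 * (Q + 1))"
  have Q: "Q \<ge> 0" unfolding Q_def by (rule integral_nonneg[OF square_integrable_integral(2)[OF \<phi>]]) simp
  have t: "t > 0" "t * Q \<le> \<epsilon> / 2" using Q \<epsilon> by (auto simp: t_def field_simps)
  have int: "(\<lambda>x. cmod (\<phi> x)) integrable_on {u..v}" "(\<lambda>x. (cmod (\<phi> x))\<^sup>2) integrable_on {u..v}"
    if "a \<le> u" "v \<le> b" for u v
    using square_integrable_integral[OF \<phi>] that
    by (auto intro!: integrable_on_subinterval[of _ "{a..b}"] dest: absolutely_integrable_norm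
        simp: absolutely_integrable_on_def)
  have bound: "cmod (F v - F u) \<le> t * integral {u..v} (\<lambda>x. (cmod (\<phi> x))\<^sup>2) + (v - u) / t"
    if "a \<le> u" "u \<le> v" "v \<le> b" for u v
  proof -
    have intq: "(\<lambda>x. t * (cmod (\<phi> x))\<^sup>2) integrable_on {u..v}"
      using integrable_cmul[OF int(2)[OF that(1,3)], of t] by simp
    have "cmod (F v - F u) \<le> integral {u..v} (\<lambda>x. cmod (\<phi> x))" using le that by blast
    also have "\<dots> \<le> integral {u..v} (\<lambda>x. t * (cmod (\<phi> x))\<^sup>2 + 1 / t)"
    proof (rule integral_le)
      show "cmod (\<phi> x) \<le> t * (cmod (\<phi> x))\<^sup>2 + 1 / t" for x
        using t(1) by (rule le_mult_power2_plus_inverse)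
    qed (use int that intq in \<open>auto intro!: integrable_add\<close>)
    also have "\<dots> = t * integral {u..v} (\<lambda>x. (cmod (\<phi> x))\<^sup>2) + (v - u) / t"
      using intq that by (subst Henstock_Kurzweil_Integration.integral_add) auto
    finally show ?thesis .
  qed
  have "(\<Sum>K\<in>d. cmod (F (Sup K) - F (Inf K))) < \<epsilon>"
    if d: "d division_of S" and S: "S \<subseteq> {a..b}" and small: "(\<Sum>K\<in>d. Sup K - Inf K) < t * \<epsilon> / 2" for d S
  proof -
    have K: "\<exists>u v. K = {u..v} \<and> a \<le> u \<and> u \<le> v \<and> v \<le> b" if K: "K \<in> d" for K
    proof -
      obtain u v where "K = {u..v}" "K \<noteq> {}"
        using division_ofD(3,4)[OF d K] by (metis cbox_interval)
      moreover have "K \<subseteq> {a..b}" using division_ofD(2)[OF d K] S by blast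
      ultimately show ?thesis by auto
    qed
    let ?q = "\<lambda>x. (cmod (\<phi> x))\<^sup>2"
    have int_K: "?q integrable_on K" if "K \<in> d" for K
      using K[OF that] int(2) by auto
    have "(\<Sum>K\<in>d. cmod (F (Sup K) - F (Inf K))) \<le> (\<Sum>K\<in>d. t * integral K ?q + (Sup K - Inf K) / t)"
    proof (rule sum_mono)
      fix K assume "K \<in> d"
      then obtain u v where "K = {u..v}" "a \<le> u" "u \<le> v" "v \<le> b" using K by blast
      then show "cmod (F (Sup K) - F (Inf K)) \<le> t * integral K ?q + (Sup K - Inf K) / t"
        using bound[of u v] by simp
    qed
    also have "\<dots> = t * (\<Sum>K\<in>d. integral K ?q) + (\<Sum>K\<in>d. Sup K - Inf K) / t"
      by (simp add: sum.distrib sum_distrib_left sum_divide_distrib)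
    also have "(\<Sum>K\<in>d. integral K ?q) = integral S ?q"
      using integral_combine_division_bottomup[OF d int_K] by simp
    also have "t * integral S ?q + (\<Sum>K\<in>d. Sup K - Inf K) / t < t * Q + \<epsilon> / 2"
    proof (rule add_le_less_mono)
      have "integral S ?q \<le> Q"
        unfolding Q_def using S square_integrable_integral(2)[OF \<phi>]
          integrable_combine_division[OF d int_K] by (intro integral_subset_le) auto
      then show "t * integral S ?q \<le> t * Q" using t by simp
      show "(\<Sum>K\<in>d. Sup K - Inf K) / t < \<epsilon> / 2" using small t by (simp add: field_simps)
    qed
    also have "\<dots> \<le> \<epsilon>" using t by simp
    finally show ?thesis .
  qed
  moreover have "t * \<epsilon> / 2 > 0" using t \<epsilon> by simp
  ultimately show "\<exists>\<delta>>0. \<forall>d S. d division_of S \<and> S \<subseteq> {a..b} \<and> (\<Sum>K\<in>d. Sup K - Inf K) < \<delta>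
        \<longrightarrow> (\<Sum>K\<in>d. cmod (F (Sup K) - F (Inf K))) < \<epsilon>"
    by blast
qed

lemma AC_on_continuous: "AC_on a b f \<Longrightarrow> continuous_on {a..b} f"
  by (rule abs_cont_continuous_on[OF AC_on_imp_abs_cont])

text \<open>Subtracting half of the total integral makes the boundary values antiperiodic.\<close>

definition antideriv :: "real \<Rightarrow> real \<Rightarrow> (real \<Rightarrow> complex) \<Rightarrow> real \<Rightarrow> complex" where
  "antideriv a b g x = integral {a..x} g - integral {a..b} g / 2"

lemma integral_cong_AE_lebesgue:
  assumes "AE x in lebesgue. x \<in> S \<longrightarrow> f x = g x"
  shows "integral S f = integral S g"
proof -
  obtain N where "negligible N" "{x. \<not> (x \<in> S \<longrightarrow> f x = g x)} \<subseteq> N"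
    using assms unfolding eventually_ae_filter_negligible by blast
  then show ?thesis by (intro integral_spike[of N]) auto
qed

lift_definition antideriv_class :: "real \<Rightarrow> real \<Rightarrow> fclass \<Rightarrow> fclass" is
  "\<lambda>a b g x. if x \<in> {a..b} then antideriv a b g x else 0"
proof -
  fix a b :: real and g h :: "real \<Rightarrow> complex"
  assume ae: "AE x in lebesgue. g x = h x"
  have "integral S g = integral S h" for S
    by (rule integral_cong_AE_lebesgue) (use ae in eventually_elim, simp)
  then show "AE x in lebesgue. (if x \<in> {a..b} then antideriv a b g x else 0)
                             = (if x \<in> {a..b} then antideriv a b h x else 0)"
    by (simp add: antideriv_def)
qed

lemma antideriv_class_on: "antideriv_class a b (class_on a b g) = class_on a b (antideriv a b g)"
proof transfer
  fix a b :: real and g :: "real \<Rightarrow> complex"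
  have "integral {a..x} (\<lambda>x. if x \<in> {a..b} then g x else 0) = integral {a..x} g" if "x \<le> b" for x
    using that by (intro integral_cong) auto
  then show "AE x in lebesgue. (if x \<in> {a..b} then antideriv a b (\<lambda>x. if x \<in> {a..b} then g x else 0) x else 0)
                             = (if x \<in> {a..b} then antideriv a b g x else 0)"
    by (simp add: antideriv_def)
qed

context
  fixes a b :: real
  assumes ab: "a < b"
begin

lemma antideriv_diff_eq:
  assumes g: "square_integrable a b g" and "a \<le> u" "u \<le> v" "v \<le> b"
  shows "antideriv a b g v - antideriv a b g u = integral {u..v} g"
proof -
  have "g integrable_on {a..v}"
    by (rule integrable_on_subinterval[of _ "{a..b}"])
      (use square_integrable_integral(1)[OF g] assms in \<open>auto simp: absolutely_integrable_on_def\<close>)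
  then show ?thesis
    using Henstock_Kurzweil_Integration.integral_combine[of a u v g] assms by (simp add: antideriv_def algebra_simps)
qed

lemma norm_integral_le:
  assumes g: "square_integrable a b g" and "a \<le> u" "v \<le> b"
  shows "cmod (integral {u..v} g) \<le> integral {u..v} (\<lambda>x. cmod (g x))"
proof -
  have "g absolutely_integrable_on {u..v}"
    using square_integrable_integral(1)[OF g] by (rule absolutely_integrable_on_subinterval) (use assms in auto)
  then show ?thesis
    by (intro Henstock_Kurzweil_Integration.integral_norm_bound_integral) (auto simp: absolutely_integrable_on_def)
qed

lemma AC_on_antideriv:
  assumes g: "square_integrable a b g"
  shows "AC_on a b (antideriv a b g)"
  using antideriv_diff_eq[OF g] norm_integral_le[OF g] by (intro AC_onI[OF g]) auto

lemma continuous_on_antideriv: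
  "square_integrable a b g \<Longrightarrow> continuous_on {a..b} (antideriv a b g)"
  by (rule AC_on_continuous[OF AC_on_antideriv])

lemma square_integrable_antideriv:
  "square_integrable a b g \<Longrightarrow> square_integrable a b (antideriv a b g)"
  by (rule square_integrable_continuous[OF continuous_on_antideriv])

lemma antideriv_boundary: "antideriv a b g a = - antideriv a b g b"
  by (simp add: antideriv_def)

lemma antideriv_has_vector_derivative:
  assumes g: "square_integrable a b g"
  obtains N where "negligible N"
    "\<And>x. x \<in> {a..b} - N \<Longrightarrow> (antideriv a b g has_vector_derivative g x) (at x within {a..b})"
proof -
  have "g integrable_on {a..b}"
    using square_integrable_integral(1)[OF g] by (simp add: absolutely_integrable_on_def)
  then obtain N where N: "negligible N" and deriv: "\<And>x. x \<in> {a..b} - N \<Longrightarrow>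
      ((\<lambda>x. integral {a..x} g) has_vector_derivative g x) (at x within {a..b})"
    using Lebesgue_differentiation by blast
  show ?thesis
  proof (rule that[OF N])
    fix x assume "x \<in> {a..b} - N"
    then show "(antideriv a b g has_vector_derivative g x) (at x within {a..b})"
      using has_vector_derivative_diff[OF deriv has_vector_derivative_const] by (simp add: antideriv_def[abs_def])
  qed
qed

text \<open>For continuous \<open>g\<close> the derivative exists at every point, endpoints
  included. Below the top order this is essential: those derivatives are evaluated at the boundary
  and differentiated again.\<close>

lemma antideriv_has_vector_derivative_continuous:
  assumes g: "continuous_on {a..b} g" and x: "x \<in> {a..b}"
  shows "(antideriv a b g has_vector_derivative g x) (at x within {a..b})"
  using has_vector_derivative_diff[OF integral_has_vector_derivative[OF g x] has_vector_derivative_const]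
  by (simp add: antideriv_def[abs_def])

lemma deriv_on_1_eqI:
  assumes f: "\<And>y. y \<in> {a..b} \<Longrightarrow> f y = F y" and F: "(F has_vector_derivative D) (at x within {a..b})"
    and x: "x \<in> {a..b}"
  shows "deriv_on a b 1 f x = D"
proof -
  have "(f has_vector_derivative D) (at x within {a..b})"
    by (rule has_vector_derivative_transform[OF x f F])
  then show ?thesis
    using ab x by (simp add: deriv_on_def vector_derivative_within_Icc)
qed

lemma deriv_on_0 [simp]: "deriv_on a b 0 f = f"
  by (simp add: deriv_on_def)

lemma deriv_on_Suc: "deriv_on a b (Suc j) f = deriv_on a b 1 (deriv_on a b j f)"
  by (simp add: deriv_on_def)

text \<open>Integration by parts: \<open>antideriv g * cnj (antideriv h)\<close> takes equal values at \<open>a\<close> and \<open>b\<close>.\<close>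

lemma antideriv_skew:
  assumes g: "square_integrable a b g" and h: "square_integrable a b h"
  shows "(LINT x|lebesgue_on {a..b}. antideriv a b g x * cnj (h x))
       = - (LINT x|lebesgue_on {a..b}. g x * cnj (antideriv a b h x))"
proof -
  let ?M = "lebesgue_on {a..b}"
  define G H P where "G = antideriv a b g" and "H = antideriv a b h" and "P = (\<lambda>x. G x * cnj (H x))"
  have G: "square_integrable a b G" and H: "square_integrable a b H"
    using g h by (simp_all add: G_def H_def square_integrable_antideriv)
  have "compact (G ` {a..b})" "compact (H ` {a..b})"
    using g h by (auto simp: G_def H_def intro!: compact_continuous_image continuous_on_antideriv)
  then obtain B1 B2 where B1: "\<And>x. x \<in> {a..b} \<Longrightarrow> cmod (G x) \<le> B1"
    and B2: "\<And>x. x \<in> {a..b} \<Longrightarrow> cmod (H x) \<le> B2"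
    by (metis bounded_iff compact_imp_bounded image_eqI)
  define B where "B = max B1 B2"
  have B: "cmod (G x) \<le> B" "cmod (H x) \<le> B" if "x \<in> {a..b}" for x
    using B1[OF that] B2[OF that] by (auto simp: B_def)
  have "0 \<le> B" using order_trans[OF norm_ge_zero B(1)[of a]] ab by simp
  \<comment> \<open>A majorant for the increments of the product \<open>P\<close>: one factor is
    bounded by \<open>B\<close>, the increment of the other by the integral of
    \<open>cmod (g x)\<close> or \<open>cmod (h x)\<close>.\<close>
  define \<phi> where "\<phi> = (\<lambda>x. complex_of_real B * (of_real (cmod (g x)) + of_real (cmod (h x))))"
  have \<phi>: "square_integrable a b \<phi>"
    unfolding \<phi>_def by (intro square_integrable_scale square_integrable_add square_integrable_norm g h)
  have norm_\<phi>: "cmod (\<phi> x) = B * (cmod (g x) + cmod (h x))" for x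
  proof -
    have "\<phi> x = of_real (B * (cmod (g x) + cmod (h x)))" by (simp add: \<phi>_def)
    then have "cmod (\<phi> x) = \<bar>B * (cmod (g x) + cmod (h x))\<bar>" by (metis norm_of_real)
    then show ?thesis using \<open>0 \<le> B\<close> by simp
  qed
  have "AC_on a b P"
  proof (rule AC_onI[OF \<phi>])
    fix u v assume uv: "a \<le> u" "u \<le> v" "v \<le> b"
    have int: "(\<lambda>x. cmod (g x)) integrable_on {u..v}" "(\<lambda>x. cmod (h x)) integrable_on {u..v}"
      using absolutely_integrable_on_subinterval[OF square_integrable_integral(1)[OF g], of u v]
        absolutely_integrable_on_subinterval[OF square_integrable_integral(1)[OF h], of u v] uv
      by (auto simp: absolutely_integrable_on_def)
    have G_le: "cmod (G v - G u) \<le> integral {u..v} (\<lambda>x. cmod (g x))"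
      using antideriv_diff_eq[OF g] norm_integral_le[OF g] uv by (simp add: G_def)
    have H_le: "cmod (H v - H u) \<le> integral {u..v} (\<lambda>x. cmod (h x))"
      using antideriv_diff_eq[OF h] norm_integral_le[OF h] uv by (simp add: H_def)
    have "P v - P u = (G v - G u) * cnj (H v) + G u * cnj (H v - H u)"
      by (simp add: P_def algebra_simps)
    then have "cmod (P v - P u) \<le> cmod (G v - G u) * cmod (H v) + cmod (G u) * cmod (H v - H u)"
      by (metis norm_triangle_ineq norm_mult complex_mod_cnj)
    also have "\<dots> \<le> integral {u..v} (\<lambda>x. cmod (g x)) * B + B * integral {u..v} (\<lambda>x. cmod (h x))"
      using B[of u] B[of v] uv G_le H_le \<open>0 \<le> B\<close>
      by (intro add_mono mult_mono integral_nonneg int) auto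
    also have "\<dots> = integral {u..v} (\<lambda>x. cmod (\<phi> x))"
      unfolding norm_\<phi> Henstock_Kurzweil_Integration.integral_mult_right
        Henstock_Kurzweil_Integration.integral_add[OF int] by (simp add: distrib_left mult.commute)
    finally show "cmod (P v - P u) \<le> integral {u..v} (\<lambda>x. cmod (\<phi> x))" .
  qed
  then have "P b = P a + integral {a..b} (deriv_on a b 1 P)"
    using AC_on_fundamental_theorem(2) ab by simp
  moreover have "P b = P a"
    using antideriv_boundary[of g] antideriv_boundary[of h] by (simp add: P_def G_def H_def)
  ultimately have zero: "integral {a..b} (deriv_on a b 1 P) = 0" by simp
  obtain N1 where N1: "negligible N1"
    "\<And>x. x \<in> {a..b} - N1 \<Longrightarrow> (G has_vector_derivative g x) (at x within {a..b})"
    using antideriv_has_vector_derivative[OF g] unfolding G_def by blast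
  obtain N2 where N2: "negligible N2"
    "\<And>x. x \<in> {a..b} - N2 \<Longrightarrow> (H has_vector_derivative h x) (at x within {a..b})"
    using antideriv_has_vector_derivative[OF h] unfolding H_def by blast
  have deriv: "deriv_on a b 1 P x = g x * cnj (H x) + G x * cnj (h x)" if "x \<in> {a..b} - (N1 \<union> N2)" for x
  proof (rule deriv_on_1_eqI)
    show "(P has_vector_derivative g x * cnj (H x) + G x * cnj (h x)) (at x within {a..b})"
      using has_vector_derivative_mult[OF N1(2) bounded_linear.has_vector_derivative[OF bounded_linear_cnj N2(2)]]
        that by (simp add: P_def add.commute)
  qed (use that in auto)
  have "integral {a..b} (deriv_on a b 1 P) = integral {a..b} (\<lambda>x. g x * cnj (H x) + G x * cnj (h x))"
    by (rule integral_spike[of "N1 \<union> N2"]) (use N1(1) N2(1) deriv in auto)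
  also have "\<dots> = (LINT x|?M. g x * cnj (H x) + G x * cnj (h x))"
    by (intro lebesgue_integral_eq_integral[symmetric] Bochner_Integration.integrable_add
        integrable_mult_cnj g h G H) simp
  also have "\<dots> = (LINT x|?M. g x * cnj (H x)) + (LINT x|?M. G x * cnj (h x))"
    by (intro Bochner_Integration.integral_add integrable_mult_cnj g h G H)
  finally show ?thesis
    using zero by (simp add: G_def H_def add_eq_0_iff)
qed

text \<open>The integral up to \<open>x\<close> contributes at most the L1 norm \<open>I\<close> of
  \<open>g\<close>, the subtracted half at most \<open>I / 2\<close>; 3 is this \<open>3 / 2\<close>
  times the 2 of \<open>integral_norm_le_L2\<close>.\<close>

lemma norm_antideriv_le:
  assumes g: "square_integrable a b g" and x: "x \<in> {a..b}"
  shows "cmod (antideriv a b g x) \<le> 3 * sqrt (b - a) * ip_norm (L2_inner a b) (class_on a b g)"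
proof -
  have int: "(\<lambda>x. cmod (g x)) integrable_on {u..v}" if "a \<le> u" "v \<le> b" for u v
    using absolutely_integrable_on_subinterval[OF square_integrable_integral(1)[OF g], of u v] that
    by (auto simp: absolutely_integrable_on_def)
  define I where "I = integral {a..b} (\<lambda>x. cmod (g x))"
  have "integral {a..x} (\<lambda>x. cmod (g x)) \<le> I"
    unfolding I_def using x by (intro integral_subset_le int) auto
  then have 1: "cmod (integral {a..x} g) \<le> I"
    using norm_integral_le[OF g, of a x] x by simp
  have 2: "cmod (integral {a..b} g) \<le> I"
    using norm_integral_le[OF g, of a b] by (simp add: I_def)
  have "cmod (antideriv a b g x) \<le> cmod (integral {a..x} g) + cmod (integral {a..b} g) / 2"
    unfolding antideriv_def using norm_triangle_ineq4[of "integral {a..x} g" "integral {a..b} g / 2"]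
    by (simp add: norm_divide)
  also have "\<dots> \<le> 3 / 2 * I" using 1 2 by simp
  also have "I = (LINT x|lebesgue_on {a..b}. cmod (g x))"
    unfolding I_def using square_integrable_imp_integrable[OF g]
    by (intro lebesgue_integral_eq_integral[symmetric]) auto
  also have "3 / 2 * \<dots> \<le> 3 / 2 * (2 * sqrt (b - a) * ip_norm (L2_inner a b) (class_on a b g))"
    using integral_norm_le_L2[OF g ab] by (simp add: ip_norm_L2[OF g])
  finally show ?thesis by simp
qed

text \<open>Integrating the square of the uniform bound over length \<open>b - a\<close> contributes
  the second factor \<open>sqrt (b - a)\<close>.\<close>

lemma ip_norm_antideriv_le:
  assumes g: "square_integrable a b g"
  shows "ip_norm (L2_inner a b) (class_on a b (antideriv a b g))
       \<le> 3 * (b - a) * ip_norm (L2_inner a b) (class_on a b g)"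
proof -
  let ?M = "lebesgue_on {a..b}"
  let ?n = "ip_norm (L2_inner a b) (class_on a b g)"
  define C where "C = 3 * sqrt (b - a) * ?n"
  have n: "0 \<le> ?n" by (simp add: ip_norm_L2[OF g])
  then have C: "0 \<le> C" using ab by (simp add: C_def)
  have "(LINT x|?M. (cmod (antideriv a b g x))\<^sup>2) \<le> (LINT x|?M. C\<^sup>2)"
  proof (rule integral_mono)
    show "integrable ?M (\<lambda>x. (cmod (antideriv a b g x))\<^sup>2)"
      by (rule square_integrableD(2)[OF square_integrable_antideriv[OF g]])
    show "integrable ?M (\<lambda>x. C\<^sup>2)"
      by (rule finite_measure.integrable_const[OF finite_measure_Icc])
    fix x assume "x \<in> space ?M"
    then show "(cmod (antideriv a b g x))\<^sup>2 \<le> C\<^sup>2"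
      using norm_antideriv_le[OF g, of x] by (intro power_mono) (auto simp: C_def)
  qed
  also have "\<dots> = (b - a) * C\<^sup>2"
    using ab by (simp add: measure_restrict_space)
  finally have "sqrt (LINT x|?M. (cmod (antideriv a b g x))\<^sup>2) \<le> sqrt (b - a) * C"
    using C ab by (metis real_sqrt_abs real_sqrt_le_iff real_sqrt_mult abs_of_nonneg)
  also have "\<dots> = 3 * (sqrt (b - a) * sqrt (b - a)) * ?n" by (simp add: C_def)
  also have "sqrt (b - a) * sqrt (b - a) = b - a" using ab by simp
  finally show ?thesis by (simp add: ip_norm_L2[OF square_integrable_antideriv[OF g]])
qed

text \<open>The primitive is continuous, so vanishing almost everywhere means vanishing on all of
  \<open>[a, b]\<close>. Its derivative is then \<open>0\<close>, and almost everywhere it is also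
  \<open>g\<close>.\<close>

lemma antideriv_eq_0:
  assumes g: "square_integrable a b g" and zero: "class_on a b (antideriv a b g) = 0"
  shows "class_on a b g = 0"
proof -
  let ?F = "antideriv a b g"
  have cont: "continuous_on {a..b} ?F" by (rule continuous_on_antideriv[OF g])
  have "integral {a..b} (\<lambda>x. (cmod (?F x))\<^sup>2) = integral {a..b} (\<lambda>x. (cmod 0)\<^sup>2)"
    by (rule integral_cong_AE_lebesgue)
      (use zero[folded class_on_zero[of a b], unfolded class_on_eq_iff] in eventually_elim, simp)
  then have "\<forall>x\<in>{a..b}. (cmod (?F x))\<^sup>2 = 0"
    using ab cont by (subst integral_eq_0_iff[symmetric]) (auto intro!: continuous_intros)
  then have F0: "?F x = 0" if "x \<in> {a..b}" for x using that by simp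
  obtain N where N: "negligible N"
    "\<And>x. x \<in> {a..b} - N \<Longrightarrow> (?F has_vector_derivative g x) (at x within {a..b})"
    using antideriv_has_vector_derivative[OF g] by blast
  have "g x = 0" if x: "x \<in> {a..b} - N" for x
    using deriv_on_1_eqI[of ?F ?F "g x" x] deriv_on_1_eqI[of ?F "\<lambda>x. 0" 0 x] N(2)[OF x] x F0
    by (simp add: has_vector_derivative_const)
  then have "class_on a b g = class_on a b (\<lambda>x. 0)"
    by (intro class_on_eq_negligible[OF N(1)]) auto
  then show ?thesis by (simp add: class_on_zero)
qed

lemma antideriv_class_skew_operator:
  assumes "0 < k"
  shows "skew_operator scale_fclass (L2 a b) (L2_inner a b) (antideriv_class a b) k (3 * (b - a))"
proof -
  have int: "g integrable_on {u..v}" if "square_integrable a b g" "a \<le> u" "v \<le> b" for g u v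
    using absolutely_integrable_on_subinterval[OF square_integrable_integral(1)[OF that(1)], of u v] that
    by (auto simp: absolutely_integrable_on_def)
  have add: "antideriv a b (\<lambda>x. f x + g x) x = antideriv a b f x + antideriv a b g x"
    if "square_integrable a b f" "square_integrable a b g" "x \<in> {a..b}" for f g x
    using that int by (simp add: antideriv_def Henstock_Kurzweil_Integration.integral_add field_simps)
  have scale: "antideriv a b (\<lambda>x. c * f x) x = c * antideriv a b f x" for c f x
    by (simp add: antideriv_def algebra_simps)
  show ?thesis
  proof (unfold_locales, rule L2_hilbert_space[OF ab]; (unfold L2_def)?; (elim imageE CollectE; hypsubst)?)
    fix f assume "square_integrable a b f"
    then show "antideriv_class a b (class_on a b f) \<in> class_on a b ` {f. square_integrable a b f}"
      by (simp add: antideriv_class_on square_integrable_antideriv)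
  next
    fix f g assume "square_integrable a b f" "square_integrable a b g"
    then show "antideriv_class a b (class_on a b f + class_on a b g)
        = antideriv_class a b (class_on a b f) + antideriv_class a b (class_on a b g)"
      unfolding class_on_add[symmetric] antideriv_class_on by (intro class_on_cong add)
  next
    fix c f
    show "antideriv_class a b (scale_fclass c (class_on a b f))
        = scale_fclass c (antideriv_class a b (class_on a b f))"
      unfolding class_on_scale[symmetric] antideriv_class_on by (intro class_on_cong scale)
  next
    fix f assume "square_integrable a b f"
    then show "ip_norm (L2_inner a b) (antideriv_class a b (class_on a b f))
        \<le> 3 * (b - a) * ip_norm (L2_inner a b) (class_on a b f)"
      unfolding antideriv_class_on by (rule ip_norm_antideriv_le)
  next
    fix f g assume "square_integrable a b f" "square_integrable a b g"
    then show "L2_inner a b (antideriv_class a b (class_on a b f)) (class_on a b g)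
        = - L2_inner a b (class_on a b f) (antideriv_class a b (class_on a b g))"
      by (simp add: antideriv_class_on L2_inner_class_on antideriv_skew)
  next
    fix f assume "square_integrable a b f" "antideriv_class a b (class_on a b f) = 0"
    then show "class_on a b f = 0"
      by (simp add: antideriv_class_on antideriv_eq_0)
  qed (rule assms)
qed

section \<open>The spaces V_n as ranges of powers of the primitive\<close>

lemma antideriv_class_pow: "(antideriv_class a b ^^ n) (class_on a b g) = class_on a b ((antideriv a b ^^ n) g)"
  by (induction n) (simp_all add: antideriv_class_on)

lemma square_integrable_antideriv_pow:
  "square_integrable a b g \<Longrightarrow> square_integrable a b ((antideriv a b ^^ n) g)"
  by (induction n) (simp_all add: square_integrable_antideriv)

text \<open>The fundamental theorem expresses the \<open>i\<close>-th derivative by its value at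
  \<open>a\<close> and the integral of the next one. Antiperiodicity forces that value to be minus
  half of the total integral, which is the constant in \<open>antideriv\<close>. The induction
  descends from \<open>n\<close> to \<open>j\<close>.\<close>

lemma V_fun_deriv_on:
  assumes f: "f \<in> V_fun a b n" and "j \<le> n"
  shows "square_integrable a b (deriv_on a b j f)"
    "class_on a b (deriv_on a b j f) = (antideriv_class a b ^^ (n - j)) (class_on a b (deriv_on a b n f))"
proof -
  have AC: "AC_on a b (deriv_on a b i f)" and bd: "deriv_on a b i f a = - deriv_on a b i f b" if "i < n" for i
    using f that by (auto simp: V_fun_def)
  have sq: "square_integrable a b (deriv_on a b i f)" if "i \<le> n" for i
  proof (cases "i = n")
    case True
    then show ?thesis using f by (simp add: V_fun_def)
  next
    case False
    then show ?thesis using AC[of i] that by (intro square_integrable_continuous AC_on_continuous) auto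
  qed
  then show "square_integrable a b (deriv_on a b j f)" using assms by simp
  have step: "class_on a b (deriv_on a b i f) = antideriv_class a b (class_on a b (deriv_on a b (Suc i) f))"
    if "i < n" for i
    unfolding antideriv_class_on
  proof (rule class_on_cong)
    fix x assume x: "x \<in> {a..b}"
    let ?h = "deriv_on a b i f"
    have FTC: "?h y = ?h a + integral {a..y} (deriv_on a b (Suc i) f)" if "y \<in> {a..b}" for y
      using AC_on_fundamental_theorem(2)[OF AC[OF \<open>i < n\<close>] ab that] by (simp only: deriv_on_Suc[symmetric])
    have "?h b = - ?h a" using bd[OF that] by simp
    then have "- ?h a = ?h a + integral {a..b} (deriv_on a b (Suc i) f)" using FTC[of b] ab by simp
    then have "?h a + (?h a + integral {a..b} (deriv_on a b (Suc i) f)) = 0" by (metis add.right_inverse)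
    moreover have "?h a = (?h a + (?h a + integral {a..b} (deriv_on a b (Suc i) f))) / 2
        - integral {a..b} (deriv_on a b (Suc i) f) / 2" by (simp add: field_simps)
    ultimately have "?h a = - (integral {a..b} (deriv_on a b (Suc i) f) / 2)" by simp
    then show "?h x = antideriv a b (deriv_on a b (Suc i) f) x"
      using FTC[OF x] by (simp add: antideriv_def)
  qed
  show "class_on a b (deriv_on a b j f) = (antideriv_class a b ^^ (n - j)) (class_on a b (deriv_on a b n f))"
    using \<open>j \<le> n\<close>
  proof (induction j rule: inc_induct)
    case (step i)
    then have "n - i = Suc (n - Suc i)" by simp
    then show ?case using step \<open>\<And>i. i < n \<Longrightarrow> _ = antideriv_class a b _\<close>[of i] by simp
  qed simp
qed

text \<open>Below order \<open>n\<close> the derivatives are identified at every point of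
  \<open>[a, b]\<close>. At order \<open>n\<close> the integrand is merely square-integrable, so the
  identity holds off a null set and is stated for classes.\<close>

lemma antideriv_pow_V_fun:
  assumes g: "square_integrable a b g"
  shows "(antideriv a b ^^ n) g \<in> V_fun a b n"
    and "class_on a b (deriv_on a b n ((antideriv a b ^^ n) g)) = class_on a b g"
proof -
  let ?f = "(antideriv a b ^^ n) g"
  have cont: "continuous_on {a..b} ((antideriv a b ^^ Suc i) g)" for i
    using continuous_on_antideriv[OF square_integrable_antideriv_pow[OF g, of i]] by simp
  have deriv: "deriv_on a b j ?f x = (antideriv a b ^^ (n - j)) g x" if "j < n" "x \<in> {a..b}" for j x
    using that
  proof (induction j arbitrary: x)
    case (Suc j)
    have eq: "deriv_on a b j ?f y = antideriv a b ((antideriv a b ^^ (n - Suc j)) g) y" if "y \<in> {a..b}" for y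
    proof -
      have "n - j = Suc (n - Suc j)" using Suc.prems by simp
      then show ?thesis using Suc.IH[of y] Suc.prems that by simp
    qed
    \<comment> \<open>\<open>Suc j < n\<close> leaves at least one integration in the integrand,
      which is therefore continuous, and the pointwise derivative is available.\<close>
    obtain i where "n - Suc j = Suc i" using Suc.prems by (metis Suc_diff_Suc)
    then have "continuous_on {a..b} ((antideriv a b ^^ (n - Suc j)) g)" using cont by simp
    then show ?case
      unfolding deriv_on_Suc
      by (intro deriv_on_1_eqI[OF eq] antideriv_has_vector_derivative_continuous Suc.prems)
  qed simp
  obtain N where N: "negligible N" and top: "\<And>x. x \<in> {a..b} - N \<Longrightarrow> deriv_on a b n ?f x = g x"
  proof (cases n)
    case 0
    then show ?thesis using that[of "{}"] by simp
  next
    case (Suc m)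
    obtain N where N: "negligible N"
      "\<And>x. x \<in> {a..b} - N \<Longrightarrow> (antideriv a b g has_vector_derivative g x) (at x within {a..b})"
      using antideriv_has_vector_derivative[OF g] by blast
    have eq: "deriv_on a b m ?f y = antideriv a b g y" if "y \<in> {a..b}" for y
      using deriv[of m y] that Suc by simp
    have "deriv_on a b n ?f x = g x" if "x \<in> {a..b} - N" for x
      unfolding Suc deriv_on_Suc using eq N(2)[OF that] that
      by (intro deriv_on_1_eqI[of _ "antideriv a b g"]) (auto simp: Suc)
    then show ?thesis using that N(1) by blast
  qed
  show "class_on a b (deriv_on a b n ?f) = class_on a b g"
    using N top by (rule class_on_eq_negligible)
  have "square_integrable a b (deriv_on a b n ?f)"
    using g N top by (rule square_integrable_cong_negligible)
  moreover have "AC_on a b (deriv_on a b j ?f)" "deriv_on a b j ?f a = - deriv_on a b j ?f b" if j: "j < n" for j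
  proof -
    obtain i where i: "n - j = Suc i" using j by (metis Suc_diff_Suc)
    have eq: "deriv_on a b j ?f x = antideriv a b ((antideriv a b ^^ i) g) x" if "x \<in> {a..b}" for x
      using deriv[OF \<open>j < n\<close> that] i by simp
    show "AC_on a b (deriv_on a b j ?f)"
      using AC_on_antideriv[OF square_integrable_antideriv_pow[OF g]] eq by (rule AC_on_cong)
    show "deriv_on a b j ?f a = - deriv_on a b j ?f b"
      using eq[of a] eq[of b] antideriv_boundary ab by simp
  qed
  ultimately show "?f \<in> V_fun a b n" by (simp add: V_fun_def)
qed

lemma V_space_eq: "V_space a b n = (antideriv_class a b ^^ n) ` L2 a b"
proof (intro equalityI subsetI)
  fix u assume "u \<in> V_space a b n"
  then obtain f where f: "f \<in> V_fun a b n" "u = class_on a b f" by (auto simp: V_space_def)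
  then have "u = (antideriv_class a b ^^ n) (class_on a b (deriv_on a b n f))"
    using V_fun_deriv_on(2)[OF f(1), of 0] by simp
  then show "u \<in> (antideriv_class a b ^^ n) ` L2 a b"
    using V_fun_deriv_on(1)[OF f(1), of n] class_on_in_L2 by blast
next
  fix u assume "u \<in> (antideriv_class a b ^^ n) ` L2 a b"
  then obtain g where "square_integrable a b g" "u = class_on a b ((antideriv a b ^^ n) g)"
    by (auto simp: L2_def antideriv_class_pow)
  then show "u \<in> V_space a b n"
    using antideriv_pow_V_fun(1) by (auto simp: V_space_def)
qed

lemma dom_A_eq: "dom_A a b = V_fun a b 2"
  by (auto simp: dom_A_def V_fun_def less_2_cases_iff)

section \<open>Transfer of the abstract theorem to the differential operator\<close>

context
  fixes k :: real
  assumes k: "0 < k"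
begin

interpretation skew_operator scale_fclass "L2 a b" "L2_inner a b" "antideriv_class a b" k "3 * (b - a)"
  by (rule antideriv_class_skew_operator[OF k])

lemma op_A_eq: "op_A a b k = A"
proof -
  have Af: "class_on a b (\<lambda>x. - deriv_on a b 2 f x + of_real k * f x)
      = scale_fclass (of_real k) (class_on a b f) - class_on a b (deriv_on a b 2 f)" for f
    by (simp add: class_on_scale[symmetric] class_on_diff[symmetric])
  have A_iff: "(u, w) \<in> A \<longleftrightarrow> (\<exists>g\<in>L2 a b. u = (antideriv_class a b ^^ 2) g \<and> w = scale_fclass (of_real k) u - g)" for u w
    by (auto simp: A_def S_def numeral_2_eq_2)
  show ?thesis
  proof (intro equalityI subrelI)
    fix u w assume "(u, w) \<in> op_A a b k"
    then obtain f where f: "f \<in> V_fun a b 2" "u = class_on a b f"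
      "w = scale_fclass (of_real k) (class_on a b f) - class_on a b (deriv_on a b 2 f)"
      unfolding op_A_def Af dom_A_eq by blast
    then show "(u, w) \<in> A"
      unfolding A_iff using V_fun_deriv_on[OF f(1), of 0] class_on_in_L2[OF V_fun_deriv_on(1)[OF f(1), of 2]]
      by auto
  next
    fix u w assume "(u, w) \<in> A"
    then obtain g where g: "square_integrable a b g" "u = (antideriv_class a b ^^ 2) (class_on a b g)"
      "w = scale_fclass (of_real k) u - class_on a b g"
      unfolding A_iff by (auto simp: L2_def)
    define f where "f = (antideriv a b ^^ 2) g"
    have "f \<in> dom_A a b" "u = class_on a b f" "class_on a b g = class_on a b (deriv_on a b 2 f)"
      using antideriv_pow_V_fun[OF g(1), of 2] g(2) by (simp_all add: f_def dom_A_eq antideriv_class_pow)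
    then show "(u, w) \<in> op_A a b k"
      using g(3) unfolding op_A_def Af by auto
  qed
qed

text \<open>The choice made by \<open>V_rep\<close> is harmless. By injectivity of
  \<open>T ^^ n\<close> the class of a function in \<open>V_fun\<close> determines the class of its
  highest derivative, and that determines the classes of all lower ones, which is all the integrals
  see.\<close>

lemma V_inner_eq:
  assumes g: "g \<in> L2 a b" and h: "h \<in> L2 a b"
  shows "V_inner a b k n ((antideriv_class a b ^^ n) g) ((antideriv_class a b ^^ n) h) = B n g h"
proof -
  have rep: "V_rep a b n ((antideriv_class a b ^^ n) u) \<in> V_fun a b n"
    "class_on a b (deriv_on a b n (V_rep a b n ((antideriv_class a b ^^ n) u))) = u" if u: "u \<in> L2 a b" for u
  proof -
    let ?f = "V_rep a b n ((antideriv_class a b ^^ n) u)"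
    have "(antideriv_class a b ^^ n) u \<in> V_space a b n" using u by (auto simp: V_space_eq)
    then have "\<exists>f. f \<in> V_fun a b n \<and> class_on a b f = (antideriv_class a b ^^ n) u"
      by (auto simp: V_space_def)
    then have f: "?f \<in> V_fun a b n" "class_on a b ?f = (antideriv_class a b ^^ n) u"
      unfolding V_rep_def by (metis (mono_tags, lifting) someI_ex)+
    show "?f \<in> V_fun a b n" by (rule f(1))
    let ?v = "class_on a b (deriv_on a b n ?f)"
    have v: "?v \<in> L2 a b" using V_fun_deriv_on(1)[OF f(1), of n] by (simp add: class_on_in_L2)
    have "(antideriv_class a b ^^ n) ?v = (antideriv_class a b ^^ n) u"
      using V_fun_deriv_on(2)[OF f(1), of 0] f(2) by simp
    then have "(antideriv_class a b ^^ n) (?v - u) = 0"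
      using v u by (simp add: Tn_diff)
    then show "?v = u" using Tn_inj[of "?v - u" n] v u by simp
  qed
  define f1 f2 where "f1 = V_rep a b n ((antideriv_class a b ^^ n) g)"
    and "f2 = V_rep a b n ((antideriv_class a b ^^ n) h)"
  have term_eq: "integral\<^sup>L (lebesgue_on {a..b}) (\<lambda>x. deriv_on a b j f1 x * cnj (deriv_on a b j f2 x))
      = L2_inner a b ((antideriv_class a b ^^ (n - j)) g) ((antideriv_class a b ^^ (n - j)) h)" if "j \<le> n" for j
    using V_fun_deriv_on(2)[OF rep(1)[OF g] that] V_fun_deriv_on(2)[OF rep(1)[OF h] that] rep(2)[OF g] rep(2)[OF h]
    by (simp add: f1_def f2_def flip: L2_inner_class_on)
  have "V_inner a b k n ((antideriv_class a b ^^ n) g) ((antideriv_class a b ^^ n) h)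
      = (\<Sum>j=0..n. of_nat (n choose j) * of_real k ^ (n - j) *
          L2_inner a b ((antideriv_class a b ^^ (n - j)) g) ((antideriv_class a b ^^ (n - j)) h))"
    unfolding V_inner_def V_inner_fun_def f1_def[symmetric] f2_def[symmetric]
    by (intro sum.cong refl) (simp add: term_eq)
  \<comment> \<open>Reversal \<open>i = n - j\<close> of the summation index, with the symmetry of
    the binomial coefficients.\<close>
  also have "\<dots> = B n g h"
    unfolding B_def
    by (rule sum.reindex_bij_witness[of _ "\<lambda>i. n - i" "\<lambda>i. n - i"]) (auto simp: binomial_symmetric[symmetric])
  finally show ?thesis .
qed

lemma left_definite_space_V:
  assumes "1 \<le> n"
  shows "left_definite_space scale_fclass (L2 a b) (L2_inner a b) (op_A a b k) k n (V_space a b n) (V_inner a b k n)"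
  unfolding V_space_eq op_A_eq
  by (rule left_definite_space_range) (use assms V_inner_eq in auto)

end

end

theorem theorem4p3:
  fixes a b k :: real and n :: nat
  assumes "a < b" and "0 < k" and "1 \<le> n"
  shows "left_definite_space scale_fclass (L2 a b) (L2_inner a b) (op_A a b k) k n
           (V_space a b n) (V_inner a b k n)"
  using assms by (rule left_definite_space_V)

end
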